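(* Let $[a,b]\subset\mathbb{R}$ be a compact interval and consider the equation $$-(r^2y')'+py'+qy=\lambda^2\rho^2y,\qquad x\in[a,b],$$ where $r,\rho$ are positive functions on $[a,b]$, $p,q$ are complex-valued, $$p\in L_1[a,b],\quad q\in W_2^{-1}[a,b],\quad \rho,r\in AC[a,b]=W_1^1[a,b],$$ and $\rho'u,\ r'u,\ pu\in L_1[a,b]$, where $u=\int q\,dx\in L_2[a,b]$ is an antiderivative of $q$ in the sense of distributions. Put $$h(x)=\int\frac{q}{r\rho}\,dx,\qquad y^{[1]}=y'-h(x)\frac{\rho(x)}{r(x)}\,y ,$$ where $h\in L_2[a,b]$ is an antiderivative in the sense of distributions and $y'$ is the derivative in $x$. Solutions are understood in the quasi-derivative sense specified in the context. Then for every $s>0$ there is $R>0$ such that, for $\lambda$ in the half-plane $\Pi_s^+=\{\lambda\in\mathbb{C}:\operatorname{Im}\lambda\geq -s\}$ with $|\lambda|>R$, there exist fundamental (linearly independent) solutions $y_\pm(x,\lambda)$ of the equation of the form $$y_\pm(x,\lambda)=\frac{1}{\sqrt{r(x)\rho(x)}}\exp\Big(\frac12\int_a^x\frac{p(\tau)}{r^2(\tau)}\,d\tau\pm i\lambda\int_a^x\frac{\rho(\tau)}{r(\tau)}\,d\tau\Big)\big(1+\varphi_\pm(x,\lambda)\big),$$ whose quasi-derivatives satisfy $$y_\pm^{[1]}(x,\lambda)=\pm i\lambda\sqrt{\frac{\rho(x)}{r^3(x)}}\exp\Big(\frac12\int_a^x\frac{p(\tau)}{r^2(\tau)}\,d\tau\pm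 i\lambda\int_a^x\frac{\rho(\tau)}{r(\tau)}\,d\tau\Big)\big(1+\psi_\pm(x,\lambda)\big),$$ where the functions $\varphi_\pm$ and $\psi_\pm$ are analytic in $\lambda$ in $\Pi_s^+$ for $|\lambda|>R$, and $$|\varphi_+(x,\lambda)|+|\varphi_-(x,\lambda)|=o(1),\qquad |\psi_+(x,\lambda)|+|\psi_-(x,\lambda)|=o(1)$$ as $|\lambda|\to\infty$, $\lambda\in\Pi_s^+$, uniformly in $x\in[a,b]$. The same assertion holds with $\Pi_s^+$ replaced by the half-plane $\Pi_s^-=\{\lambda\in\mathbb{C}:\operatorname{Im}\lambda\leq s\}$.
   Context: $W_1^1[a,b]=AC[a,b]$ is the space of absolutely continuous functions; $q\in W_2^{-1}[a,b]$ means $q=u'$ in the sense of distributions with $u\in L_2[a,b]$. The product of $q$ with an absolutely continuous function is defined by the Leibniz rule; thus, up to an additive constant, $h(x)=\dfrac{u(x)}{r(x)\rho(x)}+\displaystyle\int_a^x\frac{u\,(r\rho)'}{(r\rho)^2}\,d\tau\in L_2[a,b]$. Meaning of solution. Put $t=t(x)=\int_a^x\frac{\rho(\xi)}{r(\xi)}\,d\xi$, $t\in[0,\ell]$, $\ell=\int_a^b\frac{\rho(\xi)}{r(\xi)}\,d\xi$, and regard all functions as functions of $t$. Let $\sigma(t)=\int\frac{q}{\rho^2}\,dt$, that is, $\sigma(t(x))=h(x)$, so $\sigma\in L_2[0,\ell]$. Let $$f=-\Big(\frac{\rho}{r}\Big)'_t\cdot\frac{r}{\rho}-2\frac{r'_t}{r}+\frac{p}{r\rho},\qquad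 g=f\sigma-\sigma^2,$$ where the subscript $t$ denotes differentiation in $t$; both $f,g\in L_1[0,\ell]$. A solution of the equation is a function $y(t(x))$, where $(y,w)$ is a pair of absolutely continuous functions on $[0,\ell]$ satisfying almost everywhere $$\frac{d}{dt}\begin{pmatrix}y\\ w\end{pmatrix}=\begin{pmatrix}\sigma&1\\ -\lambda^2+g&f-\sigma\end{pmatrix}\begin{pmatrix}y\\ w\end{pmatrix}.$$ Here $w=y'_t-\sigma y$ is the quasi-derivative in the variable $t$, and the quasi-derivative in the variable $x$ is $y^{[1]}=y'_x-h\frac{\rho}{r}y=\frac{\rho}{r}\,w$ (taken as the continuous representative). *)

theory Defs
  imports "HOL-Analysis.Analysis"
begin

section \<open>Function spaces on a compact interval\<close>

text \<open>
  Complex- or real-valued functions on \<open>[a,b]\<close> are total functions on the reals whose values outside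
  \<open>[a,b]\<close> are irrelevant. The space \<open>L\<^sub>1[a,b]\<close> is rendered by \<open>absolutely_integrable_on\<close>.
\<close>

definition L2_on :: "real \<Rightarrow> real \<Rightarrow> (real \<Rightarrow> complex) \<Rightarrow> bool" where
  "L2_on a b u \<longleftrightarrow>
     u \<in> borel_measurable (lebesgue_on {a..b}) \<and>
     (\<lambda>x. (cmod (u x))\<^sup>2) absolutely_integrable_on {a..b}"

text \<open>
  The epsilon-delta definition of absolute continuity; a division \<open>D\<close> of a subset of \<open>[a,b]\<close> is a
  finite family of non-overlapping compact subintervals.
\<close>

definition abs_cont_on :: "real \<Rightarrow> real \<Rightarrow> (real \<Rightarrow> 'v::real_normed_vector) \<Rightarrow> bool" where
  "abs_cont_on a b f \<longleftrightarrow>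
     (\<forall>\<epsilon>>0. \<exists>\<delta>>0. \<forall>D S. D division_of S \<and> S \<subseteq> {a..b} \<and> (\<Sum>K\<in>D. measure lborel K) < \<delta>
        \<longrightarrow> (\<Sum>K\<in>D. norm (f (Sup K) - f (Inf K))) < \<epsilon>)"

section \<open>Distributions on an open interval\<close>

definition smooth :: "(real \<Rightarrow> complex) \<Rightarrow> bool" where
  "smooth \<phi> \<longleftrightarrow> (\<forall>n x. ((\<lambda>f x. vector_derivative f (at x)) ^^ n) \<phi> differentiable (at x))"

definition test_function :: "real \<Rightarrow> real \<Rightarrow> (real \<Rightarrow> complex) \<Rightarrow> bool" where
  "test_function a b \<phi> \<longleftrightarrow>
     smooth \<phi> \<and> (\<exists>K. compact K \<and> K \<subseteq> {a<..<b} \<and> (\<forall>x. x \<notin> K \<longrightarrow> \<phi> x = 0))"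

text \<open>Only the values on test functions matter.\<close>

type_synonym distribution = "(real \<Rightarrow> complex) \<Rightarrow> complex"

definition distr_deriv :: "real \<Rightarrow> real \<Rightarrow> (real \<Rightarrow> complex) \<Rightarrow> distribution" where
  "distr_deriv a b u \<phi> = - integral {a..b} (\<lambda>x. u x * vector_derivative \<phi> (at x))"

definition distr_antideriv :: "real \<Rightarrow> real \<Rightarrow> (real \<Rightarrow> complex) \<Rightarrow> distribution \<Rightarrow> bool" where
  "distr_antideriv a b u q \<longleftrightarrow> (\<forall>\<phi>. test_function a b \<phi> \<longrightarrow> q \<phi> = distr_deriv a b u \<phi>)"

definition W2_minus1 :: "real \<Rightarrow> real \<Rightarrow> distribution set" where
  "W2_minus1 a b = {q. \<exists>u. L2_on a b u \<and> distr_antideriv a b u q}"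

text \<open>
  The product of an absolutely continuous function \<open>m\<close> with the distribution \<open>q = u'\<close>, defined by the
  Leibniz rule \<open>m q = (m u)' - m' u\<close>. It does not change if a constant is added to \<open>u\<close>.
\<close>

definition leibniz_product :: "real \<Rightarrow> real \<Rightarrow> (real \<Rightarrow> real) \<Rightarrow> (real \<Rightarrow> complex) \<Rightarrow> distribution" where
  "leibniz_product a b m u \<phi> =
     distr_deriv a b (\<lambda>x. of_real (m x) * u x) \<phi>
     - integral {a..b} (\<lambda>x. of_real (deriv m x) * u x * \<phi> x)"

section \<open>The equation in the variable \<open>t\<close>\<close>

definition tvar :: "real \<Rightarrow> (real \<Rightarrow> real) \<Rightarrow> (real \<Rightarrow> real) \<Rightarrow> real \<Rightarrow> real" where
  "tvar a r \<rho> x = integral {a..x} (\<lambda>\<xi>. \<rho> \<xi> / r \<xi>)"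

definition xvar :: "real \<Rightarrow> real \<Rightarrow> (real \<Rightarrow> real) \<Rightarrow> (real \<Rightarrow> real) \<Rightarrow> real \<Rightarrow> real" where
  "xvar a b r \<rho> = the_inv_into {a..b} (tvar a r \<rho>)"

definition sigma_coeff ::
    "real \<Rightarrow> real \<Rightarrow> (real \<Rightarrow> real) \<Rightarrow> (real \<Rightarrow> real) \<Rightarrow> (real \<Rightarrow> complex) \<Rightarrow> real \<Rightarrow> complex" where
  "sigma_coeff a b r \<rho> h t = h (xvar a b r \<rho> t)"

definition f_coeff ::
    "real \<Rightarrow> real \<Rightarrow> (real \<Rightarrow> real) \<Rightarrow> (real \<Rightarrow> real) \<Rightarrow> (real \<Rightarrow> complex) \<Rightarrow> real \<Rightarrow> complex" where
  "f_coeff a b r \<rho> p t =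
     (let X = xvar a b r \<rho> in
        - of_real (deriv (\<lambda>s. \<rho> (X s) / r (X s)) t * (r (X t) / \<rho> (X t)))
        - 2 * of_real (deriv (\<lambda>s. r (X s)) t / r (X t))
        + p (X t) / of_real (r (X t) * \<rho> (X t)))"

definition g_coeff ::
    "real \<Rightarrow> real \<Rightarrow> (real \<Rightarrow> real) \<Rightarrow> (real \<Rightarrow> real) \<Rightarrow> (real \<Rightarrow> complex) \<Rightarrow> (real \<Rightarrow> complex)
      \<Rightarrow> real \<Rightarrow> complex" where
  "g_coeff a b r \<rho> p h t =
     f_coeff a b r \<rho> p t * sigma_coeff a b r \<rho> h t - (sigma_coeff a b r \<rho> h t)\<^sup>2"

text \<open>
  \<open>y\<close> is a solution for the spectral parameter \<open>lam\<close> and \<open>y1\<close> is the continuous representative of its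
  quasi-derivative \<open>y' - h (\<rho> / r) y\<close> (derivative in \<open>x\<close>). The first equation of the system
  reads \<open>W = Y' - \<sigma> Y\<close> (derivative in \<open>t\<close>), so \<open>W\<close>, being continuous, is determined by \<open>Y\<close>.
\<close>

definition solution_with_quasi_deriv ::
    "real \<Rightarrow> real \<Rightarrow> (real \<Rightarrow> real) \<Rightarrow> (real \<Rightarrow> real) \<Rightarrow> (real \<Rightarrow> complex) \<Rightarrow> (real \<Rightarrow> complex)
      \<Rightarrow> complex \<Rightarrow> (real \<Rightarrow> complex) \<Rightarrow> (real \<Rightarrow> complex) \<Rightarrow> bool" where
  "solution_with_quasi_deriv a b r \<rho> p h lam y y1 \<longleftrightarrow>
     (\<exists>Y W.
        abs_cont_on 0 (tvar a r \<rho> b) Y \<and> abs_cont_on 0 (tvar a r \<rho> b) W \<and>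
        (AE t in lebesgue_on {0..tvar a r \<rho> b}.
           (Y has_vector_derivative (sigma_coeff a b r \<rho> h t * Y t + W t)) (at t) \<and>
           (W has_vector_derivative
              ((- lam\<^sup>2 + g_coeff a b r \<rho> p h t) * Y t
               + (f_coeff a b r \<rho> p t - sigma_coeff a b r \<rho> h t) * W t)) (at t)) \<and>
        (\<forall>x\<in>{a..b}. y x = Y (tvar a r \<rho> x) \<and> y1 x = of_real (\<rho> x / r x) * W (tvar a r \<rho> x)))"

definition lin_indep_on :: "real \<Rightarrow> real \<Rightarrow> (real \<Rightarrow> complex) \<Rightarrow> (real \<Rightarrow> complex) \<Rightarrow> bool" where
  "lin_indep_on a b y z \<longleftrightarrow>
     (\<forall>c d. (\<forall>x\<in>{a..b}. c * y x + d * z x = 0) \<longrightarrow> c = 0 \<and> d = 0)"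

end

theory Submission
  imports Defs "HOL-Complex_Analysis.Complex_Analysis"
begin

text \<open>
  Work in the variable \<open>x\<close>, with \<open>\<kappa> = \<rho>/r\<close>, \<open>T(x) = \<integral>\<^sub>a\<^sup>x \<kappa>\<close> and \<open>F = - \<rho>'/\<rho> - r'/r + p/r\<^sup>2\<close>, so that \<open>F\<close> is \<open>\<kappa>\<close> times
  the coefficient \<open>f\<close>. With \<open>E' = F E/2\<close> and
  \<open>y = E e\<^sup>i\<^sup>\<lambda>\<^sup>T (1 + x\<^sub>1 + x\<^sub>2)\<close>, \<open>w = i \<lambda> E e\<^sup>i\<^sup>\<lambda>\<^sup>T (1 + x\<^sub>1 - x\<^sub>2)\<close> the system becomes
  \<open>x\<^sub>1' = \<alpha> x\<^sub>2 + (\<gamma>/2i\<lambda>) (1 + x\<^sub>1 + x\<^sub>2)\<close>,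
  \<open>x\<^sub>2' = - 2i\<lambda> \<kappa> x\<^sub>2 + \<alpha> (1 + x\<^sub>1) - (\<gamma>/2i\<lambda>) (1 + x\<^sub>1 + x\<^sub>2)\<close>
  with \<open>\<alpha> = \<kappa> h - F/2\<close> and \<open>\<gamma> = F h - \<kappa> h\<^sup>2\<close> integrable. The solution vanishing at \<open>a\<close> is small for
  \<open>Im \<lambda> \<le> s\<close>: the variation of constants formula for \<open>x\<^sub>2\<close> contains the oscillatory integral of
  \<open>e\<^sup>-\<^sup>2\<^sup>i\<^sup>\<lambda>\<^sup>(\<^sup>T\<^sup>(\<^sup>x\<^sup>)\<^sup>-\<^sup>T\<^sup>(\<^sup>\<tau>\<^sup>)\<^sup>) \<alpha>(\<tau>)\<close>, which tends to 0 uniformly by the Riemann-Lebesgue argument, and Gronwall's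
  inequality does the rest. The solution vanishing at \<open>b\<close> is its mirror image and serves \<open>Im \<lambda> \<ge> -s\<close>; replacing \<open>\<lambda>\<close> by
  \<open>-\<lambda>\<close> turns \<open>y\<^sub>+\<close> into \<open>y\<^sub>-\<close>.

  That \<open>F h\<close> is integrable follows from \<open>h = u/(r\<rho>) + continuous\<close> almost everywhere (du Bois-Reymond). That an absolutely
  continuous \<open>G\<close> is the integral of its derivative is obtained as follows. The lower limit \<open>v\<close> of its
  absolute difference quotients is integrable by Fatou's lemma; a Vitali covering gives \<open>\<bar>G(d) - G(c)\<bar> \<le> \<integral>\<^sub>c\<^sup>d v\<close>;
  hence \<open>G + \<integral>v\<close> is increasing, and for increasing functions the same two inequalities are equalities.
\<close>

section \<open>Lebesgue differentiation\<close>

text \<open>Since \<open>h\<close> is only square integrable, there is no genuine second-order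
  equation to work with: the coefficients of the system are merely integrable, identities between
  derivatives hold only almost everywhere, and the natural result is o(1) without a rate. The
  amplitudes come from diagonalising the leading matrix with rows (0, 1) and (-lam^2, 0): after
  removal of \<open>E\<close> and the phase, 1 + x1 and x2 are the components along its eigenvectors
  (1, i lam) and (1, -i lam). The terms with \<gamma> carry a factor 1/lam, but the coupling
  \<alpha> between the two components does not decay. Only its inhomogeneous contribution has to be
  made small by oscillation; the rest goes into a Gronwall kernel that does not depend on lam. The
  exponential in the variation of constants formula is bounded for Im lam bounded above when the
  system is solved to the right, so the half-plane decides the starting endpoint, and the two
  solutions wanted in one half-plane start from opposite ends. Linear independence is read off from
  values at two points instead of a Wronskian.\<close>

lemma sum_division_telescope:
  fixes F :: "real \<Rightarrow> 'a::real_normed_vector"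
  assumes "a \<le> b" "\<D> division_of {a..b}"
  shows "(\<Sum>K\<in>\<D>. F (Sup K) - F (Inf K)) = F b - F a"
proof -
  note D = division_ofD[OF assms(2)]
  let ?p = "(\<lambda>K. (Inf K, K)) ` \<D>"
  have "?p tagged_division_of {a..b}"
  proof (rule tagged_division_ofI)
    show "x \<in> K" if "(x, K) \<in> ?p" for x K
    proof -
      from that D have K: "K \<in> \<D>" "x = Inf K" by auto
      obtain c d where "K = cbox c d" "K \<noteq> {}" using D(3,4)[OF K(1)] by metis
      then show ?thesis using K by auto
    qed
    show "finite ?p" "\<And>x K. (x, K) \<in> ?p \<Longrightarrow> K \<subseteq> {a..b}"
      "\<And>x K. (x, K) \<in> ?p \<Longrightarrow> \<exists>a b. K = cbox a b" using D(1,2,4) by auto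
    show "\<And>x1 K1 x2 K2. (x1, K1) \<in> ?p \<Longrightarrow> (x2, K2) \<in> ?p \<Longrightarrow> (x1, K1) \<noteq> (x2, K2) \<Longrightarrow>
      interior K1 \<inter> interior K2 = {}" using D(5) by blast
    have "{K. \<exists>x. (x, K) \<in> ?p} = \<D>" by auto
    then show "\<Union>{K. \<exists>x. (x, K) \<in> ?p} = {a..b}" using D(6) by simp
  qed
  from additive_tagged_division_1[OF assms(1) this, of F]
  show ?thesis by (simp add: sum.reindex inj_on_def)
qed

lemma content_eq_Sup_Inf:
  assumes "\<D> division_of S" "K \<in> \<D>"
  shows "measure lborel K = Sup K - Inf (K :: real set)" "Inf K \<le> Sup K" "Inf K \<in> S" "Sup K \<in> S" "K = {Inf K..Sup K}"
proof -
  obtain c d where "K = cbox c d" "K \<noteq> {}" "K \<subseteq> S" using division_ofD(2-4)[OF assms] by metis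
  then show "measure lborel K = Sup K - Inf K" "Inf K \<le> Sup K" "Inf K \<in> S" "Sup K \<in> S" "K = {Inf K..Sup K}" by auto
qed

text \<open>Balls on the line are intervals, so the Vitali covering theorem yields countably many
  disjoint members; as all of them lie in \<open>{a..b}\<close>, finitely many exhaust the measure
  of the union up to \<epsilon>. The remainder \<open>T\<close> collects the discarded tail and the
  null set missed by the covering. A point may sit anywhere in its interval, which later permits
  one-sided intervals.\<close>

lemma vitali_finite:
  fixes P :: "real \<Rightarrow> real \<Rightarrow> bool"
  assumes fine: "\<And>x \<eta>. x \<in> S \<Longrightarrow> \<eta> > 0 \<Longrightarrow> \<exists>c d. c \<le> x \<and> x \<le> d \<and> c < d \<and> d - c < \<eta> \<and> P c d"
    and sub: "\<And>c d. P c d \<Longrightarrow> a \<le> c \<and> d \<le> b"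
    and "\<epsilon> > 0"
  obtains \<D> T where "\<D> division_of \<Union>\<D>" "\<Union>\<D> \<subseteq> {a..b}"
    "\<And>K. K \<in> \<D> \<Longrightarrow> \<exists>c d. c < d \<and> K = {c..d} \<and> P c d"
    "T \<in> lmeasurable" "measure lebesgue T < \<epsilon>" "S \<subseteq> T \<union> \<Union>\<D>"
proof -
  define I where "I = {i::real\<times>real. fst i < snd i \<and> P (fst i) (snd i)}"
  define m where "m = (\<lambda>i::real\<times>real. (fst i + snd i) / 2)"
  define r where "r = (\<lambda>i::real\<times>real. (snd i - fst i) / 2)"
  have cb: "cball (m i) (r i) = {fst i..snd i}" for i
    by (auto simp: cball_eq_atLeastAtMost m_def r_def field_simps)
  obtain C where C: "countable C" "C \<subseteq> I"
     "pairwise (\<lambda>i j. disjnt (cball (m i) (r i)) (cball (m j) (r j))) C"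
     "negligible (S - (\<Union>i \<in> C. cball (m i) (r i)))"
  proof (rule Vitali_covering_theorem_cballs[of I r S m])
    show "0 < r i" if "i \<in> I" for i using that by (auto simp: I_def r_def)
    show "\<exists>i. i \<in> I \<and> x \<in> cball (m i) (r i) \<and> r i < d" if xd: "x \<in> S" "0 < d" for x d
    proof -
      obtain c e where "c \<le> x" "x \<le> e" "c < e" "e - c < d" "P c e" using fine[OF xd] by blast
      then show ?thesis by (intro exI[of _ "(c,e)"]) (auto simp: I_def cb, auto simp: r_def)
    qed
  qed
  define \<C> where "\<C> = (\<lambda>i. {fst i..snd i}) ` C"
  have C': "countable \<C>" "\<And>K. K \<in> \<C> \<Longrightarrow> K \<in> lmeasurable" using C by (auto simp: \<C>_def)
  have Csub: "\<Union>\<C> \<subseteq> {a..b}" using C(2) sub by (force simp: \<C>_def I_def)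
  have Um: "\<Union>\<D> \<in> lmeasurable" if "\<D> \<subseteq> \<C>" for \<D>
  proof -
    have "\<Union>\<D> \<in> sets lebesgue"
      using that C' by (intro sets.countable_Union) (auto intro: countable_subset)
    moreover have "\<Union>\<D> \<subseteq> cbox a b" using that Csub by auto
    ultimately show ?thesis by (meson bounded_cbox bounded_subset bounded_set_imp_lmeasurable)
  qed
  obtain \<D> where D: "\<D> \<subseteq> \<C>" "finite \<D>" "measure lebesgue (\<Union>\<C>) - \<epsilon> < measure lebesgue (\<Union>\<D>)"
  proof (rule measure_countable_Union_approachable[OF C'(1) \<open>\<epsilon> > 0\<close> C'(2)])
    show "measure lebesgue (\<Union>D') \<le> measure lebesgue {a..b}" if "D' \<subseteq> \<C>" for D'
      using that Csub Um[OF that] by (intro measure_mono_fmeasurable) auto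
  qed auto
  define T where "T = (\<Union>\<C> - \<Union>\<D>) \<union> (S - (\<Union>i \<in> C. cball (m i) (r i)))"
  have Ueq: "\<Union>\<C> = (\<Union>i \<in> C. cball (m i) (r i))" by (auto simp: \<C>_def cb)
  show ?thesis
  proof
    show "\<D> division_of \<Union>\<D>"
    proof (rule division_ofI)
      fix K assume "K \<in> \<D>"
      then have "K \<in> \<C>" using D(1) by blast
      then obtain i where i: "i \<in> C" "K = {fst i..snd i}" unfolding \<C>_def by blast
      then have "K = cbox (fst i) (snd i)" by simp
      then show "K \<subseteq> \<Union>\<D>" "K \<noteq> {}" "\<exists>a b. K = cbox a b"
        using subsetD[OF C(2) i(1)] \<open>K \<in> \<D>\<close> by (auto simp: I_def)
      fix L assume "L \<in> \<D>" "K \<noteq> L"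
      then have "L \<in> \<C>" using D(1) by blast
      then obtain j where j: "j \<in> C" "L = {fst j..snd j}" unfolding \<C>_def by blast
      have "i \<noteq> j" using \<open>K \<noteq> L\<close> i j by auto
      then have "disjnt K L" using C(3) i j by (auto simp: pairwise_def cb)
      then show "interior K \<inter> interior L = {}"
        using interior_subset[of K] interior_subset[of L] by (auto simp: disjnt_def)
    qed (use D in auto)
    show "\<Union>\<D> \<subseteq> {a..b}" using D Csub by auto
    show "\<exists>c d. c < d \<and> K = {c..d} \<and> P c d" if "K \<in> \<D>" for K
    proof -
      have "K \<in> \<C>" using D(1) that by blast
      then obtain i where i: "i \<in> C" "K = {fst i..snd i}" unfolding \<C>_def by blast
      then show ?thesis using subsetD[OF C(2) i(1)] by (auto simp: I_def)
    qed
    have neg: "negligible (S - (\<Union>i \<in> C. cball (m i) (r i)))" by fact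
    have md: "\<Union>\<C> - \<Union>\<D> \<in> lmeasurable" using Um D by (meson fmeasurable.Diff order_refl)
    then show "T \<in> lmeasurable" unfolding T_def
      by (rule fmeasurable.Un[OF _ negligible_imp_measurable[OF neg]])
    have "measure lebesgue T \<le> measure lebesgue (\<Union>\<C> - \<Union>\<D>) + measure lebesgue (S - (\<Union>i \<in> C. cball (m i) (r i)))"
      unfolding T_def by (rule measure_Un_le[OF fmeasurableD[OF md] negligible_imp_sets[OF neg]])
    also have "\<dots> = measure lebesgue (\<Union>\<C> - \<Union>\<D>)" using negligible_imp_measure0[OF neg] by simp
    also have "\<dots> = measure lebesgue (\<Union>\<C>) - measure lebesgue (\<Union>\<D>)"
      using Um[of \<C>] Um[OF D(1)] D(1) by (intro measurable_measure_Diff) auto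
    also have "\<dots> < \<epsilon>" using D by simp
    finally show "measure lebesgue T < \<epsilon>" .
    show "S \<subseteq> T \<union> \<Union>\<D>" using Ueq by (auto simp: T_def)
  qed
qed

lemma measure_Union_division:
  fixes S :: "real set"
  assumes "\<D> division_of S"
  shows "S \<in> lmeasurable" "measure lebesgue S = (\<Sum>K\<in>\<D>. measure lborel K)"
proof -
  have "compact S"
    using division_ofD(1,4,6)[OF assms] by (metis compact_Union compact_cbox)
  then show "S \<in> lmeasurable" by (rule lmeasurable_compact)
  show "measure lebesgue S = (\<Sum>K\<in>\<D>. measure lborel K)"
  proof -
    have "measure lebesgue K = measure lborel K" if "K \<in> \<D>" for K
      using division_ofD(4)[OF assms that] by auto
    moreover have "measure lebesgue S = measure lborel S"
      using \<open>compact S\<close> by (simp add: borel_compact)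
    ultimately show ?thesis using content_division[OF assms] by (metis (no_types, lifting) sum.cong)
  qed
qed

text \<open>Henstock's lemma controls the sum of the errors |K| f x - (integral of f over K) over
  every fine partial division, so plain gauge integrability suffices. If difference quotients at the
  points of a set fail by more than 1/(n+1) at arbitrarily small scales, a Vitali family of failing
  intervals has total length below n+1 times the Henstock error, so the set is null.\<close>

theorem indefinite_integral_has_vector_derivative_AE:
  fixes f :: "real \<Rightarrow> 'a::euclidean_space"
  assumes f: "f integrable_on {a..b}"
  obtains N where "negligible N"
    "\<And>x. x \<in> {a<..<b} - N \<Longrightarrow> ((\<lambda>x. integral {a..x} f) has_vector_derivative f x) (at x)"
proof -
  define F where "F = (\<lambda>x. integral {a..x} f)"
  \<comment> \<open>The point \<open>x\<close> is forced to be an endpoint: failure of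
    \<open>Q\<close> at all small scales is then exactly the derivative estimate at
    \<open>x\<close>, from the left and from the right.\<close>
  define Q where "Q = (\<lambda>(n::nat) x c d. (x = c \<or> x = d) \<and> a \<le> c \<and> c < d \<and> d \<le> b \<and>
        (d - c) / Suc n < norm (F d - F c - (d - c) *\<^sub>R f x))"
  define N where "N = (\<lambda>n. {x. \<forall>\<eta>>0. \<exists>c d. d - c < \<eta> \<and> Q n x c d})"
  have "negligible (N n)" for n
    unfolding negligible_outer_le
  proof (intro allI impI)
    fix e :: real assume "e > 0"
    \<comment> \<open>Half of \<open>e\<close> pays for the Vitali remainder, the other half for the
      failing intervals, whose total length is below \<open>Suc n\<close> times the Henstock
      error.\<close>
    define e' where "e' = e / 2 / Suc n"
    have "e' > 0" using \<open>e > 0\<close> by (simp add: e'_def)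
    from f have f': "f integrable_on cbox a b" by simp
    obtain \<gamma> where \<gamma>: "gauge \<gamma>"
      "\<And>p. \<lbrakk>p tagged_partial_division_of (cbox a b); \<gamma> fine p\<rbrakk> \<Longrightarrow>
             (\<Sum>(x,k)\<in>p. norm(measure lborel k *\<^sub>R f x - integral k f)) < e'"
      using Henstock_lemma[OF f' \<open>e' > 0\<close>] by blast
    define P where "P = (\<lambda>c d. \<exists>x. Q n x c d \<and> {c..d} \<subseteq> \<gamma> x)"
    obtain \<D> T where D: "\<D> division_of \<Union>\<D>" "\<Union>\<D> \<subseteq> {a..b}"
      "\<And>K. K \<in> \<D> \<Longrightarrow> \<exists>c d. c < d \<and> K = {c..d} \<and> P c d"
      "T \<in> lmeasurable" "measure lebesgue T < e / 2" "N n \<subseteq> T \<union> \<Union>\<D>"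
    proof (rule vitali_finite[of "N n" P a b "e/2"])
      show "\<exists>c d. c \<le> x \<and> x \<le> d \<and> c < d \<and> d - c < \<eta> \<and> P c d" if x: "x \<in> N n" and "\<eta> > 0" for x \<eta>
      proof -
        have "open (\<gamma> x)" "x \<in> \<gamma> x" using \<gamma>(1) by (auto simp: gauge_def)
        then obtain \<delta> where \<delta>: "\<delta> > 0" "ball x \<delta> \<subseteq> \<gamma> x" using open_contains_ball by blast
        have "min \<eta> \<delta> > 0" using \<delta> \<open>\<eta> > 0\<close> by simp
        then obtain c d where cd: "d - c < min \<eta> \<delta>" "Q n x c d" using x unfolding N_def by blast
        have "{c..d} \<subseteq> ball x \<delta>" using cd by (auto simp: Q_def dist_real_def)
        then show ?thesis using cd \<delta> by (intro exI[of _ c] exI[of _ d]) (auto simp: P_def Q_def)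
      qed
    qed (use \<open>e > 0\<close> in \<open>auto simp: P_def Q_def\<close>)
    \<comment> \<open>The Vitali family remembers only that each interval has some failing endpoint;
      choosing one supplies the tags.\<close>
    define t where "t = (\<lambda>K. SOME x. Q n x (Inf K) (Sup K) \<and> K \<subseteq> \<gamma> x)"
    have t: "Q n (t K) (Inf K) (Sup K) \<and> K \<subseteq> \<gamma> (t K)" if K: "K \<in> \<D>" for K
    proof -
      obtain c d where "c < d" "K = {c..d}" "P c d" using D(3)[OF K] by blast
      then have "\<exists>x. Q n x (Inf K) (Sup K) \<and> K \<subseteq> \<gamma> x" by (auto simp: P_def)
      then show ?thesis unfolding t_def by (rule someI_ex)
    qed
    let ?p = "(\<lambda>K. (t K, K)) ` \<D>"
    have "?p tagged_partial_division_of cbox a b"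
      unfolding tagged_partial_division_of_def
    proof (intro conjI allI impI)
      show "finite ?p" using D(1) by auto
      fix x K assume xK: "(x, K) \<in> ?p"
      then have K: "K \<in> \<D>" "x = t K" by auto
      note c = content_eq_Sup_Inf[OF D(1) K(1)]
      show "x \<in> K" using t[OF K(1)] K(2) c(2,5) unfolding Q_def by (metis atLeastAtMost_iff order_refl)
      show "K \<subseteq> cbox a b" using D(2) K(1) by auto
      show "\<exists>a b. K = cbox a b" using division_ofD(4)[OF D(1) K(1)] .
    next
      fix x1 K1 x2 K2 assume "(x1, K1) \<in> ?p \<and> (x2, K2) \<in> ?p \<and> (x1, K1) \<noteq> (x2, K2)"
      then show "interior K1 \<inter> interior K2 = {}" using division_ofD(5)[OF D(1)] by blast
    qed
    moreover have "\<gamma> fine ?p" using t by (auto simp: fine_def)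
    ultimately have "(\<Sum>(x,k)\<in>?p. norm(measure lborel k *\<^sub>R f x - integral k f)) < e'" by (rule \<gamma>(2))
    then have s: "(\<Sum>K\<in>\<D>. norm(measure lborel K *\<^sub>R f (t K) - integral K f)) < e'"
      by (simp add: sum.reindex inj_on_def)
    have "measure lborel K / Suc n \<le> norm(measure lborel K *\<^sub>R f (t K) - integral K f)" if K: "K \<in> \<D>" for K
    proof -
      note c = content_eq_Sup_Inf[OF D(1) K]
      note q = t[OF K, unfolded Q_def]
      have "f integrable_on {a..Sup K}" by (rule integrable_on_subinterval[OF f]) (use q in auto)
      then have "integral {a..Inf K} f + integral {Inf K..Sup K} f = integral {a..Sup K} f"
        using q c(2) by (intro Henstock_Kurzweil_Integration.integral_combine) auto
      then have "integral K f = F (Sup K) - F (Inf K)" using c(5) by (simp add: F_def algebra_simps)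
      then show ?thesis using q c(1) by (simp add: norm_minus_commute)
    qed
    then have "(\<Sum>K\<in>\<D>. measure lborel K / Suc n) \<le> (\<Sum>K\<in>\<D>. norm(measure lborel K *\<^sub>R f (t K) - integral K f))"
      by (rule sum_mono)
    with s have "(\<Sum>K\<in>\<D>. measure lborel K) / Suc n < e'" by (simp add: sum_divide_distrib)
    then have "(\<Sum>K\<in>\<D>. measure lborel K) < e / 2" unfolding e'_def by (subst (asm) divide_less_cancel) auto
    then have "measure lebesgue (T \<union> \<Union>\<D>) \<le> e"
      using D(4,5) measure_Union_division[OF D(1)] measure_Un_le[of T lebesgue "\<Union>\<D>"] by (auto simp: fmeasurableD)
    then show "\<exists>T. N n \<subseteq> T \<and> T \<in> lmeasurable \<and> measure lebesgue T \<le> e"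
      using D(4,6) measure_Union_division[OF D(1)] by (intro exI[of _ "T \<union> \<Union>\<D>"]) auto
  qed
  then have neg: "negligible (\<Union>n. N n)" by (intro negligible_countable_Union) auto
  show ?thesis
  proof (rule that[OF neg])
    fix x assume x: "x \<in> {a<..<b} - (\<Union>n. N n)"
    have "(F has_vector_derivative f x) (at x)"
      unfolding has_vector_derivative_def has_derivative_at_alt
    proof (intro conjI allI impI)
      show "bounded_linear (\<lambda>h. h *\<^sub>R f x)" by (rule bounded_linear_scaleR_left)
      fix e :: real assume "e > 0"
      then obtain n where n: "1 / Suc n < e" by (meson nat_approx_posE)
      from x have "x \<notin> N n" by blast
      then have "\<exists>\<eta>>0. \<forall>c d. d - c < \<eta> \<longrightarrow> \<not> Q n x c d" unfolding N_def by blast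
      then obtain \<eta> where \<eta>: "\<eta> > 0" "\<And>c d. d - c < \<eta> \<Longrightarrow> \<not> Q n x c d" by blast
      \<comment> \<open>The distances to both ends enter because \<open>Q\<close> speaks only of
        intervals inside \<open>{a..b}\<close>.\<close>
      define \<delta> where "\<delta> = Min {\<eta>, x - a, b - x}"
      have \<delta>: "\<delta> > 0" "\<delta> \<le> \<eta>" "\<delta> \<le> x - a" "\<delta> \<le> b - x" using \<eta> x by (auto simp: \<delta>_def)
      have le: "\<bar>y - x\<bar> / Suc n \<le> e * \<bar>y - x\<bar>" for y
        using mult_right_mono[of "1 / Suc n" e "\<bar>y - x\<bar>"] n by simp
      have "norm (F y - F x - (y - x) *\<^sub>R f x) \<le> e * norm (y - x)" if "norm (y - x) < \<delta>" for y
      proof (cases y x rule: linorder_cases)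
        case less
        then have "\<not> Q n x y x" using \<eta>(2)[of x y] that \<delta> by auto
        then have "norm (F x - F y - (x - y) *\<^sub>R f x) \<le> (x - y) / Suc n" using less that \<delta> by (auto simp: Q_def)
        moreover have "F x - F y - (x - y) *\<^sub>R f x = - (F y - F x - (y - x) *\<^sub>R f x)" by (simp add: algebra_simps)
        ultimately show ?thesis using less le[of y] by (simp only: norm_minus_cancel) auto
      next
        case greater
        then have "\<not> Q n x x y" using \<eta>(2)[of y x] that \<delta> by auto
        then have "norm (F y - F x - (y - x) *\<^sub>R f x) \<le> (y - x) / Suc n" using greater that \<delta> by (auto simp: Q_def)
        then show ?thesis using greater le[of y] by auto
      qed auto
      then show "\<exists>d>0. \<forall>y. norm (y - x) < d \<longrightarrow> norm (F y - F x - (y - x) *\<^sub>R f x) \<le> e * norm (y - x)"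
        using \<delta>(1) by blast
    qed
    then show "((\<lambda>x. integral {a..x} f) has_vector_derivative f x) (at x)" by (simp add: F_def)
  qed
qed

section \<open>Absolutely continuous functions\<close>

text \<open>Two truncations at one level: cutting \<open>f\<close> at height \<open>k\<close> costs
  little by dominated convergence, and cutting the continuous functions that converge to
  \<open>f\<close> almost everywhere at the same height provides the constant bound
  \<open>2 * k\<close> for the second limit.\<close>

lemma L1_approx_continuous:
  fixes f :: "real \<Rightarrow> real"
  assumes f: "f absolutely_integrable_on {a..b}" and "e > 0"
  obtains g where "continuous_on UNIV g" "integral {a..b} (\<lambda>x. \<bar>f x - g x\<bar>) < e"
proof -
  define cl where "cl = (\<lambda>M y::real. max (- M) (min M y))"
  have cl0: "\<bar>cl M y\<bar> \<le> \<bar>M\<bar>" "\<bar>y - cl M y\<bar> \<le> \<bar>y\<bar>" if "M \<ge> 0" for M y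
    using that by (auto simp: cl_def)
  have ccl: "continuous_on S (cl M)" for M S unfolding cl_def by (intro continuous_intros)
  have fm: "f \<in> borel_measurable (lebesgue_on {a..b})"
    using f by (rule absolutely_integrable_imp_borel_measurable) simp
  have clm: "(\<lambda>x. cl M (f x)) \<in> borel_measurable (lebesgue_on {a..b})" for M
    using fm unfolding cl_def by measurable
  have nfi: "(\<lambda>x. norm (f x)) integrable_on {a..b}" using f by (simp add: absolutely_integrable_on_def)
  have I1: "(\<lambda>x. \<bar>f x - cl M (f x)\<bar>) integrable_on {a..b}" if "M \<ge> 0" for M
  proof (rule measurable_bounded_by_integrable_imp_integrable[OF _ nfi])
    show "(\<lambda>x. \<bar>f x - cl M (f x)\<bar>) \<in> borel_measurable (lebesgue_on {a..b})"
      using fm clm[of M] by measurable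
    show "norm \<bar>f x - cl M (f x)\<bar> \<le> norm (f x)" for x using cl0(2)[OF that, of "f x"] by simp
  qed simp
  have "(\<lambda>k::nat. integral {a..b} (\<lambda>x. \<bar>f x - cl (real k) (f x)\<bar>)) \<longlonglongrightarrow> integral {a..b} (\<lambda>x. 0)"
  proof (rule dominated_convergence(2)[where h="\<lambda>x. norm (f x)"])
    show "(\<lambda>k. \<bar>f x - cl (real k) (f x)\<bar>) \<longlonglongrightarrow> 0" for x
    proof (rule tendsto_eventually)
      obtain k0 :: nat where "\<bar>f x\<bar> \<le> k0" using real_arch_simple by blast
      then show "\<forall>\<^sub>F k in sequentially. \<bar>f x - cl (real k) (f x)\<bar> = 0"
        by (intro eventually_sequentiallyI[of k0]) (auto simp: cl_def)
    qed
    show "norm \<bar>f x - cl (real k) (f x)\<bar> \<le> norm (f x)" for k x using cl0(2)[of k "f x"] by simp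
  qed (use I1 nfi in auto)
  then have "\<forall>\<^sub>F k in sequentially. integral {a..b} (\<lambda>x. \<bar>f x - cl (real k) (f x)\<bar>) < e / 2"
    using \<open>e > 0\<close> by (intro order_tendstoD(2)) auto
  then obtain k where k: "integral {a..b} (\<lambda>x. \<bar>f x - cl (real k) (f x)\<bar>) < e / 2"
    by (auto simp: eventually_sequentially)
  have "(\<lambda>x. if x \<in> {a..b} then f x else 0) \<in> borel_measurable lebesgue"
    using fm by (subst borel_measurable_if) auto
  then have "(\<lambda>x. if x \<in> {a..b} then f x else 0) measurable_on UNIV"
    by (rule lebesgue_measurable_imp_measurable_on_real) simp
  then obtain N g where N: "negligible N" and g: "\<And>n. continuous_on UNIV (g n)"
    "\<And>x. x \<notin> N \<Longrightarrow> (\<lambda>n::nat. g n x) \<longlonglongrightarrow> (if x \<in> {a..b} then f x else 0)"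
    unfolding measurable_on_def by auto
  have cg: "continuous_on S (\<lambda>x. cl k (g n x))" for n S
    using continuous_on_compose2[OF ccl continuous_on_subset[OF g(1)]] by auto
  have I2: "(\<lambda>x. \<bar>cl k (f x) - cl k (g n x)\<bar>) integrable_on {a..b}" for n
  proof (rule measurable_bounded_by_integrable_imp_integrable[where g="\<lambda>x. 2 * real k"])
    show "(\<lambda>x. \<bar>cl k (f x) - cl k (g n x)\<bar>) \<in> borel_measurable (lebesgue_on {a..b})"
      by (intro borel_measurable_abs borel_measurable_diff clm continuous_imp_measurable_on_sets_lebesgue cg) auto
    show "norm \<bar>cl k (f x) - cl k (g n x)\<bar> \<le> 2 * real k" for x
      using cl0(1)[of k "f x"] cl0(1)[of k "g n x"] by auto
  qed auto
  \<comment> \<open>Zero on the null set \<open>N\<close>, so that the convergence holds at every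
    point, as the dominated convergence theorem used here requires.\<close>
  let ?h = "\<lambda>n x. if x \<in> N then 0 else \<bar>cl k (f x) - cl k (g n x)\<bar>"
  have I3: "?h n integrable_on {a..b}" "integral {a..b} (?h n) = integral {a..b} (\<lambda>x. \<bar>cl k (f x) - cl k (g n x)\<bar>)" for n
    using integrable_spike[OF I2 N, of "?h n" n] integral_spike[OF N, of "{a..b}" "?h n" "\<lambda>x. \<bar>cl k (f x) - cl k (g n x)\<bar>"]
    by auto
  have "(\<lambda>n. integral {a..b} (?h n)) \<longlonglongrightarrow> integral {a..b} (\<lambda>x. 0)"
  proof (rule dominated_convergence(2)[where h="\<lambda>x. 2 * real k"])
    show "norm (?h n x) \<le> 2 * real k" for n x
      using cl0(1)[of k "f x"] cl0(1)[of k "g n x"] by auto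
    show "(\<lambda>n. ?h n x) \<longlonglongrightarrow> 0" if "x \<in> {a..b}" for x
    proof (cases "x \<in> N")
      case False
      have "(\<lambda>n. cl k (g n x)) \<longlonglongrightarrow> cl k (f x)"
        using continuous_on_tendsto_compose[OF ccl[of UNIV k], of "\<lambda>n. g n x" "f x"] g(2)[OF False] that by simp
      then have "(\<lambda>n. \<bar>cl k (f x) - cl k (g n x)\<bar>) \<longlonglongrightarrow> \<bar>cl k (f x) - cl k (f x)\<bar>"
        by (intro tendsto_intros)
      then show ?thesis using False by simp
    qed simp
  qed (use I3 in auto)
  then have "\<forall>\<^sub>F n in sequentially. integral {a..b} (?h n) < e / 2"
    using \<open>e > 0\<close> by (intro order_tendstoD(2)) auto
  then obtain n where n: "integral {a..b} (\<lambda>x. \<bar>cl k (f x) - cl k (g n x)\<bar>) < e / 2"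
    unfolding I3(2) by (auto simp: eventually_sequentially)
  show ?thesis
  proof
    show "continuous_on UNIV (\<lambda>x. cl k (g n x))" by (rule cg)
    have J: "(\<lambda>x. \<bar>f x - cl k (f x)\<bar> + \<bar>cl k (f x) - cl k (g n x)\<bar>) integrable_on {a..b}"
      using I1[of k] I2[of n] by (intro integrable_add) auto
    have m: "(\<lambda>x. \<bar>f x - cl k (g n x)\<bar>) \<in> borel_measurable (lebesgue_on {a..b})"
      by (intro borel_measurable_abs borel_measurable_diff fm continuous_imp_measurable_on_sets_lebesgue cg) auto
    have "integral {a..b} (\<lambda>x. \<bar>f x - cl k (g n x)\<bar>) \<le>
        integral {a..b} (\<lambda>x. \<bar>f x - cl k (f x)\<bar> + \<bar>cl k (f x) - cl k (g n x)\<bar>)"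
    proof (rule integral_le[OF _ J])
      show "(\<lambda>x. \<bar>f x - cl k (g n x)\<bar>) integrable_on {a..b}"
        by (rule measurable_bounded_by_integrable_imp_integrable[OF m J]) auto
    qed auto
    also have "\<dots> = integral {a..b} (\<lambda>x. \<bar>f x - cl k (f x)\<bar>) + integral {a..b} (\<lambda>x. \<bar>cl k (f x) - cl k (g n x)\<bar>)"
      using I1[of k] I2[of n] by (intro integral_add) auto
    finally show "integral {a..b} (\<lambda>x. \<bar>f x - cl k (g n x)\<bar>) < e" using k n by simp
  qed
qed

section \<open>Absolute continuity: indefinite integrals, slope estimates, closure
  properties\<close>

lemma abs_cont_on_subinterval: "abs_cont_on a b f \<Longrightarrow> a \<le> c \<Longrightarrow> d \<le> b \<Longrightarrow> abs_cont_on c d f"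
  unfolding abs_cont_on_def by (meson atLeastatMost_subset_iff order_trans)

lemma abs_cont_on_cong:
  assumes "abs_cont_on a b f" "\<And>x. x \<in> {a..b} \<Longrightarrow> f x = g x"
  shows "abs_cont_on a b g"
  unfolding abs_cont_on_def
proof (intro allI impI)
  fix e :: real assume "e > 0"
  then obtain \<delta> where \<delta>: "\<delta> > 0" "\<And>D S. D division_of S \<and> S \<subseteq> {a..b} \<and> (\<Sum>K\<in>D. measure lborel K) < \<delta> \<Longrightarrow>
     (\<Sum>K\<in>D. norm (f (Sup K) - f (Inf K))) < e" using assms(1) unfolding abs_cont_on_def by meson
  show "\<exists>\<delta>>0. \<forall>D S. D division_of S \<and> S \<subseteq> {a..b} \<and> (\<Sum>K\<in>D. measure lborel K) < \<delta> \<longrightarrow>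
     (\<Sum>K\<in>D. norm (g (Sup K) - g (Inf K))) < e"
  proof (intro exI conjI allI impI)
    fix D S assume D: "D division_of S \<and> S \<subseteq> {a..b} \<and> (\<Sum>K\<in>D. measure lborel K) < \<delta>"
    have "(\<Sum>K\<in>D. norm (g (Sup K) - g (Inf K))) = (\<Sum>K\<in>D. norm (f (Sup K) - f (Inf K)))"
    proof (rule sum.cong)
      fix K assume "K \<in> D"
      with D have "Inf K \<in> {a..b}" "Sup K \<in> {a..b}" using content_eq_Sup_Inf(3,4)[of D S K] by auto
      then show "norm (g (Sup K) - g (Inf K)) = norm (f (Sup K) - f (Inf K))" using assms(2) by simp
    qed simp
    then show "(\<Sum>K\<in>D. norm (g (Sup K) - g (Inf K))) < e" using \<delta>(2)[OF D] by simp
  qed (rule \<delta>(1))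
qed

lemma integral_diff_subinterval:
  fixes f :: "real \<Rightarrow> 'a::euclidean_space"
  assumes "f integrable_on {a..b}" "a \<le> c" "c \<le> d" "d \<le> b"
  shows "integral {a..d} f - integral {a..c} f = integral {c..d} f"
proof -
  have "f integrable_on {a..d}" by (rule integrable_on_subinterval[OF assms(1)]) (use assms in auto)
  then have "integral {a..c} f + integral {c..d} f = integral {a..d} f"
    using assms by (intro Henstock_Kurzweil_Integration.integral_combine) auto
  then show ?thesis by (simp add: algebra_simps)
qed

text \<open>A continuous \<open>g\<close> close to \<open>norm f\<close> in L1 is bounded by some
  \<open>M\<close>, so the increments over a division sum to at most the L1 error plus
  \<open>M\<close> times the total length; hence the choice \<open>e / 2 / M\<close>.\<close>

lemma abs_cont_on_integral:
  fixes f :: "real \<Rightarrow> 'a::euclidean_space"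
  assumes f: "f absolutely_integrable_on {a..b}"
  shows "abs_cont_on a b (\<lambda>x. integral {a..x} f)"
  unfolding abs_cont_on_def
proof (intro allI impI)
  fix e :: real assume "e > 0"
  have nf: "(\<lambda>x. norm (f x)) absolutely_integrable_on {a..b}"
    using f by (simp add: absolutely_integrable_on_def)
  then have nf1: "(\<lambda>x. norm (f x)) integrable_on {a..b}" by (simp add: absolutely_integrable_on_def)
  have f1: "f integrable_on {a..b}" using f by (simp add: absolutely_integrable_on_def)
  obtain g where g: "continuous_on UNIV g" "integral {a..b} (\<lambda>x. \<bar>norm (f x) - g x\<bar>) < e / 2"
    using L1_approx_continuous[OF nf, of "e/2"] \<open>e > 0\<close> by auto
  have "compact (g ` {a..b})" using g(1) by (intro compact_continuous_image continuous_on_subset[OF g(1)]) auto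
  then have "bounded (g ` {a..b})" by (rule compact_imp_bounded)
  then obtain M where M: "M > 0" "\<And>x. x \<in> {a..b} \<Longrightarrow> \<bar>g x\<bar> \<le> M"
    unfolding bounded_pos by auto
  have ig: "g integrable_on {a..b}"
    using g(1) by (intro integrable_continuous_real continuous_on_subset[OF g(1)]) auto
  have I: "(\<lambda>x. \<bar>norm (f x) - g x\<bar>) integrable_on {a..b}"
  proof -
    have "(\<lambda>x. norm (f x) - g x) absolutely_integrable_on {a..b}"
      by (rule set_integral_diff(1)[OF nf absolutely_integrable_continuous_real[OF continuous_on_subset[OF g(1)]]]) simp
    then show ?thesis by (simp add: absolutely_integrable_on_def)
  qed
  show "\<exists>\<delta>>0. \<forall>D S. D division_of S \<and> S \<subseteq> {a..b} \<and> (\<Sum>K\<in>D. measure lborel K) < \<delta> \<longrightarrow>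
     (\<Sum>K\<in>D. norm (integral {a..Sup K} f - integral {a..Inf K} f)) < e"
  proof (intro exI[of _ "e / 2 / M"] conjI allI impI)
    show "e / 2 / M > 0" using M \<open>e > 0\<close> by simp
    fix D S assume "D division_of S \<and> S \<subseteq> {a..b} \<and> (\<Sum>K\<in>D. measure lborel K) < e / 2 / M"
    then have D: "D division_of S" "S \<subseteq> {a..b}" "(\<Sum>K\<in>D. measure lborel K) < e / 2 / M" by auto
    let ?\<phi> = "\<lambda>x. \<bar>norm (f x) - g x\<bar>"
    have *: "norm (integral {a..d} f - integral {a..c} f) \<le> integral {c..d} ?\<phi> + M * (d - c)"
      if cd: "a \<le> c" "c \<le> d" "d \<le> b" for c d
    proof -
      have sub: "{c..d} \<subseteq> {a..b}" using cd by auto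
      note IK = integrable_on_subinterval[OF I sub] integrable_on_subinterval[OF f1 sub]
      have "integral {a..d} f - integral {a..c} f = integral {c..d} f"
        by (rule integral_diff_subinterval[OF f1 cd])
      also have "norm \<dots> \<le> integral {c..d} (\<lambda>x. ?\<phi> x + M)"
      proof (rule integral_norm_bound_integral[OF IK(2)])
        show "(\<lambda>x. ?\<phi> x + M) integrable_on {c..d}" by (intro integrable_add IK(1) integrable_const_ivl)
        show "norm (f x) \<le> ?\<phi> x + M" if "x \<in> {c..d}" for x using M(2)[of x] that sub by auto
      qed
      also have "\<dots> = integral {c..d} ?\<phi> + integral {c..d} (\<lambda>x. M)"
        by (intro integral_add IK(1) integrable_const_ivl)
      also have "integral {c..d} (\<lambda>x. M) = M * (d - c)" using cd by simp
      finally show ?thesis .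
    qed
    have 1: "norm (integral {a..Sup K} f - integral {a..Inf K} f) \<le> integral K ?\<phi> + M * measure lborel K"
      if K: "K \<in> D" for K
    proof -
      note c = content_eq_Sup_Inf[OF D(1) K]
      have "a \<le> Inf K" "Sup K \<le> b" using c(3,4) D(2) by auto
      from *[OF this(1) c(2) this(2)] show ?thesis using c(1,5) by simp
    qed
    have IS: "?\<phi> integrable_on S" using I D by (meson integrable_on_subdivision)
    have "(\<Sum>K\<in>D. norm (integral {a..Sup K} f - integral {a..Inf K} f)) \<le> (\<Sum>K\<in>D. integral K ?\<phi> + M * measure lborel K)"
      by (rule sum_mono[OF 1])
    also have "\<dots> = integral S ?\<phi> + M * (\<Sum>K\<in>D. measure lborel K)"
      using integral_combine_division_topdown[OF IS D(1)] by (simp add: sum.distrib sum_distrib_left)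
    also have "integral S ?\<phi> \<le> integral {a..b} ?\<phi>" using IS I D(2) by (intro integral_subset_le) auto
    finally have "(\<Sum>K\<in>D. norm (integral {a..Sup K} f - integral {a..Inf K} f)) \<le>
       integral {a..b} ?\<phi> + M * (\<Sum>K\<in>D. measure lborel K)" by simp
    moreover have "M * (\<Sum>K\<in>D. measure lborel K) < e / 2" using D(3) M(1) by (simp add: field_simps)
    ultimately show "(\<Sum>K\<in>D. norm (integral {a..Sup K} f - integral {a..Inf K} f)) < e" using g(2) by linarith
  qed
qed

lemma abs_cont_on_imp_continuous_on:
  fixes F :: "real \<Rightarrow> 'a::real_normed_vector"
  assumes "abs_cont_on a b F"
  shows "continuous_on {a..b} F"
  unfolding continuous_on_iff
proof (intro ballI allI impI)
  fix x e :: real assume x: "x \<in> {a..b}" "e > 0"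
  then obtain \<delta> where \<delta>: "\<delta> > 0" "\<And>D S. D division_of S \<and> S \<subseteq> {a..b} \<and> (\<Sum>K\<in>D. measure lborel K) < \<delta> \<Longrightarrow>
     (\<Sum>K\<in>D. norm (F (Sup K) - F (Inf K))) < e" using assms(1) unfolding abs_cont_on_def by meson
  have *: "norm (F v - F u) < e" if "u \<le> v" "v - u < \<delta>" "a \<le> u" "v \<le> b" for u v
    using \<delta>(2)[of "{{u..v}}" "{u..v}"] that division_of_self[of u v] by auto
  show "\<exists>d>0. \<forall>x'\<in>{a..b}. dist x' x < d \<longrightarrow> dist (F x') (F x) < e"
  proof (intro exI conjI ballI impI)
    fix y assume y: "y \<in> {a..b}" "dist y x < \<delta>"
    show "dist (F y) (F x) < e"
      using *[of x y] *[of y x] x y by (cases "x \<le> y") (auto simp: dist_norm norm_minus_commute)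
  qed (rule \<delta>(1))
qed

text \<open>A Vitali family of intervals with controlled slope leaves a remainder of total length
  below the \<delta> of absolute continuity, where the increments sum to less than \<open>e\<close>.
  Slopes therefore need control only to the right, almost everywhere, and along some arbitrarily
  small steps: a lower derivate is enough.\<close>

lemma abs_cont_slope_le:
  fixes H :: "real \<Rightarrow> real"
  assumes "abs_cont_on a b H" "a \<le> b" "negligible N" "\<epsilon> \<ge> 0"
    and slope: "\<And>x \<eta>. x \<in> {a<..<b} - N \<Longrightarrow> \<eta> > 0 \<Longrightarrow> \<exists>y. x < y \<and> y - x < \<eta> \<and> y \<le> b \<and> H y - H x \<le> \<epsilon> * (y - x)"
  shows "H b - H a \<le> \<epsilon> * (b - a)"
proof (rule field_le_epsilon)
  fix e :: real assume "e > 0"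
  then obtain \<delta> where \<delta>: "\<delta> > 0" "\<And>D S. D division_of S \<and> S \<subseteq> {a..b} \<and> (\<Sum>K\<in>D. measure lborel K) < \<delta> \<Longrightarrow>
     (\<Sum>K\<in>D. norm (H (Sup K) - H (Inf K))) < e" using assms(1) unfolding abs_cont_on_def by meson
  define P where "P = (\<lambda>c d. a \<le> c \<and> c < d \<and> d \<le> b \<and> H d - H c \<le> \<epsilon> * (d - c))"
  obtain \<D> T where D: "\<D> division_of \<Union>\<D>" "\<Union>\<D> \<subseteq> {a..b}"
      "\<And>K. K \<in> \<D> \<Longrightarrow> \<exists>c d. c < d \<and> K = {c..d} \<and> P c d"
      "T \<in> lmeasurable" "measure lebesgue T < \<delta>" "{a<..<b} - N \<subseteq> T \<union> \<Union>\<D>"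
  proof (rule vitali_finite[of "{a<..<b} - N" P a b \<delta>])
    show "\<exists>c d. c \<le> x \<and> x \<le> d \<and> c < d \<and> d - c < \<eta> \<and> P c d" if x: "x \<in> {a<..<b} - N" and "\<eta> > 0" for x \<eta>
    proof -
      obtain y where "x < y" "y - x < \<eta>" "y \<le> b" "H y - H x \<le> \<epsilon> * (y - x)" using slope[OF x \<open>\<eta> > 0\<close>] by blast
      then show ?thesis using x by (intro exI[of _ x] exI[of _ y]) (auto simp: P_def)
    qed
  qed (use \<delta> in \<open>auto simp: P_def\<close>)
  \<comment> \<open>Completing the family to a division of \<open>{a..b}\<close> makes the
    increments telescope; the added intervals \<open>q - \<D>\<close> are the short
    remainder.\<close>
  obtain q where q: "\<D> \<subseteq> q" "q division_of {a..b}"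
    using partial_division_extend_interval[OF D(1), of a b] D(2) by auto
  have fin: "finite q" using q(2) by blast
  have Uq: "\<Union>q = {a..b}" using division_ofD(6)[OF q(2)] .
  then have "q division_of \<Union>q" using q(2) by simp
  then have q': "q - \<D> division_of \<Union>(q - \<D>)" by (rule division_of_subset) blast
  have split: "sum f q = sum f (q - \<D>) + sum f \<D>" for f :: "real set \<Rightarrow> real"
    using sum.subset_diff[OF q(1) fin] .
  have mD: "measure lebesgue (\<Union>\<D>) = (\<Sum>K\<in>\<D>. measure lborel K)" "\<Union>\<D> \<in> lmeasurable"
    using measure_Union_division[OF D(1)] by auto
  have "measure lebesgue {a<..<b} \<le> measure lebesgue ((T \<union> \<Union>\<D>) \<union> N)"
    using D(4,6) mD(2) assms(3) by (intro measure_mono_fmeasurable fmeasurable.Un) (auto simp: negligible_imp_measurable)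
  also have "\<dots> \<le> measure lebesgue (T \<union> \<Union>\<D>) + measure lebesgue N"
    using D(4) mD(2) negligible_imp_sets[OF assms(3)] by (intro measure_Un_le) auto
  also have "\<dots> \<le> measure lebesgue T + measure lebesgue (\<Union>\<D>)"
    using D(4) mD(2) measure_Un_le[of T lebesgue "\<Union>\<D>"] negligible_imp_measure0[OF assms(3)] by auto
  finally have "b - a < \<delta> + (\<Sum>K\<in>\<D>. measure lborel K)" using D(5) mD(1) assms(2) by simp
  moreover have tot: "(\<Sum>K\<in>q. measure lborel K) = b - a"
    using additive_content_division[of q a b] q(2) assms(2) by simp
  ultimately have "(\<Sum>K\<in>q - \<D>. measure lborel K) < \<delta>" using split[of "measure lborel"] by simp
  then have "(\<Sum>K\<in>q - \<D>. norm (H (Sup K) - H (Inf K))) < e"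
    using q' \<delta>(2)[of "q - \<D>" "\<Union>(q - \<D>)"] Uq by blast
  moreover have "(\<Sum>K\<in>q - \<D>. H (Sup K) - H (Inf K)) \<le> (\<Sum>K\<in>q - \<D>. norm (H (Sup K) - H (Inf K)))"
    by (intro sum_mono) auto
  moreover have "(\<Sum>K\<in>\<D>. H (Sup K) - H (Inf K)) \<le> \<epsilon> * (b - a)"
  proof -
    have "(\<Sum>K\<in>\<D>. H (Sup K) - H (Inf K)) \<le> (\<Sum>K\<in>\<D>. \<epsilon> * measure lborel K)"
    proof (rule sum_mono)
      fix K assume "K \<in> \<D>"
      from D(3)[OF this] show "H (Sup K) - H (Inf K) \<le> \<epsilon> * measure lborel K" by (auto simp: P_def)
    qed
    also have "\<dots> = \<epsilon> * (\<Sum>K\<in>\<D>. measure lborel K)" by (simp add: sum_distrib_left)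
    also have "\<dots> \<le> \<epsilon> * (b - a)"
      using split[of "measure lborel"] tot assms(4) by (intro mult_left_mono) (auto simp: sum_nonneg)
    finally show ?thesis .
  qed
  moreover have "(\<Sum>K\<in>q. H (Sup K) - H (Inf K)) = H b - H a"
    by (rule sum_division_telescope[OF assms(2) q(2)])
  ultimately show "H b - H a \<le> \<epsilon> * (b - a) + e" using split[of "\<lambda>K. H (Sup K) - H (Inf K)"] by linarith
qed

text \<open>One estimate behind the closure properties: sums, products and Lipschitz images all have
  increments bounded by those of at most two functions.\<close>

lemma abs_cont_on_dominated:
  assumes F1: "abs_cont_on a b F1" and F2: "abs_cont_on a b F2"
    and le: "\<And>x y. x \<in> {a..b} \<Longrightarrow> y \<in> {a..b} \<Longrightarrow> norm (G y - G x) \<le> C * (norm (F1 y - F1 x) + norm (F2 y - F2 x))"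
  shows "abs_cont_on a b G"
  unfolding abs_cont_on_def
proof (intro allI impI)
  fix e :: real assume "e > 0"
  \<comment> \<open>\<open>\<bar>C\<bar> + 1\<close> is positive whatever the value of
    \<open>C\<close>, which avoids a case distinction.\<close>
  define e' where "e' = e / 2 / (\<bar>C\<bar> + 1)"
  have "e' > 0" using \<open>e > 0\<close> by (simp add: e'_def)
  obtain d1 where d1: "d1 > 0" "\<And>D S. D division_of S \<and> S \<subseteq> {a..b} \<and> (\<Sum>K\<in>D. measure lborel K) < d1 \<Longrightarrow>
     (\<Sum>K\<in>D. norm (F1 (Sup K) - F1 (Inf K))) < e'" using F1 \<open>e' > 0\<close> unfolding abs_cont_on_def by meson
  obtain d2 where d2: "d2 > 0" "\<And>D S. D division_of S \<and> S \<subseteq> {a..b} \<and> (\<Sum>K\<in>D. measure lborel K) < d2 \<Longrightarrow>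
     (\<Sum>K\<in>D. norm (F2 (Sup K) - F2 (Inf K))) < e'" using F2 \<open>e' > 0\<close> unfolding abs_cont_on_def by meson
  show "\<exists>\<delta>>0. \<forall>D S. D division_of S \<and> S \<subseteq> {a..b} \<and> (\<Sum>K\<in>D. measure lborel K) < \<delta> \<longrightarrow>
     (\<Sum>K\<in>D. norm (G (Sup K) - G (Inf K))) < e"
  proof (intro exI[of _ "min d1 d2"] conjI allI impI)
    fix D S assume D: "D division_of S \<and> S \<subseteq> {a..b} \<and> (\<Sum>K\<in>D. measure lborel K) < min d1 d2"
    have "(\<Sum>K\<in>D. norm (G (Sup K) - G (Inf K))) \<le>
        (\<Sum>K\<in>D. (\<bar>C\<bar> + 1) * (norm (F1 (Sup K) - F1 (Inf K)) + norm (F2 (Sup K) - F2 (Inf K))))"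
    proof (rule sum_mono)
      fix K assume "K \<in> D"
      with D have "Inf K \<in> {a..b}" "Sup K \<in> {a..b}" using content_eq_Sup_Inf(3,4)[of D S K] by auto
      then have "norm (G (Sup K) - G (Inf K)) \<le> C * (norm (F1 (Sup K) - F1 (Inf K)) + norm (F2 (Sup K) - F2 (Inf K)))"
        by (rule le)
      also have "\<dots> \<le> (\<bar>C\<bar> + 1) * (norm (F1 (Sup K) - F1 (Inf K)) + norm (F2 (Sup K) - F2 (Inf K)))"
        by (rule mult_right_mono) auto
      finally show "norm (G (Sup K) - G (Inf K)) \<le> \<dots>" .
    qed
    also have "\<dots> = (\<bar>C\<bar> + 1) * ((\<Sum>K\<in>D. norm (F1 (Sup K) - F1 (Inf K))) + (\<Sum>K\<in>D. norm (F2 (Sup K) - F2 (Inf K))))"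
      by (simp only: sum_distrib_left[symmetric] sum.distrib)
    also have "\<dots> < (\<bar>C\<bar> + 1) * (e' + e')"
      using d1(2)[of D S] d2(2)[of D S] D by (intro mult_strict_left_mono add_strict_mono) auto
    also have "\<dots> = e"
    proof -
      have "e' + e' = e / (\<bar>C\<bar> + 1)"
        unfolding e'_def by (metis add_divide_distrib field_sum_of_halves)
      moreover have "\<bar>C\<bar> + 1 \<noteq> 0" by linarith
      ultimately show ?thesis by simp
    qed
    finally show "(\<Sum>K\<in>D. norm (G (Sup K) - G (Inf K))) < e" .
  qed (use d1 d2 in auto)
qed

lemma abs_cont_on_lipschitz_compose:
  assumes "abs_cont_on a b F"
    and "\<And>x y. x \<in> {a..b} \<Longrightarrow> y \<in> {a..b} \<Longrightarrow> norm (\<phi> (F y) - \<phi> (F x)) \<le> C * norm (F y - F x)"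
  shows "abs_cont_on a b (\<lambda>x. \<phi> (F x))"
proof (rule abs_cont_on_dominated[OF assms(1) assms(1), where C = "C / 2"])
  fix x y assume "x \<in> {a..b}" "y \<in> {a..b}"
  from assms(2)[OF this] show "norm (\<phi> (F y) - \<phi> (F x)) \<le> C / 2 * (norm (F y - F x) + norm (F y - F x))" by simp
qed

lemma abs_cont_on_add: "abs_cont_on a b F \<Longrightarrow> abs_cont_on a b G \<Longrightarrow> abs_cont_on a b (\<lambda>x. F x + G x)"
  by (rule abs_cont_on_dominated[of a b F G _ 1]) (simp_all add: norm_diff_triangle_ineq)

lemma abs_cont_on_linear:
  assumes "abs_cont_on a b F" "bounded_linear L"
  shows "abs_cont_on a b (\<lambda>x. L (F x))"
proof -
  obtain C where "\<And>x. norm (L x) \<le> norm x * C" using bounded_linear.bounded[OF assms(2)] by blast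
  then show ?thesis
    by (intro abs_cont_on_lipschitz_compose[OF assms(1), where C = C])
       (metis bounded_linear.linear[OF assms(2)] linear_diff mult.commute)
qed

lemma abs_cont_on_diff: "abs_cont_on a b F \<Longrightarrow> abs_cont_on a b G \<Longrightarrow> abs_cont_on a b (\<lambda>x. F x - G x)"
  using abs_cont_on_add[OF _ abs_cont_on_linear[OF _ bounded_linear_minus[OF bounded_linear_ident]], of a b F G] by simp

lemma abs_cont_on_bounded:
  assumes "abs_cont_on a b F"
  obtains M where "M > 0" "\<And>x. x \<in> {a..b} \<Longrightarrow> norm (F x) \<le> M"
proof -
  have "bounded (F ` {a..b})"
    by (intro compact_imp_bounded compact_continuous_image abs_cont_on_imp_continuous_on[OF assms]) simp
  then show ?thesis using that unfolding bounded_pos by auto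
qed

lemma abs_cont_on_mult:
  fixes F G :: "real \<Rightarrow> 'a::real_normed_algebra"
  assumes F: "abs_cont_on a b F" and G: "abs_cont_on a b G"
  shows "abs_cont_on a b (\<lambda>x. F x * G x)"
proof -
  obtain M where M: "M > 0" "\<And>x. x \<in> {a..b} \<Longrightarrow> norm (F x) \<le> M" using abs_cont_on_bounded[OF F] by blast
  obtain N where N: "N > 0" "\<And>x. x \<in> {a..b} \<Longrightarrow> norm (G x) \<le> N" using abs_cont_on_bounded[OF G] by blast
  show ?thesis
  proof (rule abs_cont_on_dominated[OF F G, where C = "M + N"])
    fix x y assume xy: "x \<in> {a..b}" "y \<in> {a..b}"
    have "F y * G y - F x * G x = F y * (G y - G x) + (F y - F x) * G x" by (simp add: algebra_simps)
    also have "norm \<dots> \<le> norm (F y) * norm (G y - G x) + norm (F y - F x) * norm (G x)"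
      by (intro norm_triangle_mono norm_mult_ineq)
    also have "\<dots> \<le> M * norm (G y - G x) + norm (F y - F x) * N"
      by (intro add_mono mult_right_mono mult_left_mono M N xy norm_ge_zero)
    also have "\<dots> \<le> (M + N) * (norm (F y - F x) + norm (G y - G x))"
      using M(1) N(1) by (simp add: algebra_simps)
    finally show "norm (F y * G y - F x * G x) \<le> (M + N) * (norm (F y - F x) + norm (G y - G x))" .
  qed
qed

lemma abs_cont_on_const: "abs_cont_on a b (\<lambda>x. c)"
  unfolding abs_cont_on_def by (auto intro: exI[of _ 1])

section \<open>Difference quotients and the fundamental theorem for absolutely continuous
  functions\<close>

lemma grid_division:
  fixes x h :: real and n :: nat
  assumes "h > 0"
  defines "D \<equiv> (\<lambda>k::nat. {x + k * h..x + Suc k * h}) ` {..<n}"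
  shows "D division_of \<Union>D" "(\<Sum>K\<in>D. g (Sup K) (Inf K)) = (\<Sum>k<n. g (x + Suc k * h) (x + k * h))"
    "\<Union>D \<subseteq> {x..x + n * h}"
proof -
  have Suc: "x + Suc k * h = x + k * h + h" for k by (simp add: algebra_simps)
  have inj: "inj_on (\<lambda>k::nat. {x + k * h..x + Suc k * h}) {..<n}"
    using assms(1) by (intro inj_onI) (simp add: Icc_eq_Icc Suc del: of_nat_Suc)
  show "(\<Sum>K\<in>D. g (Sup K) (Inf K)) = (\<Sum>k<n. g (x + Suc k * h) (x + k * h))"
    unfolding D_def using assms(1) by (subst sum.reindex[OF inj]) (simp add: Suc del: of_nat_Suc)
  have disj: "interior {x + i * h..x + Suc i * h} \<inter> interior {x + j * h..x + Suc j * h} = {}" if "i < j" for i j :: nat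
  proof -
    have "real (Suc i) * h \<le> real j * h" using that assms(1) by (intro mult_right_mono) auto
    then show ?thesis by auto
  qed
  show "D division_of \<Union>D"
  proof (rule division_ofI)
    fix K assume "K \<in> D"
    then obtain k :: nat where k: "K = {x + k * h..x + Suc k * h}" by (auto simp: D_def)
    then have "K = cbox (x + k * h) (x + Suc k * h)" by simp
    then show "\<exists>a b. K = cbox a b" by blast
    show "K \<subseteq> \<Union>D" using \<open>K \<in> D\<close> by blast
    show "K \<noteq> {}" using k assms(1) by (simp add: Suc del: of_nat_Suc)
    fix L assume "L \<in> D" "K \<noteq> L"
    then obtain j :: nat where j: "L = {x + j * h..x + Suc j * h}" by (auto simp: D_def)
    then have "k < j \<or> j < k" using k \<open>K \<noteq> L\<close> by (metis linorder_neqE_nat)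
    then show "interior K \<inter> interior L = {}" using disj[of k j] disj[of j k] unfolding k j by blast
  qed (auto simp: D_def)
  show "\<Union>D \<subseteq> {x..x + n * h}"
  proof (rule Union_least)
    fix K assume "K \<in> D"
    then obtain k :: nat where k: "K = {x + k * h..x + Suc k * h}" "k < n" by (auto simp: D_def)
    have "real (Suc k) * h \<le> real n * h" using k(2) assms(1) by (intro mult_right_mono) auto
    moreover have "real k * h \<ge> 0" using assms(1) by simp
    ultimately show "K \<subseteq> {x..x + n * h}" using k(1) by auto
  qed
qed

text \<open>The interval \<open>{a..b - h}\<close> consists of exactly \<open>n\<close> cells of
  length \<open>h\<close>. Folded onto the first cell, the integrand at \<open>x\<close> becomes the
  variation sum over the grid with base point \<open>x\<close> and step \<open>h\<close>, which
  \<open>B\<close> bounds; integration over one cell gives the factor \<open>h\<close>.\<close>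

lemma integral_difference_quotient_le:
  fixes F :: "real \<Rightarrow> real"
  assumes F: "continuous_on {a..b} F" and h: "h > 0" and b: "b = a + (real n + 1) * h"
    and B: "\<And>D S. D division_of S \<Longrightarrow> S \<subseteq> {a..b} \<Longrightarrow> (\<Sum>K\<in>D. \<bar>F (Sup K) - F (Inf K)\<bar>) \<le> B"
  shows "integral {a..b - h} (\<lambda>x. \<bar>F (x + h) - F x\<bar>) \<le> B * h"
proof -
  define \<phi> where "\<phi> = (\<lambda>x. \<bar>F (x + h) - F x\<bar>)"
  have bh: "b - h = a + real n * h" using b by (simp add: algebra_simps)
  have cont: "continuous_on {a..b - h} \<phi>"
    unfolding \<phi>_def using h by (intro continuous_intros continuous_on_compose2[OF F]) auto
  have grid: "integral {a..a + real m * h} \<phi> = (\<Sum>k<m. integral {a..a + h} (\<lambda>x. \<phi> (x + real k * h)))" if "m \<le> n" for m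
    using that
  proof (induction m)
    case (Suc m)
    have le: "real (Suc m) * h \<le> real n * h" using Suc.prems h by (intro mult_right_mono) auto
    have "\<phi> integrable_on {a..a + real (Suc m) * h}"
      using le bh by (intro integrable_continuous_real continuous_on_subset[OF cont]) auto
    then have "integral {a..a + real (Suc m) * h} \<phi> =
      integral {a..a + real m * h} \<phi> + integral {a + real m * h..a + real (Suc m) * h} \<phi>"
      using h by (intro Henstock_Kurzweil_Integration.integral_combine[symmetric]) (auto simp: algebra_simps)
    also have "integral {a + real m * h..a + real (Suc m) * h} \<phi> = integral {a..a + h} (\<lambda>x. \<phi> (x + real m * h))"
      using integral_shift_real_ivl[of "a + real m * h" "real m * h" "a + real (Suc m) * h" \<phi>]
      by (simp add: algebra_simps)
    finally show ?case using Suc by simp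
  qed simp
  have int: "(\<lambda>x. \<phi> (x + real k * h)) integrable_on {a..a + h}" if "k < n" for k
  proof (intro integrable_continuous_real continuous_on_compose2[OF cont] continuous_intros)
    have "real (Suc k) * h \<le> real n * h" "0 \<le> real k * h" using that h by (auto intro!: mult_right_mono)
    then show "(\<lambda>x. x + real k * h) ` {a..a + h} \<subseteq> {a..b - h}" using bh by (auto simp: algebra_simps)
  qed
  have "integral {a..b - h} \<phi> = (\<Sum>k<n. integral {a..a + h} (\<lambda>x. \<phi> (x + real k * h)))"
    using grid[of n] bh by simp
  also have "\<dots> = integral {a..a + h} (\<lambda>x. \<Sum>k<n. \<phi> (x + real k * h))"
    using int by (intro integral_sum[symmetric]) auto
  also have "\<dots> \<le> integral {a..a + h} (\<lambda>x. B)"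
  proof (rule integral_le)
    show "(\<lambda>x. \<Sum>k<n. \<phi> (x + real k * h)) integrable_on {a..a + h}" using int by (intro integrable_sum) auto
    fix x assume x: "x \<in> {a..a + h}"
    note g = grid_division[OF h, where x = x and n = n]
    have "x + real n * h \<le> b" using x bh by auto
    then have "{x..x + real n * h} \<subseteq> {a..b}" using x by auto
    with g(3) have "\<Union>((\<lambda>k::nat. {x + k * h..x + Suc k * h}) ` {..<n}) \<subseteq> {a..b}" by (rule subset_trans)
    from B[OF g(1) this] show "(\<Sum>k<n. \<phi> (x + real k * h)) \<le> B"
      unfolding g(2)[where g = "\<lambda>u v. \<bar>F u - F v\<bar>"] by (simp add: \<phi>_def algebra_simps)
  qed auto
  also have "\<dots> = B * h" using h by simp
  finally show ?thesis by (simp add: \<phi>_def)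
qed

text \<open>The bound on variation sums makes the difference quotients bounded in L1 uniformly in
  the step, which is what Fatou's lemma needs. Differentiability of \<open>F\<close> is not yet
  available at this stage; the liminf takes its place because the slope estimate asks only for some
  small steps with a good quotient.\<close>

lemma abs_cont_slope_density:
  fixes F :: "real \<Rightarrow> real"
  assumes ac: "abs_cont_on a b F" and "a < b"
    and B: "\<And>D S. D division_of S \<Longrightarrow> S \<subseteq> {a..b} \<Longrightarrow> (\<Sum>K\<in>D. \<bar>F (Sup K) - F (Inf K)\<bar>) \<le> B"
  obtains v where "v absolutely_integrable_on {a..b}" "\<And>x. 0 \<le> v x" "integral {a..b} v \<le> B"
    "\<And>c d. a \<le> c \<Longrightarrow> c \<le> d \<Longrightarrow> d \<le> b \<Longrightarrow> \<bar>F d - F c\<bar> \<le> integral {c..d} v"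
proof -
  have F: "continuous_on {a..b} F" by (rule abs_cont_on_imp_continuous_on[OF ac])
  have "B \<ge> 0" using B[of "{}" "{}"] by simp
  \<comment> \<open>These steps cut the interval into \<open>n + 1\<close> equal cells, as the bound
    on integrated difference quotients presupposes.\<close>
  define h where "h = (\<lambda>n::nat. (b - a) / (real n + 1))"
  have h: "h n > 0" "b = a + (real n + 1) * h n" for n using \<open>a < b\<close> by (auto simp: h_def)
  have hlim: "h \<longlonglongrightarrow> 0"
  proof -
    have "(\<lambda>n. (b - a) * (1 / (real n + 1))) \<longlonglongrightarrow> (b - a) * 0"
      using LIMSEQ_inverse_real_of_nat by (intro tendsto_mult tendsto_const) (simp add: inverse_eq_divide add.commute)
    then show ?thesis by (simp add: h_def)
  qed
  define s where "s = (\<lambda>n x. if x \<in> {a..b - h n} then \<bar>F (x + h n) - F x\<bar> / h n else 0)"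
  have s0: "s n x \<ge> 0" for n x using h(1)[of n] by (simp add: s_def)
  have contq: "continuous_on {a..b - h n} (\<lambda>x. \<bar>F (x + h n) - F x\<bar> / h n)" for n
    using h(1)[of n] by (intro continuous_intros continuous_on_compose2[OF F]) auto
  have sm: "s n \<in> borel_measurable borel" for n
  proof -
    have "s n = (\<lambda>x. indicator {a..b - h n} x *\<^sub>R (\<bar>F (x + h n) - F x\<bar> / h n))"
      by (auto simp: s_def indicator_def fun_eq_iff)
    then show ?thesis using borel_measurable_continuous_on_indicator[OF _ contq] by simp
  qed
  have sI: "(\<integral>\<^sup>+x. ennreal (s n x) \<partial>lborel) \<le> ennreal B" for n
  proof -
    define I where "I = integral {a..b - h n} (\<lambda>x. \<bar>F (x + h n) - F x\<bar> / h n)"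
    have "((\<lambda>x. \<bar>F (x + h n) - F x\<bar> / h n) has_integral I) {a..b - h n}"
      unfolding I_def by (intro integrable_integral integrable_continuous_real contq)
    then have "(s n has_integral I) UNIV"
      unfolding s_def by (simp only: has_integral_restrict_UNIV)
    then have "(\<integral>\<^sup>+x. ennreal (s n x) \<partial>lborel) = ennreal I"
      by (intro nn_integral_has_integral_lborel sm s0)
    moreover have "I \<le> B"
    proof -
      have "I = integral {a..b - h n} (\<lambda>x. \<bar>F (x + h n) - F x\<bar>) / h n"
        unfolding I_def by simp
      also have "\<dots> \<le> B" using integral_difference_quotient_le[OF F h B] h(1)[of n] by (simp add: field_simps)
      finally show ?thesis .
    qed
    ultimately show ?thesis by (simp add: ennreal_leI)
  qed
  define L where "L = (\<lambda>x. liminf (\<lambda>n. ennreal (s n x)))"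
  have Lm: "L \<in> borel_measurable lborel"
    unfolding L_def using sm by measurable
  have LI: "(\<integral>\<^sup>+x. L x \<partial>lborel) \<le> ennreal B"
  proof -
    have "(\<integral>\<^sup>+x. L x \<partial>lborel) \<le> liminf (\<lambda>n. \<integral>\<^sup>+x. ennreal (s n x) \<partial>lborel)"
      unfolding L_def by (intro nn_integral_liminf) (use sm in measurable)
    also have "\<dots> \<le> ennreal B" using sI by (intro Liminf_le) auto
    finally show ?thesis .
  qed
  \<comment> \<open>The liminf is an extended real; it is finite almost everywhere, and
    \<open>N1\<close> will collect the points where the passage to \<open>v\<close> loses
    information.\<close>
  define v where "v = (\<lambda>x. enn2real (L x))"
  have v0: "v x \<ge> 0" for x by (simp add: v_def)
  have vm: "v \<in> borel_measurable borel" using Lm unfolding v_def by measurable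
  have "(\<integral>\<^sup>+x. ennreal (v x) \<partial>lborel) \<le> (\<integral>\<^sup>+x. L x \<partial>lborel)"
    by (intro nn_integral_mono) (simp add: v_def ennreal_enn2real_if)
  then have vI: "(\<integral>\<^sup>+x. ennreal (v x) \<partial>lborel) \<le> ennreal B" using LI by simp
  then have vfin: "(\<integral>\<^sup>+x. ennreal (v x) \<partial>lborel) < \<infinity>" using ennreal_less_top[of B] by (simp add: le_less_trans)
  have vint: "v integrable_on UNIV" by (rule nn_integral_integrable_on[OF vm v0 vfin])
  have vB: "integral UNIV v \<le> B"
    using nn_integral_lborel_eq_integral[OF vm v0 vfin] vI \<open>B \<ge> 0\<close> by (simp add: ennreal_le_iff)
  have vint': "v integrable_on {c..d}" for c d by (rule integrable_on_subinterval[OF vint]) simp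
  have vabs: "v absolutely_integrable_on {c..d}" for c d
    by (intro nonnegative_absolutely_integrable_1 vint' v0)
  have "AE x in lborel. L x \<noteq> \<infinity>"
    using LI by (intro nn_integral_PInf_AE[OF Lm]) (auto simp: top_unique)
  then obtain N1 where N1: "N1 \<in> null_sets lborel" "\<And>x. x \<notin> N1 \<Longrightarrow> L x \<noteq> \<infinity>"
    by (auto elim!: AE_E3)
  have N1': "negligible N1" using N1(1) by (simp add: negligible_iff_null_sets null_sets_completionI)
  obtain N2 where N2: "negligible N2"
    "\<And>x. x \<in> {a<..<b} - N2 \<Longrightarrow> ((\<lambda>x. integral {a..x} v) has_vector_derivative v x) (at x)"
    using indefinite_integral_has_vector_derivative_AE[OF vint'[of a b]] by blast
  \<comment> \<open>Stated for every \<open>G\<close> with increments at most those of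
    \<open>F\<close> in absolute value, so that it applies to \<open>F\<close> and to its
    negative.\<close>
  have main: "G d - G c \<le> integral {c..d} v"
    if G: "abs_cont_on a b G" "\<And>x y. G y - G x \<le> \<bar>F y - F x\<bar>" and cd: "a \<le> c" "c \<le> d" "d \<le> b" for G c d
  proof (rule field_le_epsilon)
    fix e :: real assume "e > 0"
    \<comment> \<open>Adding 1 to the length keeps the denominator positive when
      \<open>c = d\<close>.\<close>
    define \<epsilon> where "\<epsilon> = e / (d - c + 1)"
    have \<epsilon>: "\<epsilon> > 0" "\<epsilon> * (d - c) \<le> e" using \<open>e > 0\<close> cd by (auto simp: \<epsilon>_def field_simps)
    define H where "H = (\<lambda>x. G x - integral {a..x} v)"
    have acH: "abs_cont_on c d H"
      unfolding H_def by (rule abs_cont_on_subinterval[OF abs_cont_on_diff[OF G(1) abs_cont_on_integral[OF vabs]] cd(1,3)])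
    have "H d - H c \<le> \<epsilon> * (d - c)"
    proof (rule abs_cont_slope_le[OF acH cd(2), of "N1 \<union> N2"])
      show "negligible (N1 \<union> N2)" using N1' N2(1) by simp
      show "\<epsilon> \<ge> 0" using \<epsilon> by simp
      fix x \<eta> :: real assume x: "x \<in> {c<..<d} - (N1 \<union> N2)" and "\<eta> > 0"
      then have xab: "x \<in> {a<..<b} - N2" using cd by auto
      have der: "((\<lambda>x. integral {a..x} v) has_derivative (\<lambda>t. t *\<^sub>R v x)) (at x)"
        using N2(2)[OF xab] by (simp add: has_vector_derivative_def)
      then obtain \<delta> where \<delta>: "\<delta> > 0" "\<And>y. norm (y - x) < \<delta> \<Longrightarrow>
          norm (integral {a..y} v - integral {a..x} v - (y - x) *\<^sub>R v x) \<le> \<epsilon> / 2 * norm (y - x)"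
        unfolding has_derivative_at_alt using \<epsilon>(1) half_gt_zero[of \<epsilon>] by blast
      have "min (min \<eta> \<delta>) (d - x) > 0" using \<delta> \<open>\<eta> > 0\<close> x by simp
      from order_tendstoD(2)[OF hlim this] obtain n0 where n0: "\<And>n. n \<ge> n0 \<Longrightarrow> h n < min (min \<eta> \<delta>) (d - x)"
        unfolding eventually_sequentially by blast
      \<comment> \<open>Otherwise the quotients would eventually stay above
        \<open>v x + \<epsilon> / 2\<close>, and so would their liminf, which equals
        \<open>v x\<close> here.\<close>
      have "\<exists>n\<ge>n0. s n x < v x + \<epsilon> / 2"
      proof (rule ccontr)
        assume "\<not> ?thesis"
        then have "\<And>n. n \<ge> n0 \<Longrightarrow> v x + \<epsilon> / 2 \<le> s n x" by (meson not_le)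
        then have "\<forall>\<^sub>F n in sequentially. ennreal (v x + \<epsilon> / 2) \<le> ennreal (s n x)"
          unfolding eventually_sequentially using ennreal_leI by blast
        then have "ennreal (v x + \<epsilon> / 2) \<le> L x" unfolding L_def by (rule Liminf_bounded)
        also have "L x = ennreal (v x)" using N1(2)[of x] x by (simp add: v_def less_top)
        finally have "v x + \<epsilon> / 2 \<le> v x" by (simp add: v0)
        then show False using \<epsilon>(1) by simp
      qed
      then obtain n where n: "n \<ge> n0" "s n x < v x + \<epsilon> / 2" by blast
      have hn: "h n < \<eta>" "h n < \<delta>" "h n < d - x" using n0[OF n(1)] by auto
      have "x \<in> {a..b - h n}" using hn(3) x cd by auto
      then have "\<bar>F (x + h n) - F x\<bar> < (v x + \<epsilon> / 2) * h n"
        using n(2) h(1)[of n] by (simp add: s_def divide_less_eq)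
      then have 1: "G (x + h n) - G x < v x * h n + \<epsilon> / 2 * h n"
        using G(2)[of "x + h n" x] by (simp add: algebra_simps)
      have 2: "\<bar>integral {a..x + h n} v - integral {a..x} v - h n * v x\<bar> \<le> \<epsilon> / 2 * h n"
        using \<delta>(2)[of "x + h n"] h(1)[of n] hn(2) by simp
      have "H (x + h n) - H x \<le> \<epsilon> * h n"
        using 1 abs_le_D2[OF 2] unfolding H_def by (simp add: algebra_simps)
      then show "\<exists>y. x < y \<and> y - x < \<eta> \<and> y \<le> d \<and> H y - H x \<le> \<epsilon> * (y - x)"
        using hn h(1)[of n] by (intro exI[of _ "x + h n"]) auto
    qed
    moreover have "integral {a..d} v - integral {a..c} v = integral {c..d} v"
      by (rule integral_diff_subinterval[OF vint' cd])
    ultimately show "G d - G c \<le> integral {c..d} v + e" using \<epsilon>(2) unfolding H_def by linarith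
  qed
  show ?thesis
  proof (rule that[OF vabs v0])
    have "integral {a..b} v \<le> integral UNIV v" by (rule integral_subset_le) (use vint vint' v0 in auto)
    then show "integral {a..b} v \<le> B" using vB by simp
    fix c d assume cd: "a \<le> c" "c \<le> d" "d \<le> b"
    have neg: "abs_cont_on a b (\<lambda>x. - F x)"
      using abs_cont_on_linear[OF ac bounded_linear_minus[OF bounded_linear_ident]] .
    have "F d - F c \<le> integral {c..d} v" by (rule main[OF ac _ cd]) simp
    moreover have "- F d - - F c \<le> integral {c..d} v" by (rule main[OF neg _ cd]) simp
    ultimately show "\<bar>F d - F c\<bar> \<le> integral {c..d} v" by (simp add: abs_le_iff)
  qed
qed

lemma abs_cont_on_bounded_variation_eq_integral:
  fixes F :: "real \<Rightarrow> real"
  assumes ac: "abs_cont_on a b F" and "a < b"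
    and B: "\<And>D S. D division_of S \<Longrightarrow> S \<subseteq> {a..b} \<Longrightarrow> (\<Sum>K\<in>D. \<bar>F (Sup K) - F (Inf K)\<bar>) \<le> B"
  obtains w where "w absolutely_integrable_on {a..b}" "\<And>x. x \<in> {a..b} \<Longrightarrow> F x - F a = integral {a..x} w"
proof -
  obtain v where v: "v absolutely_integrable_on {a..b}" "\<And>x. 0 \<le> v x" "integral {a..b} v \<le> B"
    "\<And>c d. a \<le> c \<Longrightarrow> c \<le> d \<Longrightarrow> d \<le> b \<Longrightarrow> \<bar>F d - F c\<bar> \<le> integral {c..d} v"
  proof (rule abs_cont_slope_density[OF ac \<open>a < b\<close>, of B])
    show "(\<Sum>K\<in>D. \<bar>F (Sup K) - F (Inf K)\<bar>) \<le> B" if "D division_of S" "S \<subseteq> {a..b}" for D S by (rule B[OF that])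
  qed (rule that; blast)
  have vi: "v integrable_on {a..b}" using v(1) by (simp add: absolutely_integrable_on_def)
  define P where "P = (\<lambda>x. F x + integral {a..x} v)"
  have acP: "abs_cont_on a b P" unfolding P_def by (intro abs_cont_on_add ac abs_cont_on_integral v(1))
  have mono: "P c \<le> P d" if cd: "a \<le> c" "c \<le> d" "d \<le> b" for c d
    using v(4)[OF cd] integral_diff_subinterval[OF vi cd] unfolding P_def by linarith
  have BP: "(\<Sum>K\<in>D. \<bar>P (Sup K) - P (Inf K)\<bar>) \<le> P b - P a" if D: "D division_of S" "S \<subseteq> {a..b}" for D S
  proof -
    have UD: "D division_of \<Union>D" "\<Union>D \<subseteq> {a..b}" using D division_ofD(6)[OF D(1)] by auto
    obtain q where q: "D \<subseteq> q" "q division_of {a..b}"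
      using partial_division_extend_interval[OF UD(1), of a b] UD(2) by auto
    have pos: "0 \<le> P (Sup K) - P (Inf K)" if "K \<in> q" for K
      using content_eq_Sup_Inf[OF q(2) that] mono[of "Inf K" "Sup K"] by auto
    have "(\<Sum>K\<in>D. \<bar>P (Sup K) - P (Inf K)\<bar>) = (\<Sum>K\<in>D. P (Sup K) - P (Inf K))"
      using pos q(1) by (intro sum.cong refl abs_of_nonneg) blast
    also have "\<dots> \<le> (\<Sum>K\<in>q. P (Sup K) - P (Inf K))"
      using pos q by (intro sum_mono2) auto
    also have "\<dots> = P b - P a" using \<open>a < b\<close> by (intro sum_division_telescope q(2)) simp
    finally show ?thesis .
  qed
  obtain w where w: "w absolutely_integrable_on {a..b}" "\<And>x. 0 \<le> w x" "integral {a..b} w \<le> P b - P a"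
    "\<And>c d. a \<le> c \<Longrightarrow> c \<le> d \<Longrightarrow> d \<le> b \<Longrightarrow> \<bar>P d - P c\<bar> \<le> integral {c..d} w"
  proof (rule abs_cont_slope_density[OF acP \<open>a < b\<close>, of "P b - P a"])
    show "(\<Sum>K\<in>D. \<bar>P (Sup K) - P (Inf K)\<bar>) \<le> P b - P a" if "D division_of S" "S \<subseteq> {a..b}" for D S by (rule BP[OF that])
  qed (rule that; blast)
  have wi: "w integrable_on {a..b}" using w(1) by (simp add: absolutely_integrable_on_def)
  show ?thesis
  proof (rule that)
    show "(\<lambda>x. w x - v x) absolutely_integrable_on {a..b}" by (rule set_integral_diff(1)[OF w(1) v(1)])
    fix x assume x: "x \<in> {a..b}"
    \<comment> \<open>On \<open>{a..x}\<close> and on \<open>{x..b}\<close> the increment of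
      \<open>P\<close> is at most the integral of \<open>w\<close>, while the integral over the
      whole interval is at most the total increment; so neither inequality can be strict.\<close>
    have "P x - P a \<le> integral {a..x} w" using w(4)[of a x] x by auto
    moreover have "P b - P x \<le> integral {x..b} w" using w(4)[of x b] x by auto
    moreover have "integral {a..b} w - integral {a..x} w = integral {x..b} w"
      using x by (intro integral_diff_subinterval[OF wi]) auto
    ultimately have "P x - P a = integral {a..x} w" using w(3) by linarith
    then have "F x - F a = integral {a..x} w - integral {a..x} v" by (simp add: P_def)
    also have "\<dots> = integral {a..x} (\<lambda>x. w x - v x)"
      by (rule integral_diff[symmetric]; rule integrable_on_subinterval, (rule wi vi), use x in auto)
    finally show "F x - F a = integral {a..x} (\<lambda>x. w x - v x)" .
  qed
qed

text \<open>Absolute continuity with tolerance 1 bounds the variation sums by 1 on every interval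
  shorter than the corresponding \<delta>, so the bounded variation result applies locally. The
  bisection principle glues the local densities, without a global variation bound.\<close>

lemma abs_cont_on_real_eq_integral:
  fixes F :: "real \<Rightarrow> real"
  assumes ac: "abs_cont_on a b F" and "a \<le> b"
  obtains w where "w absolutely_integrable_on {a..b}" "\<And>x. x \<in> {a..b} \<Longrightarrow> F x - F a = integral {a..x} w"
proof -
  \<comment> \<open>The inclusion in \<open>{a..b}\<close> is a premise inside \<open>Q\<close>,
    because the local step of the bisection principle also ranges over intervals that stick
    out.\<close>
  define Q where "Q = (\<lambda>c d. a \<le> c \<longrightarrow> d \<le> b \<longrightarrow>
    (\<exists>w. w absolutely_integrable_on {c..d} \<and> (\<forall>x\<in>{c..d}. F x - F c = integral {c..x} w)))"
  have "Q a b" using \<open>a \<le> b\<close>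
  proof (induction rule: Bolzano)
    case (trans c m d)
    show ?case unfolding Q_def
    proof (intro impI)
      assume "a \<le> c" "d \<le> b"
      then obtain w1 w2 where w1: "w1 absolutely_integrable_on {c..m}" "\<And>x. x \<in> {c..m} \<Longrightarrow> F x - F c = integral {c..x} w1"
        and w2: "w2 absolutely_integrable_on {m..d}" "\<And>x. x \<in> {m..d} \<Longrightarrow> F x - F m = integral {m..x} w2"
        using trans unfolding Q_def by fastforce
      define w where "w = (\<lambda>x. if x \<le> m then w1 x else w2 x)"
      have a1: "w absolutely_integrable_on {c..m}"
        by (rule absolutely_integrable_spike[OF w1(1) negligible_empty]) (auto simp: w_def)
      have a2: "w absolutely_integrable_on {m..d}"
        by (rule absolutely_integrable_spike[OF w2(1) negligible_sing[of m]]) (auto simp: w_def)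
      have a3: "w absolutely_integrable_on {c..d}"
        by (rule absolutely_integrable_on_combine[OF a1 a2]) (use trans in auto)
      have "F x - F c = integral {c..x} w" if x: "x \<in> {c..d}" for x
      proof (cases "x \<le> m")
        case True
        then have "integral {c..x} w = integral {c..x} w1" by (intro integral_cong) (auto simp: w_def)
        then show ?thesis using w1(2)[of x] x True by simp
      next
        case False
        have "w integrable_on {c..d}" using a3 by (simp add: absolutely_integrable_on_def)
        then have "integral {c..x} w - integral {c..m} w = integral {m..x} w"
          using False x trans by (intro integral_diff_subinterval) auto
        moreover have "integral {c..m} w = integral {c..m} w1" by (intro integral_cong) (auto simp: w_def)
        moreover have "integral {m..x} w = integral {m..x} w2"
          by (rule integral_spike[OF negligible_sing[of m]]) (auto simp: w_def)
        ultimately show ?thesis using w1(2)[of m] w2(2)[of x] x False trans by simp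
      qed
      with a3 show "\<exists>w. w absolutely_integrable_on {c..d} \<and> (\<forall>x\<in>{c..d}. F x - F c = integral {c..x} w)" by blast
    qed
  next
    case (local x)
    obtain \<delta> where \<delta>: "\<delta> > 0" "\<And>D S. D division_of S \<and> S \<subseteq> {a..b} \<and> (\<Sum>K\<in>D. measure lborel K) < \<delta> \<Longrightarrow>
     (\<Sum>K\<in>D. norm (F (Sup K) - F (Inf K))) < 1" using ac unfolding abs_cont_on_def by (meson zero_less_one)
    show ?case
    proof (intro exI conjI allI impI)
      fix c d assume cd: "c \<le> x \<and> x \<le> d \<and> d - c < \<delta>"
      show "Q c d" unfolding Q_def
      proof (intro impI)
        assume ab: "a \<le> c" "d \<le> b"
        show "\<exists>w. w absolutely_integrable_on {c..d} \<and> (\<forall>x\<in>{c..d}. F x - F c = integral {c..x} w)"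
        proof (cases "c < d")
          case True
          have le1: "(\<Sum>K\<in>D. \<bar>F (Sup K) - F (Inf K)\<bar>) \<le> 1" if D: "D division_of S" "S \<subseteq> {c..d}" for D S
          proof -
            have "(\<Sum>K\<in>D. measure lborel K) \<le> d - c"
              using subadditive_content_division[OF D(1), of c d] D(2) True by simp
            then show ?thesis using \<delta>(2)[of D S] D cd ab by fastforce
          qed
          show ?thesis
          proof (rule abs_cont_on_bounded_variation_eq_integral[OF abs_cont_on_subinterval[OF ac ab] True, of 1])
            show "(\<Sum>K\<in>D. \<bar>F (Sup K) - F (Inf K)\<bar>) \<le> 1" if "D division_of S" "S \<subseteq> {c..d}" for D S
              by (rule le1[OF that])
          qed blast
        next
          case False
          then have "c = x" "d = x" using cd by auto
          then show ?thesis by (intro exI[of _ "\<lambda>_. 0"]) simp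
        qed
      qed
    qed (rule \<delta>(1))
  qed
  then show ?thesis using that unfolding Q_def by blast
qed

lemma abs_cont_on_eq_integral:
  fixes F :: "real \<Rightarrow> 'a::euclidean_space"
  assumes ac: "abs_cont_on a b F" and "a \<le> b"
  obtains w where "w absolutely_integrable_on {a..b}" "\<And>x. x \<in> {a..b} \<Longrightarrow> F x - F a = integral {a..x} w"
proof -
  have "\<exists>w. w absolutely_integrable_on {a..b} \<and> (\<forall>x\<in>{a..b}. F x \<bullet> i - F a \<bullet> i = integral {a..x} w)" for i
    by (rule abs_cont_on_real_eq_integral[OF abs_cont_on_linear[OF ac bounded_linear_inner_left[of i]] \<open>a \<le> b\<close>]) blast
  then obtain w where w: "\<And>i. w i absolutely_integrable_on {a..b}"
    "\<And>i x. x \<in> {a..b} \<Longrightarrow> F x \<bullet> i - F a \<bullet> i = integral {a..x} (w i)" by metis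
  define W where "W = (\<lambda>x. \<Sum>i\<in>Basis. w i x *\<^sub>R (i::'a))"
  have comp: "W x \<bullet> i = w i x" if "i \<in> Basis" for i x using that by (simp add: W_def)
  have W: "W absolutely_integrable_on {a..b}"
    by (rule absolutely_integrable_componentwise) (simp add: comp w)
  show ?thesis
  proof (rule that[OF W])
    fix x assume x: "x \<in> {a..b}"
    have Wx: "W integrable_on {a..x}"
      by (rule integrable_on_subinterval[of _ "{a..b}"]) (use W x in \<open>auto simp: absolutely_integrable_on_def\<close>)
    show "F x - F a = integral {a..x} W"
    proof (rule euclidean_eqI)
      fix i :: 'a assume i: "i \<in> Basis"
      have "integral {a..x} W \<bullet> i = integral {a..x} (\<lambda>x. W x \<bullet> i)" by (rule integral_component_eq[OF Wx, symmetric])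
      also have "\<dots> = integral {a..x} (w i)" using comp[OF i] by simp
      finally show "(F x - F a) \<bullet> i = integral {a..x} W \<bullet> i" using w(2)[OF x, of i] by (simp add: inner_diff_left)
    qed
  qed
qed

theorem abs_cont_on_AE_derivative:
  fixes F :: "real \<Rightarrow> 'a::euclidean_space"
  assumes ac: "abs_cont_on a b F" and "a \<le> b"
  obtains w N where "w absolutely_integrable_on {a..b}" "\<And>x. x \<in> {a..b} \<Longrightarrow> F x - F a = integral {a..x} w"
    "negligible N" "\<And>x. x \<in> {a<..<b} - N \<Longrightarrow> (F has_vector_derivative w x) (at x)"
proof -
  obtain w where w: "w absolutely_integrable_on {a..b}" "\<And>x. x \<in> {a..b} \<Longrightarrow> F x - F a = integral {a..x} w"
    by (rule abs_cont_on_eq_integral[OF assms]) (rule that; blast)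
  then have wi: "w integrable_on {a..b}" by (simp add: absolutely_integrable_on_def)
  obtain N where N: "negligible N"
    "\<And>x. x \<in> {a<..<b} - N \<Longrightarrow> ((\<lambda>x. integral {a..x} w) has_vector_derivative w x) (at x)"
    using indefinite_integral_has_vector_derivative_AE[OF wi] by blast
  show ?thesis
  proof (rule that[OF w N(1)])
    fix x assume x: "x \<in> {a<..<b} - N"
    have "((\<lambda>x. F a + integral {a..x} w) has_vector_derivative w x) (at x)"
      using has_vector_derivative_add[OF has_vector_derivative_const N(2)[OF x], of "F a"] by simp
    then show "(F has_vector_derivative w x) (at x)"
    proof (rule has_vector_derivative_transform_within_open)
      show "F a + integral {a..y} w = F y" if "y \<in> {a<..<b}" for y using w(2)[of y] that by (simp add: algebra_simps)
    qed (use x in auto)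
  qed
qed

text \<open>Derivatives at a point are unique, so any \<open>D\<close> that is the derivative off a
  null set equals the density almost everywhere. Differential identities known only almost
  everywhere are integrated through this result.\<close>

theorem abs_cont_on_integral_of_derivative:
  fixes F :: "real \<Rightarrow> 'a::euclidean_space"
  assumes ac: "abs_cont_on a b F" and N: "negligible N"
    and D: "\<And>x. x \<in> {a<..<b} - N \<Longrightarrow> (F has_vector_derivative D x) (at x)"
  shows "D absolutely_integrable_on {a..b}" "\<And>x. x \<in> {a..b} \<Longrightarrow> F x - F a = integral {a..x} D"
proof -
  have *: "D absolutely_integrable_on {a..b} \<and> (\<forall>x\<in>{a..b}. F x - F a = integral {a..x} D)"
  proof (cases "a \<le> b")
    case True
    obtain w M where w: "w absolutely_integrable_on {a..b}" "\<And>x. x \<in> {a..b} \<Longrightarrow> F x - F a = integral {a..x} w"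
      "negligible M" "\<And>x. x \<in> {a<..<b} - M \<Longrightarrow> (F has_vector_derivative w x) (at x)"
      using abs_cont_on_AE_derivative[OF ac True] by blast
    have neg: "negligible (N \<union> M \<union> {a, b})" using N w(3) by simp
    have eq: "D x = w x" if "x \<in> {a..b} - (N \<union> M \<union> {a, b})" for x
      using vector_derivative_unique_at[OF D[of x] w(4)[of x]] that by auto
    have "D absolutely_integrable_on {a..b}" by (rule absolutely_integrable_spike[OF w(1) neg eq])
    moreover have "F x - F a = integral {a..x} D" if "x \<in> {a..b}" for x
      unfolding w(2)[OF that] by (rule integral_spike[OF neg]) (use eq that in auto)
    ultimately show ?thesis by blast
  qed auto
  then show "D absolutely_integrable_on {a..b}" "\<And>x. x \<in> {a..b} \<Longrightarrow> F x - F a = integral {a..x} D" by auto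
qed

section \<open>Linear integral equations with integrable coefficients\<close>

lemma absolutely_integrable_on_subinterval_integrable:
  fixes f :: "real \<Rightarrow> 'a::euclidean_space"
  assumes "f absolutely_integrable_on {a..b}" "a \<le> c" "d \<le> b"
  shows "f integrable_on {c..d}"
proof (rule integrable_on_subinterval)
  show "f integrable_on {a..b}" using assms(1) by (simp add: absolutely_integrable_on_def)
qed (use assms in auto)

lemma absolutely_integrable_mult_continuous:
  fixes f g :: "real \<Rightarrow> 'a::{real_normed_algebra,euclidean_space}"
  assumes f: "f absolutely_integrable_on {a..b}" and g: "continuous_on {a..b} g"
  shows "(\<lambda>x. f x * g x) absolutely_integrable_on {a..b}" "(\<lambda>x. g x * f x) absolutely_integrable_on {a..b}"
proof -
  have gm: "g \<in> borel_measurable (lebesgue_on {a..b})"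
    using g by (rule continuous_imp_measurable_on_sets_lebesgue) simp
  have gb: "bounded (g ` {a..b})"
    by (intro compact_imp_bounded compact_continuous_image g) simp
  have bil: "bilinear (\<lambda>x y :: 'a. x * y)" "bilinear (\<lambda>x y :: 'a. y * x)"
    by (auto simp: bilinear_def linear_iff algebra_simps)
  show "(\<lambda>x. f x * g x) absolutely_integrable_on {a..b}"
    using absolutely_integrable_bounded_measurable_product[OF bil(2) gm _ gb f] by simp
  show "(\<lambda>x. g x * f x) absolutely_integrable_on {a..b}"
    using absolutely_integrable_bounded_measurable_product[OF bil(1) gm _ gb f] by simp
qed

section \<open>Exponential weights, Gronwall's inequality and Picard iteration\<close>

lemma abs_cont_on_exp:
  fixes F :: "real \<Rightarrow> complex"
  assumes F: "abs_cont_on a b F"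
  shows "abs_cont_on a b (\<lambda>x. exp (F x))"
proof -
  obtain M where M: "M > 0" "\<And>x. x \<in> {a..b} \<Longrightarrow> norm (F x) \<le> M" using abs_cont_on_bounded[OF F] by blast
  show ?thesis
  proof (rule abs_cont_on_lipschitz_compose[OF F, where C = "exp M"])
    fix x y assume xy: "x \<in> {a..b}" "y \<in> {a..b}"
    show "norm (exp (F y) - exp (F x)) \<le> exp M * norm (F y - F x)"
    proof (rule field_differentiable_bound[of "cball 0 M" exp exp])
      show "(exp has_field_derivative exp z) (at z within cball 0 M)" for z :: complex
        by (intro derivative_eq_intros) auto
      show "cmod (exp z) \<le> exp M" if "z \<in> cball 0 M" for z
        using that complex_Re_le_cmod[of z] by (simp add: norm_exp_eq_Re)
    qed (use M xy in auto)
  qed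
qed

lemma abs_cont_on_exp_real:
  fixes F :: "real \<Rightarrow> real"
  assumes "abs_cont_on a b F"
  shows "abs_cont_on a b (\<lambda>x. exp (F x))"
proof -
  have "abs_cont_on a b (\<lambda>x. Re (exp (complex_of_real (F x))))"
    by (intro abs_cont_on_linear[OF abs_cont_on_exp bounded_linear_Re] abs_cont_on_linear[OF assms bounded_linear_of_real])
  then show ?thesis by (simp add: exp_of_real)
qed

text \<open>\<open>k * exp (2 * m)\<close> is half the derivative of \<open>exp (2 * m)\<close>. For
  nonnegative \<open>k\<close>, integration against \<open>k\<close> thus halves the supremum norm
  weighted by \<open>exp (- 2 * m)\<close>: the contraction behind both Gronwall's inequality and
  the Picard iteration.\<close>

lemma integral_mult_exp_integral:
  fixes k :: "real \<Rightarrow> real"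
  assumes k: "k absolutely_integrable_on {a..b}" and m: "\<And>t. m t = integral {a..t} k"
  shows "(\<lambda>s. k s * exp (2 * m s)) absolutely_integrable_on {a..b}"
    "\<And>t. t \<in> {a..b} \<Longrightarrow> integral {a..t} (\<lambda>s. k s * exp (2 * m s)) \<le> exp (2 * m t) / 2"
proof -
  have mac: "abs_cont_on a b m" using abs_cont_on_integral[OF k] m by presburger
  have ki: "k integrable_on {a..b}" using k by (simp add: absolutely_integrable_on_def)
  obtain N where N: "negligible N" "\<And>x. x \<in> {a<..<b} - N \<Longrightarrow> (m has_vector_derivative k x) (at x)"
    using indefinite_integral_has_vector_derivative_AE[OF ki] m by (metis (no_types, lifting) ext)
  have ac: "abs_cont_on a b (\<lambda>t. exp (2 * m t))"
    by (intro abs_cont_on_exp_real abs_cont_on_linear[OF mac bounded_linear_mult_right])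
  have der: "((\<lambda>t. exp (2 * m t)) has_vector_derivative 2 * (k x * exp (2 * m x))) (at x)" if "x \<in> {a<..<b} - N" for x
    using N(2)[OF that] unfolding has_real_derivative_iff_has_vector_derivative[symmetric]
    by (auto intro!: derivative_eq_intros)
  show "(\<lambda>s. k s * exp (2 * m s)) absolutely_integrable_on {a..b}"
    by (rule absolutely_integrable_mult_continuous(1)[OF k abs_cont_on_imp_continuous_on[OF ac]])
  fix t assume t: "t \<in> {a..b}"
  have "exp (2 * m t) - exp (2 * m a) = 2 * integral {a..t} (\<lambda>s. k s * exp (2 * m s))"
  proof -
    have "exp (2 * m t) - exp (2 * m a) = integral {a..t} (\<lambda>s. 2 * (k s * exp (2 * m s)))"
      by (rule abs_cont_on_integral_of_derivative(2)[OF ac N(1) der t])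
    then show ?thesis by simp
  qed
  then show "integral {a..t} (\<lambda>s. k s * exp (2 * m s)) \<le> exp (2 * m t) / 2"
    using exp_ge_zero[of "2 * m a"] by linarith
qed

text \<open>At a maximum point \<open>t0\<close> of \<open>N * exp (- 2 * m)\<close>, with positive
  value \<open>c\<close>, the hypothesis gives
  \<open>c * exp (2 * m t0) \<le> \<epsilon> + c * exp (2 * m t0) / 2\<close>, whence
  \<open>c \<le> 2 * \<epsilon>\<close>. The constants are not sharp, but continuity of
  \<open>N\<close> is all the argument asks for.\<close>

lemma gronwall:
  fixes N k :: "real \<Rightarrow> real"
  assumes k: "k absolutely_integrable_on {a..b}" and k0: "\<And>s. s \<in> {a..b} \<Longrightarrow> 0 \<le> k s"
    and m: "\<And>t. m t = integral {a..t} k"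
    and N: "continuous_on {a..b} N"
    and le: "\<And>t. t \<in> {a..b} \<Longrightarrow> N t \<le> \<epsilon> + integral {a..t} (\<lambda>s. k s * N s)" and "\<epsilon> \<ge> 0"
    and t: "t \<in> {a..b}"
  shows "N t \<le> 2 * \<epsilon> * exp (2 * m t)"
proof -
  have mac: "abs_cont_on a b m" using abs_cont_on_integral[OF k] m by presburger
  have mc: "continuous_on {a..b} m" by (rule abs_cont_on_imp_continuous_on[OF mac])
  have ki: "k integrable_on {a..b}" using k by (simp add: absolutely_integrable_on_def)
  have m0: "m s \<ge> 0" if "s \<in> {a..b}" for s
    unfolding m by (rule integral_nonneg[OF integrable_on_subinterval[OF ki]]) (use that k0 in auto)
  have "continuous_on {a..b} (\<lambda>s. N s * exp (- 2 * m s))" by (intro continuous_intros N mc)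
  then obtain t0 where t0: "t0 \<in> {a..b}" "\<And>s. s \<in> {a..b} \<Longrightarrow> N s * exp (- 2 * m s) \<le> N t0 * exp (- 2 * m t0)"
    using continuous_attains_sup[of "{a..b}" "\<lambda>s. N s * exp (- 2 * m s)"] t by auto
  define c where "c = N t0 * exp (- 2 * m t0)"
  have Ns: "N s \<le> c * exp (2 * m s)" if "s \<in> {a..b}" for s
    using t0(2)[OF that] mult_right_mono[of "N s * exp (- 2 * m s)" c "exp (2 * m s)"]
    by (simp add: c_def mult.assoc flip: exp_add)
  have Nt0: "N t0 = c * exp (2 * m t0)" by (simp add: c_def mult.assoc flip: exp_add)
  note W = integral_mult_exp_integral[OF k m]
  have sub: "{a..t0} \<subseteq> {a..b}" using t0(1) by auto
  have i1: "(\<lambda>s. k s * N s) integrable_on {a..t0}"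
    using t0(1) by (intro absolutely_integrable_on_subinterval_integrable[OF absolutely_integrable_mult_continuous(1)[OF k N]]) auto
  have i2: "(\<lambda>s. c * (k s * exp (2 * m s))) integrable_on {a..t0}"
    using t0(1) by (intro integrable_on_mult_right absolutely_integrable_on_subinterval_integrable[OF W(1)]) auto
  have "c \<le> 2 * \<epsilon>"
  proof (cases "c \<le> 0")
    case False
    have "N t0 \<le> \<epsilon> + integral {a..t0} (\<lambda>s. k s * N s)" by (rule le[OF t0(1)])
    also have "integral {a..t0} (\<lambda>s. k s * N s) \<le> integral {a..t0} (\<lambda>s. c * (k s * exp (2 * m s)))"
    proof (rule integral_le[OF i1 i2])
      fix s assume "s \<in> {a..t0}"
      then have "s \<in> {a..b}" using sub by blast
      from mult_left_mono[OF Ns[OF this] k0[OF this]] show "k s * N s \<le> c * (k s * exp (2 * m s))" by (simp add: mult_ac)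
    qed
    also have "\<dots> = c * integral {a..t0} (\<lambda>s. k s * exp (2 * m s))" by simp
    also have "\<dots> \<le> c * (exp (2 * m t0) / 2)" using W(2)[OF t0(1)] False by (intro mult_left_mono) auto
    finally have "c * exp (2 * m t0) \<le> 2 * \<epsilon>" using Nt0 by simp
    moreover have "c * 1 \<le> c * exp (2 * m t0)" using m0[OF t0(1)] False by (intro mult_left_mono) auto
    ultimately show ?thesis by simp
  qed (use \<open>\<epsilon> \<ge> 0\<close> in auto)
  then show ?thesis by (intro order_trans[OF Ns[OF t] mult_right_mono]) auto
qed

primrec picard :: "real \<Rightarrow> (real \<Rightarrow> 'v \<Rightarrow> 'v) \<Rightarrow> nat \<Rightarrow> real \<Rightarrow> 'v::euclidean_space" where
  "picard a G 0 t = 0"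
| "picard a G (Suc n) t = integral {a..t} (\<lambda>s. G s (picard a G n s))"

text \<open>In the norm weighted by \<open>exp (- 2 * m)\<close> every step halves distances,
  however large \<open>k\<close> is, so no short intervals have to be patched together. The explicit
  rate belongs to the conclusion because convergence must later be uniform in a parameter.\<close>

lemma picard_convergence:
  fixes G :: "real \<Rightarrow> 'v \<Rightarrow> 'v::euclidean_space"
  assumes k: "k absolutely_integrable_on {a..b}" and m: "\<And>t. m t = integral {a..t} k"
    and lip: "\<And>s v w. s \<in> {a..b} \<Longrightarrow> norm (G s v - G s w) \<le> k s * norm (v - w)"
    and int: "\<And>x. continuous_on {a..b} x \<Longrightarrow> (\<lambda>s. G s (x s)) absolutely_integrable_on {a..b}"
    and C: "\<And>t. t \<in> {a..b} \<Longrightarrow> norm (integral {a..t} (\<lambda>s. G s 0)) \<le> C"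
  obtains x where "continuous_on {a..b} x" "\<And>t. t \<in> {a..b} \<Longrightarrow> x t = integral {a..t} (\<lambda>s. G s (x s))"
    "\<And>n t. t \<in> {a..b} \<Longrightarrow> norm (x t - picard a G n t) \<le> 2 * C * (1 / 2) ^ n * exp (2 * m t)"
proof -
  define p where "p = picard a G"
  have p0: "p 0 = (\<lambda>t. 0)" by (auto simp: p_def)
  have pS: "p (Suc n) = (\<lambda>t. integral {a..t} (\<lambda>s. G s (p n s)))" for n by (auto simp: p_def)
  have sub: "{a..t} \<subseteq> {a..b}" if "t \<in> {a..b}" for t using that by auto
  have intt: "(\<lambda>s. G s (x s)) integrable_on {a..t}" if "continuous_on {a..b} x" "t \<in> {a..b}" for x t
    using that(2) by (intro absolutely_integrable_on_subinterval_integrable[OF int[OF that(1)]]) auto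
  have pc: "continuous_on {a..b} (p n)" for n
  proof (induction n)
    case (Suc n)
    show ?case unfolding pS by (rule abs_cont_on_imp_continuous_on[OF abs_cont_on_integral[OF int[OF Suc]]])
  qed (simp add: p0)
  note W = integral_mult_exp_integral[OF k m]
  have Wi: "(\<lambda>s. c * (k s * exp (2 * m s))) integrable_on {a..t}" if "t \<in> {a..b}" for t c
    using that by (intro integrable_on_mult_right absolutely_integrable_on_subinterval_integrable[OF W(1)]) auto
  have step: "norm (integral {a..t} (\<lambda>s. G s (x s)) - integral {a..t} (\<lambda>s. G s (y s))) \<le> c / 2 * exp (2 * m t)"
    if x: "continuous_on {a..b} x" and y: "continuous_on {a..b} y" and t: "t \<in> {a..b}" and "c \<ge> 0"
      and d: "\<And>s. s \<in> {a..b} \<Longrightarrow> norm (x s - y s) \<le> c * exp (2 * m s)" for x y t c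
  proof -
    have "integral {a..t} (\<lambda>s. G s (x s)) - integral {a..t} (\<lambda>s. G s (y s)) = integral {a..t} (\<lambda>s. G s (x s) - G s (y s))"
      by (rule integral_diff[symmetric]) (intro intt x y t)+
    also have "norm \<dots> \<le> integral {a..t} (\<lambda>s. c * (k s * exp (2 * m s)))"
    proof (rule integral_norm_bound_integral[OF _ Wi[OF t]])
      show "(\<lambda>s. G s (x s) - G s (y s)) integrable_on {a..t}" by (intro integrable_diff intt x y t)
      fix s assume "s \<in> {a..t}"
      then have s: "s \<in> {a..b}" using sub[OF t] by blast
      have "norm (G s (x s) - G s (y s)) \<le> k s * norm (x s - y s)" by (rule lip[OF s])
      also have "\<dots> \<le> k s * (c * exp (2 * m s))"
      proof (rule mult_left_mono[OF d[OF s]])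
        \<comment> \<open>The Lipschitz bound for a vector of norm 1 against 0 forces
          \<open>k s\<close> to be nonnegative.\<close>
        obtain i :: 'v where "i \<in> Basis" using nonempty_Basis by blast
        then show "0 \<le> k s" using order_trans[OF norm_ge_zero lip[OF s, of i 0]] by simp
      qed
      finally show "norm (G s (x s) - G s (y s)) \<le> c * (k s * exp (2 * m s))" by (simp add: mult_ac)
    qed
    also have "\<dots> = c * integral {a..t} (\<lambda>s. k s * exp (2 * m s))" by simp
    also have "\<dots> \<le> c * (exp (2 * m t) / 2)" using W(2)[OF t] \<open>c \<ge> 0\<close> by (rule mult_left_mono)
    finally show ?thesis by simp
  qed
  have m0: "m a = 0" by (simp add: m)
  have C0: "C \<ge> 0" if "t \<in> {a..b}" for t using C[OF that] norm_ge_zero order_trans by blast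
  have k0: "k s \<ge> 0" if s: "s \<in> {a..b}" for s
  proof -
    obtain i :: 'v where "i \<in> Basis" using nonempty_Basis by blast
    then show "0 \<le> k s" using order_trans[OF norm_ge_zero lip[OF s, of i 0]] by simp
  qed
  have mpos: "m t \<ge> 0" if "t \<in> {a..b}" for t
    unfolding m using k0 that by (intro integral_nonneg absolutely_integrable_on_subinterval_integrable[OF k]) auto
  have d: "norm (p (Suc n) t - p n t) \<le> C * (1 / 2) ^ n * exp (2 * m t)" if "t \<in> {a..b}" for n t
    using that
  proof (induction n arbitrary: t)
    case 0
    have "norm (p (Suc 0) t - p 0 t) \<le> C * 1" using C[OF 0] by (simp add: pS p0)
    also have "\<dots> \<le> C * exp (2 * m t)" using C0[OF 0] mpos[OF 0] by (intro mult_left_mono) auto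
    finally show ?case by simp
  next
    case (Suc n)
    have "norm (p (Suc (Suc n)) t - p (Suc n) t) \<le> C * (1 / 2) ^ n / 2 * exp (2 * m t)"
      unfolding pS[of "Suc n"] using step[OF pc pc Suc.prems _ Suc.IH] C0[OF Suc.prems] by (subst (2) pS) simp
    then show ?case by simp
  qed
  \<comment> \<open>Keeping the exact geometric partial sum lets the induction close; the subtracted
    term is dropped afterwards.\<close>
  have dd: "norm (p (n + j) t - p n t) \<le> 2 * C * exp (2 * m t) * ((1 / 2) ^ n - (1 / 2) ^ (n + j))" if t: "t \<in> {a..b}" for n j t
  proof (induction j)
    case (Suc j)
    have "norm (p (n + Suc j) t - p n t) \<le> norm (p (Suc (n + j)) t - p (n + j) t) + norm (p (n + j) t - p n t)"
      using norm_triangle_ineq[of "p (Suc (n + j)) t - p (n + j) t" "p (n + j) t - p n t"] by simp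
    also have "\<dots> \<le> C * (1 / 2) ^ (n + j) * exp (2 * m t) + 2 * C * exp (2 * m t) * ((1 / 2) ^ n - (1 / 2) ^ (n + j))"
      by (intro add_mono d t Suc)
    also have "\<dots> = 2 * C * exp (2 * m t) * ((1 / 2) ^ n - (1 / 2) ^ (n + Suc j))" by (simp add: algebra_simps)
    finally show ?case .
  qed simp
  have dd': "norm (p (n + j) t - p n t) \<le> 2 * C * (1 / 2) ^ n * exp (2 * m t)" if t: "t \<in> {a..b}" for n j t
  proof -
    have "2 * C * exp (2 * m t) * ((1 / 2) ^ n - (1 / 2) ^ (n + j)) \<le> 2 * C * exp (2 * m t) * (1 / 2) ^ n"
      using C0[OF t] by (intro mult_left_mono) auto
    with dd[OF t, of n j] show ?thesis by (simp add: mult_ac)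
  qed
  have ex: "\<exists>l. (\<lambda>n. p n t) \<longlonglongrightarrow> l" if t: "t \<in> {a..b}" for t
  proof -
    have "(\<lambda>n. 2 * C * (1 / 2) ^ n * exp (2 * m t)) \<longlonglongrightarrow> 2 * C * 0 * exp (2 * m t)"
      by (intro tendsto_intros LIMSEQ_power_zero) simp
    then have lim: "(\<lambda>n. 2 * C * (1 / 2) ^ n * exp (2 * m t)) \<longlonglongrightarrow> 0" by simp
    have "Cauchy (\<lambda>n. p n t)"
    proof (rule CauchyI')
      fix e :: real assume "e > 0"
      from order_tendstoD(2)[OF lim this] obtain M where M: "\<And>n. n \<ge> M \<Longrightarrow> 2 * C * (1 / 2) ^ n * exp (2 * m t) < e"
        unfolding eventually_sequentially by blast
      have "norm (p i t - p j t) < e" if "i \<ge> M" "i < j" for i j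
        using dd'[OF t, of i "j - i"] M[OF that(1)] that(2) by (simp add: norm_minus_commute)
      then show "\<exists>M. \<forall>i\<ge>M. \<forall>j>i. dist (p i t) (p j t) < e" unfolding dist_norm by blast
    qed
    then show ?thesis using Cauchy_convergent_iff convergent_def by blast
  qed
  define x where "x = (\<lambda>t. lim (\<lambda>n. p n t))"
  have xlim: "(\<lambda>n. p n t) \<longlonglongrightarrow> x t" if "t \<in> {a..b}" for t
    using ex[OF that] unfolding x_def by (metis limI)
  have xd: "norm (x t - p n t) \<le> 2 * C * (1 / 2) ^ n * exp (2 * m t)" if t: "t \<in> {a..b}" for n t
  proof (rule tendsto_upperbound)
    show "(\<lambda>j. norm (p (n + j) t - p n t)) \<longlonglongrightarrow> norm (x t - p n t)"
      using LIMSEQ_ignore_initial_segment[OF xlim[OF t], of n] by (intro tendsto_intros) (simp add: add.commute)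
  qed (use dd'[OF t] in auto)
  have mc: "continuous_on {a..b} m" using abs_cont_on_imp_continuous_on[OF abs_cont_on_integral[OF k]] m by presburger
  have "compact ((\<lambda>t. exp (2 * m t)) ` {a..b})" by (intro compact_continuous_image continuous_intros mc) simp
  then have "bounded ((\<lambda>t. exp (2 * m t)) ` {a..b})" by (rule compact_imp_bounded)
  then obtain M where "\<forall>y\<in>(\<lambda>t. exp (2 * m t)) ` {a..b}. norm y \<le> M" unfolding bounded_iff by blast
  then have M: "exp (2 * m t) \<le> M" if "t \<in> {a..b}" for t using that by force
  have xc: "continuous_on {a..b} x"
  proof (rule uniform_limit_theorem[of _ p sequentially])
    show "uniform_limit {a..b} p x sequentially"
    proof (rule uniform_limitI)
      fix e :: real assume "e > 0"
      have "(\<lambda>n. 2 * C * (1 / 2) ^ n * M) \<longlonglongrightarrow> 2 * C * 0 * M"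
        by (intro tendsto_intros LIMSEQ_power_zero) simp
      then have "\<forall>\<^sub>F n in sequentially. 2 * C * (1 / 2) ^ n * M < e" using \<open>e > 0\<close> by (intro order_tendstoD(2)) auto
      then show "\<forall>\<^sub>F n in sequentially. \<forall>t\<in>{a..b}. dist (p n t) (x t) < e"
      proof (rule eventually_mono, intro ballI)
        fix n t assume n: "2 * C * (1 / 2) ^ n * M < e" and t: "t \<in> {a..b}"
        have "2 * C * (1 / 2) ^ n * exp (2 * m t) \<le> 2 * C * (1 / 2) ^ n * M"
          using C0[OF t] M[OF t] by (intro mult_left_mono) auto
        then show "dist (p n t) (x t) < e" using xd[OF t, of n] n by (simp add: dist_norm norm_minus_commute)
      qed
    qed
  qed (use pc in auto)
  show ?thesis
  proof (rule that[OF xc])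
    fix t assume t: "t \<in> {a..b}"
    let ?I = "integral {a..t} (\<lambda>s. G s (x s))"
    have bd: "norm (?I - p (Suc n) t) \<le> 2 * C * (1 / 2) ^ n / 2 * exp (2 * m t)" for n
      unfolding pS using step[OF xc pc t _ xd] C0[OF t] by simp
    have "(\<lambda>n. 2 * C * (1 / 2) ^ n / 2 * exp (2 * m t)) \<longlonglongrightarrow> 2 * C * 0 / 2 * exp (2 * m t)"
      by (intro tendsto_intros LIMSEQ_power_zero) auto
    then have "(\<lambda>n. 2 * C * (1 / 2) ^ n / 2 * exp (2 * m t)) \<longlonglongrightarrow> 0" by simp
    then have "(\<lambda>n. ?I - p (Suc n) t) \<longlonglongrightarrow> 0"
      by (rule Lim_null_comparison[OF always_eventually[OF allI[OF bd]]])
    then have "(\<lambda>n. ?I - (?I - p (Suc n) t)) \<longlonglongrightarrow> ?I - 0" by (intro tendsto_intros)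
    then have "(\<lambda>n. p (Suc n) t) \<longlonglongrightarrow> ?I" by simp
    then show "x t = ?I" using LIMSEQ_unique[OF LIMSEQ_Suc[OF xlim[OF t]]] by blast
  next
    show "norm (x t - picard a G n t) \<le> 2 * C * (1 / 2) ^ n * exp (2 * m t)" if "t \<in> {a..b}" for n t
      using xd[OF that] by (simp add: p_def)
  qed
qed

section \<open>Oscillatory integrals\<close>

lemma integrable_norm_diff_continuous:
  fixes f :: "real \<Rightarrow> 'a::euclidean_space"
  assumes "f absolutely_integrable_on {a..b}" "continuous_on {a..b} g"
  shows "(\<lambda>x. norm (f x - g x)) integrable_on {a..b}"
  using set_integral_diff(1)[OF assms(1) absolutely_integrable_continuous_real[OF assms(2)]]
  unfolding absolutely_integrable_on_def by blast

text \<open>Stone-Weierstrass puts a polynomial uniformly close to a continuous L1 approximant, and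
  the polynomial can be integrated by parts.\<close>

lemma L1_approx_C1_real:
  fixes f :: "real \<Rightarrow> real"
  assumes f: "f absolutely_integrable_on {a..b}" and "e > 0" "a \<le> b"
  obtains P P' where "\<And>x. (P has_vector_derivative P' x) (at x)" "continuous_on UNIV P'" "continuous_on UNIV P"
    "integral {a..b} (\<lambda>x. \<bar>f x - P x\<bar>) < e"
proof -
  obtain g where g: "continuous_on UNIV g" "integral {a..b} (\<lambda>x. \<bar>f x - g x\<bar>) < e / 2"
    using L1_approx_continuous[OF f, of "e/2"] \<open>e > 0\<close> by auto
  have gc: "continuous_on {a..b} g" by (rule continuous_on_subset[OF g(1)]) simp
  define e' where "e' = e / 4 / (b - a + 1)"
  have "e' > 0" using \<open>e > 0\<close> \<open>a \<le> b\<close> by (simp add: e'_def)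
  then obtain P where P: "polynomial_function P" "\<And>x. x \<in> {a..b} \<Longrightarrow> norm (g x - P x) < e'"
    using Stone_Weierstrass_polynomial_function[OF compact_Icc gc] by meson
  obtain P' where P': "polynomial_function P'" "\<And>x. (P has_vector_derivative P' x) (at x)"
    using has_vector_derivative_polynomial_function[OF P(1)] by blast
  have Pc: "continuous_on S P" "continuous_on S P'" for S
    using P(1) P'(1) by (auto intro: continuous_on_polymonial_function)
  show ?thesis
  proof (rule that[OF P'(2) Pc(2) Pc(1)])
    have i: "(\<lambda>x. \<bar>f x - P x\<bar>) integrable_on {a..b}" "(\<lambda>x. \<bar>f x - g x\<bar>) integrable_on {a..b}"
      using integrable_norm_diff_continuous[OF f] Pc gc by auto
    have "integral {a..b} (\<lambda>x. \<bar>f x - P x\<bar>) \<le> integral {a..b} (\<lambda>x. \<bar>f x - g x\<bar> + e')"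
    proof (rule integral_le[OF i(1)])
      show "(\<lambda>x. \<bar>f x - g x\<bar> + e') integrable_on {a..b}" by (intro integrable_add i(2) integrable_const_ivl)
      fix x assume "x \<in> {a..b}"
      from P(2)[OF this] show "\<bar>f x - P x\<bar> \<le> \<bar>f x - g x\<bar> + e'" by (simp add: abs_if split: if_splits)
    qed
    also have "\<dots> = integral {a..b} (\<lambda>x. \<bar>f x - g x\<bar>) + integral {a..b} (\<lambda>x. e')"
      by (intro integral_add i(2) integrable_const_ivl)
    also have "integral {a..b} (\<lambda>x. e') = e' * (b - a)" using \<open>a \<le> b\<close> by simp
    also have "\<dots> \<le> e' * (b - a + 1)" using \<open>e' > 0\<close> by simp
    also have "\<dots> = e / 4"
    proof -
      have "b - a + 1 \<noteq> 0" using \<open>a \<le> b\<close> by linarith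
      then show ?thesis unfolding e'_def by (metis nonzero_eq_divide_eq)
    qed
    finally show "integral {a..b} (\<lambda>x. \<bar>f x - P x\<bar>) < e" using g(2) \<open>e > 0\<close> by simp
  qed
qed

lemma L1_approx_C1:
  fixes f :: "real \<Rightarrow> complex"
  assumes f: "f absolutely_integrable_on {a..b}" and "e > 0" "a \<le> b"
  obtains P P' where "\<And>x. (P has_vector_derivative P' x) (at x)" "continuous_on UNIV P'" "continuous_on UNIV P"
    "integral {a..b} (\<lambda>x. norm (f x - P x)) < e"
proof -
  have fr: "(\<lambda>x. Re (f x)) absolutely_integrable_on {a..b}" "(\<lambda>x. Im (f x)) absolutely_integrable_on {a..b}"
    using absolutely_integrable_linear[OF f bounded_linear_Re] absolutely_integrable_linear[OF f bounded_linear_Im]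
    by (auto simp: o_def)
  obtain P P' where P: "\<And>x. (P has_vector_derivative P' x) (at x)" "continuous_on UNIV P'" "continuous_on UNIV P"
    "integral {a..b} (\<lambda>x. \<bar>Re (f x) - P x\<bar>) < e / 2"
    using L1_approx_C1_real[OF fr(1), of "e/2"] \<open>e > 0\<close> \<open>a \<le> b\<close> by auto
  obtain Q Q' where Q: "\<And>x. (Q has_vector_derivative Q' x) (at x)" "continuous_on UNIV Q'" "continuous_on UNIV Q"
    "integral {a..b} (\<lambda>x. \<bar>Im (f x) - Q x\<bar>) < e / 2"
    using L1_approx_C1_real[OF fr(2), of "e/2"] \<open>e > 0\<close> \<open>a \<le> b\<close> by auto
  let ?P = "\<lambda>x. of_real (P x) + \<i> * of_real (Q x)" and ?P' = "\<lambda>x. of_real (P' x) + \<i> * of_real (Q' x)"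
  show ?thesis
  proof (rule that[of ?P ?P'])
    show "(?P has_vector_derivative ?P' x) (at x)" for x
      by (intro has_vector_derivative_add has_vector_derivative_mult_right has_vector_derivative_of_real P(1)[folded has_real_derivative_iff_has_vector_derivative] Q(1)[folded has_real_derivative_iff_has_vector_derivative])
    show c: "continuous_on UNIV ?P'" "continuous_on UNIV ?P" by (intro continuous_intros P Q)+
    have i: "(\<lambda>x. \<bar>Re (f x) - P x\<bar>) integrable_on {a..b}" "(\<lambda>x. \<bar>Im (f x) - Q x\<bar>) integrable_on {a..b}"
      using integrable_norm_diff_continuous[OF fr(1) continuous_on_subset[OF P(3)]]
        integrable_norm_diff_continuous[OF fr(2) continuous_on_subset[OF Q(3)]] by auto
    have "integral {a..b} (\<lambda>x. norm (f x - ?P x)) \<le> integral {a..b} (\<lambda>x. \<bar>Re (f x) - P x\<bar> + \<bar>Im (f x) - Q x\<bar>)"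
    proof (rule integral_le)
      show "(\<lambda>x. norm (f x - ?P x)) integrable_on {a..b}"
        by (rule integrable_norm_diff_continuous[OF f continuous_on_subset[OF c(2)]]) simp
      show "norm (f x - ?P x) \<le> \<bar>Re (f x) - P x\<bar> + \<bar>Im (f x) - Q x\<bar>" for x
        using cmod_le[of "f x - ?P x"] by simp
    qed (intro integrable_add i)
    also have "\<dots> = integral {a..b} (\<lambda>x. \<bar>Re (f x) - P x\<bar>) + integral {a..b} (\<lambda>x. \<bar>Im (f x) - Q x\<bar>)"
      by (intro integral_add i)
    finally show "integral {a..b} (\<lambda>x. norm (f x - ?P x)) < e" using P(4) Q(4) by simp
  qed
qed

lemma continuous_on_Icc_bounded:
  fixes g :: "real \<Rightarrow> 'a::real_normed_vector"
  assumes "continuous_on {a..b} g"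
  obtains M where "M > 0" "\<And>x. x \<in> {a..b} \<Longrightarrow> norm (g x) \<le> M"
proof -
  have "bounded (g ` {a..b})" by (intro compact_imp_bounded compact_continuous_image assms) simp
  then show ?thesis using that unfolding bounded_pos by auto
qed

lemma has_vector_derivative_exp_compose:
  fixes f :: "real \<Rightarrow> complex"
  assumes "(f has_vector_derivative f') (at x within S)"
  shows "((\<lambda>x. exp (f x)) has_vector_derivative exp (f x) * f') (at x within S)"
  using field_vector_diff_chain_within[OF assms, of exp "exp (f x)"] DERIV_exp[of "f x"]
  by (simp add: o_def mult.commute has_field_derivative_at_within)

text \<open>An abstract phase, to be instantiated once with the given coefficients and once with
  their reflection.\<close>

locale phase =
  fixes a b :: real and \<kappa> T :: "real \<Rightarrow> real"
  assumes ab: "a < b" and \<kappa>c: "continuous_on {a..b} \<kappa>" and \<kappa>0: "\<And>x. x \<in> {a..b} \<Longrightarrow> 0 < \<kappa> x"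
    and T: "\<And>x. T x = integral {a..x} \<kappa>"
begin

lemma \<kappa>i: "\<kappa> absolutely_integrable_on {a..b}" "\<kappa> integrable_on {a..b}"
  using absolutely_integrable_continuous_real[OF \<kappa>c] integrable_continuous_real[OF \<kappa>c] by auto

lemma T_diff: "a \<le> x \<Longrightarrow> x \<le> y \<Longrightarrow> y \<le> b \<Longrightarrow> T y - T x = integral {x..y} \<kappa>"
  unfolding T by (rule integral_diff_subinterval[OF \<kappa>i(2)])

lemma T_mono: "a \<le> x \<Longrightarrow> x \<le> y \<Longrightarrow> y \<le> b \<Longrightarrow> T x \<le> T y"
  using T_diff[of x y] integral_nonneg[of \<kappa> "{x..y}"] absolutely_integrable_on_subinterval_integrable[OF \<kappa>i(1), of x y] \<kappa>0
  by (force simp: less_imp_le)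

lemma T_a: "T a = 0"
  by (simp add: T)

lemma T_ge0: "x \<in> {a..b} \<Longrightarrow> 0 \<le> T x" and T_le: "x \<in> {a..b} \<Longrightarrow> T x \<le> T b"
  using T_mono[of a x] T_mono[of x b] by (auto simp: T_a)

lemma T_ac: "abs_cont_on a b T"
  using abs_cont_on_integral[OF \<kappa>i(1)] T by presburger

lemma T_cont: "continuous_on {a..b} T"
  by (rule abs_cont_on_imp_continuous_on[OF T_ac])

lemma T_der_within: "x \<in> {a..b} \<Longrightarrow> (T has_real_derivative \<kappa> x) (at x within {a..b})"
  using integral_has_real_derivative[OF \<kappa>c, of x] T by presburger

lemma T_der: "x \<in> {a<..<b} \<Longrightarrow> (T has_real_derivative \<kappa> x) (at x)"
  using T_der_within[of x] at_within_Icc_at[of a x b] by auto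

text \<open>The half-plane enters here. For \<tau> \<le> t the phase difference lies between 0 and
  \<open>T b\<close>, and the modulus depends on \<open>Im lam\<close> only, so the bound is uniform
  in the real part of \<open>lam\<close>.\<close>

lemma norm_exp_phase_le:
  assumes "Im lam \<le> s" "0 \<le> s" "a \<le> \<tau>" "\<tau> \<le> t" "t \<le> b"
  shows "norm (exp (- 2 * \<i> * lam * of_real (T t - T \<tau>))) \<le> exp (2 * s * T b)"
proof -
  have "norm (exp (- 2 * \<i> * lam * of_real (T t - T \<tau>))) = exp (2 * Im lam * (T t - T \<tau>))"
    by (simp add: norm_exp_eq_Re)
  also have "\<dots> \<le> exp (2 * s * T b)"
  proof -
    have "0 \<le> T t - T \<tau>" "T t - T \<tau> \<le> T b" using T_mono[of \<tau> t] T_ge0[of \<tau>] T_le[of t] assms by auto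
    then have "Im lam * (T t - T \<tau>) \<le> s * T b"
      using assms(1,2) by (intro order_trans[OF mult_right_mono[OF assms(1)] mult_left_mono]) auto
    then show ?thesis by simp
  qed
  finally show ?thesis .
qed

text \<open>Integration by parts. The factor \<kappa> is the derivative of the phase and makes the
  exponential an exact derivative, so \<kappa> itself need only be continuous. The boundary terms
  account for \<open>2 * A\<close>, the remaining integral for \<open>B * (b - a)\<close>.\<close>

lemma oscillatory_integral_C1:
  assumes P: "\<And>x. (P has_vector_derivative P' x) (at x)" "continuous_on UNIV P'" "continuous_on UNIV P"
    and s: "0 \<le> s"
  obtains M where "M > 0" "\<And>lam t. lam \<noteq> 0 \<Longrightarrow> Im lam \<le> s \<Longrightarrow> t \<in> {a..b} \<Longrightarrow>
    norm (integral {a..t} (\<lambda>\<tau>. exp (- 2 * \<i> * lam * of_real (T t - T \<tau>)) * (of_real (\<kappa> \<tau>) * P \<tau>))) \<le> M / norm lam"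
proof -
  obtain A where A: "A > 0" "\<And>x. x \<in> {a..b} \<Longrightarrow> norm (P x) \<le> A"
    using continuous_on_Icc_bounded[OF continuous_on_subset[OF P(3)], of a b] by auto
  obtain B where B: "B > 0" "\<And>x. x \<in> {a..b} \<Longrightarrow> norm (P' x) \<le> B"
    using continuous_on_Icc_bounded[OF continuous_on_subset[OF P(2)], of a b] by auto
  define K where "K = exp (2 * s * T b)"
  define M where "M = K * (2 * A + B * (b - a))"
  have "M > 0" using A(1) B(1) ab by (auto simp: M_def K_def intro!: mult_pos_pos add_pos_pos)
  show ?thesis
  proof (rule that[OF \<open>M > 0\<close>])
    fix lam :: complex and t assume lam: "lam \<noteq> 0" "Im lam \<le> s" and t: "t \<in> {a..b}"
    define E where "E = (\<lambda>\<tau>. exp (- 2 * \<i> * lam * of_real (T t - T \<tau>)))"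
    have EK: "norm (E \<tau>) \<le> K" if "\<tau> \<in> {a..t}" for \<tau>
      unfolding E_def K_def using norm_exp_phase_le[OF lam(2) s] that t by auto
    have Ec: "continuous_on {a..t} E" unfolding E_def
      by (intro continuous_intros continuous_on_subset[OF T_cont]) (use t in auto)
    have \<kappa>t: "continuous_on {a..t} \<kappa>" by (rule continuous_on_subset[OF \<kappa>c]) (use t in auto)
    have Pt: "continuous_on {a..t} P" "continuous_on {a..t} P'" using P(2,3) continuous_on_subset by blast+
    have der: "((\<lambda>\<tau>. E \<tau> * P \<tau>) has_vector_derivative (2 * \<i> * lam) * (E \<tau> * (of_real (\<kappa> \<tau>) * P \<tau>)) + E \<tau> * P' \<tau>) (at \<tau> within {a..t})"
      if \<tau>: "\<tau> \<in> {a..t}" for \<tau>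
    proof -
      have T': "(T has_real_derivative \<kappa> \<tau>) (at \<tau> within {a..t})"
        by (rule DERIV_subset[OF T_der_within]) (use \<tau> t in auto)
      have "((\<lambda>\<tau>. - 2 * \<i> * lam * of_real (T t - T \<tau>)) has_vector_derivative - 2 * \<i> * lam * of_real (0 - \<kappa> \<tau>)) (at \<tau> within {a..t})"
        by (intro has_vector_derivative_mult_right has_vector_derivative_of_real DERIV_diff DERIV_const T')
      then have "(E has_vector_derivative E \<tau> * (- 2 * \<i> * lam * of_real (0 - \<kappa> \<tau>))) (at \<tau> within {a..t})"
        unfolding E_def by (rule has_vector_derivative_exp_compose)
      from has_vector_derivative_mult[OF this has_vector_derivative_at_within[OF P(1)[of \<tau>]]]
      show ?thesis by (simp add: algebra_simps)
    qed
    have "((\<lambda>\<tau>. (2 * \<i> * lam) * (E \<tau> * (of_real (\<kappa> \<tau>) * P \<tau>)) + E \<tau> * P' \<tau>) has_integral E t * P t - E a * P a) {a..t}"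
      by (rule fundamental_theorem_of_calculus[OF _ der]) (use t in auto)
    moreover have i1: "(\<lambda>\<tau>. E \<tau> * P' \<tau>) integrable_on {a..t}"
      by (intro integrable_continuous_real continuous_intros Ec Pt)
    ultimately have "((\<lambda>\<tau>. (2 * \<i> * lam) * (E \<tau> * (of_real (\<kappa> \<tau>) * P \<tau>)) + E \<tau> * P' \<tau> - E \<tau> * P' \<tau>) has_integral
        E t * P t - E a * P a - integral {a..t} (\<lambda>\<tau>. E \<tau> * P' \<tau>)) {a..t}"
      by (intro has_integral_diff integrable_integral)
    then have "((\<lambda>\<tau>. (2 * \<i> * lam) * (E \<tau> * (of_real (\<kappa> \<tau>) * P \<tau>))) has_integral
        E t * P t - E a * P a - integral {a..t} (\<lambda>\<tau>. E \<tau> * P' \<tau>)) {a..t}" by (simp only: add_diff_cancel_right')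
    then have "integral {a..t} (\<lambda>\<tau>. (2 * \<i> * lam) * (E \<tau> * (of_real (\<kappa> \<tau>) * P \<tau>))) =
       E t * P t - E a * P a - integral {a..t} (\<lambda>\<tau>. E \<tau> * P' \<tau>)" by (rule integral_unique)
    then have eq: "(2 * \<i> * lam) * integral {a..t} (\<lambda>\<tau>. E \<tau> * (of_real (\<kappa> \<tau>) * P \<tau>)) =
       E t * P t - E a * P a - integral {a..t} (\<lambda>\<tau>. E \<tau> * P' \<tau>)" by simp
    have "norm (E t * P t - E a * P a - integral {a..t} (\<lambda>\<tau>. E \<tau> * P' \<tau>)) \<le> K * A + K * A + K * B * (b - a)"
    proof (intro norm_triangle_le_diff add_mono)
      have at: "a \<in> {a..t}" "t \<in> {a..t}" "a \<in> {a..b}" using t by auto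
      have "K > 0" by (simp add: K_def)
      show "norm (E t * P t) \<le> K * A" "norm (E a * P a) \<le> K * A"
        unfolding norm_mult using EK[OF at(2)] EK[OF at(1)] A(2)[OF t] A(2)[OF at(3)] \<open>K > 0\<close> by (auto intro!: mult_mono)
      have "norm (integral {a..t} (\<lambda>\<tau>. E \<tau> * P' \<tau>)) \<le> integral {a..t} (\<lambda>\<tau>. K * B)"
      proof (rule integral_norm_bound_integral[OF i1])
        show "norm (E x * P' x) \<le> K * B" if "x \<in> {a..t}" for x
          unfolding norm_mult using EK[OF that] B(2)[of x] that t \<open>K > 0\<close> by (auto intro!: mult_mono)
      qed auto
      also have "\<dots> = K * B * (t - a)" using t by simp
      also have "\<dots> \<le> K * B * (b - a)" using t \<open>K > 0\<close> B(1) by (intro mult_left_mono) auto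
      finally show "norm (integral {a..t} (\<lambda>\<tau>. E \<tau> * P' \<tau>)) \<le> K * B * (b - a)" .
    qed
    then have "norm ((2 * \<i> * lam) * integral {a..t} (\<lambda>\<tau>. E \<tau> * (of_real (\<kappa> \<tau>) * P \<tau>))) \<le> M"
      unfolding eq by (simp add: M_def algebra_simps)
    then have "2 * (norm (integral {a..t} (\<lambda>\<tau>. E \<tau> * (of_real (\<kappa> \<tau>) * P \<tau>))) * norm lam) \<le> M"
      by (simp add: norm_mult mult_ac)
    then have "norm (integral {a..t} (\<lambda>\<tau>. E \<tau> * (of_real (\<kappa> \<tau>) * P \<tau>))) * norm lam \<le> M"
      using mult_nonneg_nonneg[OF norm_ge_zero norm_ge_zero, of "integral {a..t} (\<lambda>\<tau>. E \<tau> * (of_real (\<kappa> \<tau>) * P \<tau>))" lam] by linarith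
    then show "norm (integral {a..t} (\<lambda>\<tau>. exp (- 2 * \<i> * lam * of_real (T t - T \<tau>)) * (of_real (\<kappa> \<tau>) * P \<tau>))) \<le> M / norm lam"
      using lam(1) unfolding E_def by (subst pos_le_divide_eq) auto
  qed
qed

text \<open>Dividing by the continuous positive \<kappa> gives \<alpha> the form \<kappa> \<beta>.
  Replacing \<beta> by a smooth \<open>P\<close> costs little in L1, uniformly in \<open>lam\<close>
  and \<open>t\<close> because the exponential is bounded by \<open>K\<close>, and the smooth part
  is of order 1/|lam|.\<close>

lemma oscillatory_integral_tendsto_0:
  fixes \<alpha> :: "real \<Rightarrow> complex"
  assumes \<alpha>: "\<alpha> absolutely_integrable_on {a..b}" and s: "0 \<le> s" and "\<epsilon> > 0"
  obtains R where "R > 0" "\<And>lam t. norm lam > R \<Longrightarrow> Im lam \<le> s \<Longrightarrow> t \<in> {a..b} \<Longrightarrow>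
    norm (integral {a..t} (\<lambda>\<tau>. exp (- 2 * \<i> * lam * of_real (T t - T \<tau>)) * \<alpha> \<tau>)) \<le> \<epsilon>"
proof -
  define K where "K = exp (2 * s * T b)"
  have K: "K > 0" by (simp add: K_def)
  obtain \<kappa>M where \<kappa>M: "\<kappa>M > 0" "\<And>x. x \<in> {a..b} \<Longrightarrow> norm (\<kappa> x) \<le> \<kappa>M" using continuous_on_Icc_bounded[OF \<kappa>c] by blast
  define \<beta> where "\<beta> = (\<lambda>x. \<alpha> x * of_real (1 / \<kappa> x))"
  have \<beta>: "\<beta> absolutely_integrable_on {a..b}" unfolding \<beta>_def
    by (intro absolutely_integrable_mult_continuous(1)[OF \<alpha>] continuous_intros \<kappa>c) (use \<kappa>0 in force)
  \<comment> \<open>Makes the approximation error \<open>K * \<kappa>M * e\<close> equal to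
    \<epsilon>/2; the other half is left for \<open>M / norm lam\<close>, hence the radius
    \<open>2 * M / \<epsilon>\<close>.\<close>
  define e where "e = \<epsilon> / (2 * K * \<kappa>M)"
  have "e > 0" using \<open>\<epsilon> > 0\<close> K \<kappa>M by (simp add: e_def)
  obtain P P' where P: "\<And>x. (P has_vector_derivative P' x) (at x)" "continuous_on UNIV P'" "continuous_on UNIV P"
    "integral {a..b} (\<lambda>x. norm (\<beta> x - P x)) < e"
    using L1_approx_C1[OF \<beta> \<open>e > 0\<close>] ab by auto
  obtain M where M: "M > 0" "\<And>lam t. lam \<noteq> 0 \<Longrightarrow> Im lam \<le> s \<Longrightarrow> t \<in> {a..b} \<Longrightarrow>
    norm (integral {a..t} (\<lambda>\<tau>. exp (- 2 * \<i> * lam * of_real (T t - T \<tau>)) * (of_real (\<kappa> \<tau>) * P \<tau>))) \<le> M / norm lam"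
    using oscillatory_integral_C1[OF P(1-3) s] by blast
  show ?thesis
  proof (rule that[of "2 * M / \<epsilon>"])
    show "2 * M / \<epsilon> > 0" using M(1) \<open>\<epsilon> > 0\<close> by simp
    fix lam :: complex and t assume lam: "norm lam > 2 * M / \<epsilon>" "Im lam \<le> s" and t: "t \<in> {a..b}"
    have "norm lam > 0" using lam(1) \<open>2 * M / \<epsilon> > 0\<close> by linarith
    then have "lam \<noteq> 0" by auto
    define E where "E = (\<lambda>\<tau>. exp (- 2 * \<i> * lam * of_real (T t - T \<tau>)))"
    have EK: "norm (E \<tau>) \<le> K" if "\<tau> \<in> {a..t}" for \<tau>
      unfolding E_def K_def using norm_exp_phase_le[OF lam(2) s] that t by auto
    have Ec: "continuous_on {a..b} E" unfolding E_def
      by (intro continuous_intros T_cont)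
    have Pb: "continuous_on {a..b} P" using P(3) continuous_on_subset by blast
    have i1: "(\<lambda>\<tau>. E \<tau> * (of_real (\<kappa> \<tau>) * P \<tau>)) integrable_on {a..t}"
    proof -
      have "continuous_on {a..b} (\<lambda>\<tau>. E \<tau> * (of_real (\<kappa> \<tau>) * P \<tau>))" by (intro continuous_intros Ec \<kappa>c Pb)
      from absolutely_integrable_on_subinterval_integrable[OF absolutely_integrable_continuous_real[OF this], of a t]
      show ?thesis using t by auto
    qed
    have c2: "continuous_on {a..b} (\<lambda>\<tau>. E \<tau> * of_real (\<kappa> \<tau>))" by (intro continuous_intros Ec \<kappa>c)
    have bP: "(\<lambda>\<tau>. \<beta> \<tau> - P \<tau>) absolutely_integrable_on {a..b}"
      by (rule set_integral_diff(1)[OF \<beta> absolutely_integrable_continuous_real[OF Pb]])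
    have i2: "(\<lambda>\<tau>. E \<tau> * of_real (\<kappa> \<tau>) * (\<beta> \<tau> - P \<tau>)) integrable_on {a..t}"
      by (rule absolutely_integrable_on_subinterval_integrable[OF absolutely_integrable_mult_continuous(2)[OF bP c2]])
        (use t in auto)
    have i3: "(\<lambda>x. norm (\<beta> x - P x)) integrable_on {a..b}" using bP by (simp add: absolutely_integrable_on_def)
    have i4: "(\<lambda>x. norm (\<beta> x - P x)) integrable_on {a..t}" by (rule integrable_on_subinterval[OF i3]) (use t in auto)
    have "integral {a..t} (\<lambda>\<tau>. E \<tau> * \<alpha> \<tau>) =
       integral {a..t} (\<lambda>\<tau>. E \<tau> * (of_real (\<kappa> \<tau>) * P \<tau>) + E \<tau> * of_real (\<kappa> \<tau>) * (\<beta> \<tau> - P \<tau>))"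
    proof (rule integral_cong)
      fix x assume "x \<in> {a..t}"
      then have "\<kappa> x \<noteq> 0" using \<kappa>0[of x] t by auto
      then show "E x * \<alpha> x = E x * (of_real (\<kappa> x) * P x) + E x * of_real (\<kappa> x) * (\<beta> x - P x)"
        by (simp add: \<beta>_def field_simps)
    qed
    also have "\<dots> = integral {a..t} (\<lambda>\<tau>. E \<tau> * (of_real (\<kappa> \<tau>) * P \<tau>)) + integral {a..t} (\<lambda>\<tau>. E \<tau> * of_real (\<kappa> \<tau>) * (\<beta> \<tau> - P \<tau>))"
      by (rule integral_add[OF i1 i2])
    also have "norm \<dots> \<le> M / norm lam + K * \<kappa>M * e"
    proof (intro norm_triangle_mono)
      show "norm (integral {a..t} (\<lambda>\<tau>. E \<tau> * (of_real (\<kappa> \<tau>) * P \<tau>))) \<le> M / norm lam"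
        unfolding E_def by (rule M(2)[OF \<open>lam \<noteq> 0\<close> lam(2) t])
      have "norm (integral {a..t} (\<lambda>\<tau>. E \<tau> * of_real (\<kappa> \<tau>) * (\<beta> \<tau> - P \<tau>))) \<le> integral {a..t} (\<lambda>\<tau>. K * \<kappa>M * norm (\<beta> \<tau> - P \<tau>))"
      proof (rule integral_norm_bound_integral[OF i2])
        show "(\<lambda>\<tau>. K * \<kappa>M * norm (\<beta> \<tau> - P \<tau>)) integrable_on {a..t}" by (intro integrable_on_mult_right i4)
        fix x assume x: "x \<in> {a..t}"
        then have "norm (\<kappa> x) \<le> \<kappa>M" using \<kappa>M(2) t by auto
        then show "norm (E x * of_real (\<kappa> x) * (\<beta> x - P x)) \<le> K * \<kappa>M * norm (\<beta> x - P x)"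
          unfolding norm_mult using EK[OF x] K by (intro mult_right_mono mult_mono) auto
      qed
      also have "\<dots> = K * \<kappa>M * integral {a..t} (\<lambda>\<tau>. norm (\<beta> \<tau> - P \<tau>))" by simp
      also have "\<dots> \<le> K * \<kappa>M * e"
      proof (rule mult_left_mono)
        have "integral {a..t} (\<lambda>\<tau>. norm (\<beta> \<tau> - P \<tau>)) \<le> integral {a..b} (\<lambda>\<tau>. norm (\<beta> \<tau> - P \<tau>))"
          by (rule integral_subset_le) (use t i3 i4 in auto)
        then show "integral {a..t} (\<lambda>\<tau>. norm (\<beta> \<tau> - P \<tau>)) \<le> e" using P(4) by simp
      qed (use K \<kappa>M(1) in auto)
      finally show "norm (integral {a..t} (\<lambda>\<tau>. E \<tau> * of_real (\<kappa> \<tau>) * (\<beta> \<tau> - P \<tau>))) \<le> K * \<kappa>M * e" .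
    qed
    also have "K * \<kappa>M * e = \<epsilon> / 2" using K \<kappa>M(1) by (simp add: e_def)
    also have "M / norm lam \<le> \<epsilon> / 2" using lam(1) \<open>norm lam > 0\<close> \<open>\<epsilon> > 0\<close> by (simp add: field_simps)
    finally show "norm (integral {a..t} (\<lambda>\<tau>. exp (- 2 * \<i> * lam * of_real (T t - T \<tau>)) * \<alpha> \<tau>)) \<le> \<epsilon>"
      by (simp add: E_def)
  qed
qed

end

section \<open>The amplitude system\<close>

text \<open>Finite sums of \<open>\<lambda>\<^sup>i \<lambda>\<^sup>-\<^sup>j c(t)\<close>: the shape of the Picard iterates, which makes them analytic in the parameter
  without differentiating under the integral sign.\<close>

inductive laurent_family :: "real \<Rightarrow> real \<Rightarrow> (real \<Rightarrow> complex \<Rightarrow> complex) \<Rightarrow> bool" for a b where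
  monomial: "continuous_on {a..b} c \<Longrightarrow> laurent_family a b (\<lambda>t lam. lam ^ i * (1 / lam) ^ j * c t)"
| add: "laurent_family a b u \<Longrightarrow> laurent_family a b v \<Longrightarrow> laurent_family a b (\<lambda>t lam. u t lam + v t lam)"
| cong: "laurent_family a b u \<Longrightarrow> (\<And>t lam. t \<in> {a..b} \<Longrightarrow> v t lam = u t lam) \<Longrightarrow> laurent_family a b v"

lemma laurent_family_continuous_on:
  "laurent_family a b v \<Longrightarrow> continuous_on {a..b} (\<lambda>t. v t lam)"
proof (induction rule: laurent_family.induct)
  case (cong u v)
  then show ?case by (subst continuous_on_cong[OF refl, of _ _ "\<lambda>t. u t lam"]) auto
qed (auto intro!: continuous_intros)

lemma laurent_family_holomorphic_on:
  "laurent_family a b v \<Longrightarrow> t \<in> {a..b} \<Longrightarrow> (\<lambda>lam. v t lam) holomorphic_on - {0}"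
proof (induction rule: laurent_family.induct)
  case (cong u v)
  then show ?case by (auto cong: holomorphic_cong)
qed (auto intro!: holomorphic_intros)

lemma laurent_family_const: "laurent_family a b (\<lambda>t lam. c)"
  using laurent_family.monomial[of a b "\<lambda>_. c" 0 0] by simp

text \<open>Powers of \<open>lam\<close> leave the integral, and what remains is an indefinite
  integral, continuous in \<open>t\<close> although \<beta> is merely integrable. The prefactor
  covers the powers \<open>lam\<close>, 1 and \<open>1 / lam\<close> of the amplitude
  system.\<close>

lemma laurent_family_integral:
  assumes "laurent_family a b v" and \<beta>: "\<beta> absolutely_integrable_on {a..b}"
  shows "laurent_family a b (\<lambda>t lam. lam ^ i * (1 / lam) ^ j * integral {a..t} (\<lambda>s. \<beta> s * v s lam))"
  using assms(1)
proof (induction rule: laurent_family.induct)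
  case (monomial c i' j')
  have "continuous_on {a..b} (\<lambda>t. integral {a..t} (\<lambda>s. \<beta> s * c s))"
    by (rule abs_cont_on_imp_continuous_on[OF abs_cont_on_integral[OF absolutely_integrable_mult_continuous(1)[OF \<beta> monomial]]])
  from laurent_family.monomial[OF this, of "i + i'" "j + j'"] show ?case
  proof (rule laurent_family.cong)
    fix t and lam :: complex
    have "(\<lambda>s. \<beta> s * (lam ^ i' * (1 / lam) ^ j' * c s)) = (\<lambda>s. (lam ^ i' * (1 / lam) ^ j') * (\<beta> s * c s))"
      by (simp add: fun_eq_iff mult_ac)
    then have "integral {a..t} (\<lambda>s. \<beta> s * (lam ^ i' * (1 / lam) ^ j' * c s)) = (lam ^ i' * (1 / lam) ^ j') * integral {a..t} (\<lambda>s. \<beta> s * c s)"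
      by (simp only: integral_mult_right)
    then show "lam ^ i * (1 / lam) ^ j * integral {a..t} (\<lambda>s. \<beta> s * (lam ^ i' * (1 / lam) ^ j' * c s)) =
       lam ^ (i + i') * (1 / lam) ^ (j + j') * integral {a..t} (\<lambda>s. \<beta> s * c s)"
      by (simp only: power_add mult_ac)
  qed
next
  case (add u v)
  from laurent_family.add[OF add.IH] show ?case
  proof (rule laurent_family.cong)
    fix t and lam :: complex assume t: "t \<in> {a..b}"
    have "integral {a..t} (\<lambda>s. \<beta> s * (u s lam + v s lam)) = integral {a..t} (\<lambda>s. \<beta> s * u s lam + \<beta> s * v s lam)"
      by (simp add: distrib_left)
    also have "\<dots> = integral {a..t} (\<lambda>s. \<beta> s * u s lam) + integral {a..t} (\<lambda>s. \<beta> s * v s lam)"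
      using t
      by (intro integral_add absolutely_integrable_on_subinterval_integrable[OF absolutely_integrable_mult_continuous(1)[OF \<beta>]]
           laurent_family_continuous_on add.hyps) auto
    finally show "lam ^ i * (1 / lam) ^ j * integral {a..t} (\<lambda>s. \<beta> s * (u s lam + v s lam)) =
      lam ^ i * (1 / lam) ^ j * integral {a..t} (\<lambda>s. \<beta> s * u s lam) + lam ^ i * (1 / lam) ^ j * integral {a..t} (\<lambda>s. \<beta> s * v s lam)"
      by (simp only: distrib_left)
  qed
next
  case (cong u v)
  from cong.IH show ?case
  proof (rule laurent_family.cong)
    fix t and lam :: complex assume t: "t \<in> {a..b}"
    have "integral {a..t} (\<lambda>s. \<beta> s * v s lam) = integral {a..t} (\<lambda>s. \<beta> s * u s lam)"
      by (rule integral_cong) (use cong.hyps(2) t in auto)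
    then show "lam ^ i * (1 / lam) ^ j * integral {a..t} (\<lambda>s. \<beta> s * v s lam) =
      lam ^ i * (1 / lam) ^ j * integral {a..t} (\<lambda>s. \<beta> s * u s lam)" by simp
  qed
qed

section \<open>The amplitude system as a Lipschitz integral equation\<close>

locale perturbed_phase = phase +
  fixes \<alpha> \<gamma> :: "real \<Rightarrow> complex"
  assumes \<alpha>: "\<alpha> absolutely_integrable_on {a..b}" and \<gamma>: "\<gamma> absolutely_integrable_on {a..b}"
begin

definition rhs :: "complex \<Rightarrow> real \<Rightarrow> complex \<times> complex \<Rightarrow> complex \<times> complex" where
  "rhs lam s v =
    (\<alpha> s * snd v + \<gamma> s / (2 * \<i> * lam) * (1 + fst v + snd v),
     - 2 * \<i> * lam * \<kappa> s * snd v + \<alpha> s * (1 + fst v) - \<gamma> s / (2 * \<i> * lam) * (1 + fst v + snd v))"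

text \<open>Chosen generously: it is a Lipschitz constant of \<open>rhs\<close> and also bounds
  \<open>rhs\<close> at 0, so that one integral serves both estimates of the Picard
  iteration.\<close>

definition lipc :: "complex \<Rightarrow> real \<Rightarrow> real" where
  "lipc lam s = 2 * norm (\<alpha> s) + 2 * norm (\<gamma> s) / norm lam + 2 * norm lam * \<kappa> s"

lemma lipc_integrable: "lipc lam absolutely_integrable_on {a..b}"
proof -
  have "(\<lambda>s. norm (\<alpha> s)) absolutely_integrable_on {a..b}" "(\<lambda>s. norm (\<gamma> s)) absolutely_integrable_on {a..b}"
    using \<alpha> \<gamma> by (simp_all add: absolutely_integrable_on_def)
  then show ?thesis unfolding lipc_def
    by (intro set_integral_add(1) set_integrable_mult_right set_integrable_divide \<kappa>i(1)) auto
qed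

lemma rhs_lipschitz:
  assumes s: "s \<in> {a..b}"
  shows "norm (rhs lam s v - rhs lam s w) \<le> lipc lam s * norm (v - w)"
proof -
  obtain v1 v2 w1 w2 where vw: "v = (v1, v2)" "w = (w1, w2)" by (cases v, cases w)
  define d1 d2 where "d1 = v1 - w1" and "d2 = v2 - w2"
  have d: "norm d1 \<le> norm (v - w)" "norm d2 \<le> norm (v - w)"
    using norm_fst_le[of d1 d2] norm_snd_le[of d2 d1] by (auto simp: vw d1_def d2_def)
  define c where "c = \<gamma> s / (2 * \<i> * lam)"
  have nc: "norm c = norm (\<gamma> s) / norm lam / 2" by (simp add: c_def norm_divide norm_mult)
  have "rhs lam s v - rhs lam s w = (\<alpha> s * d2 + c * (d1 + d2), - 2 * \<i> * lam * \<kappa> s * d2 + \<alpha> s * d1 - c * (d1 + d2))"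
    unfolding rhs_def c_def[symmetric] vw d1_def d2_def fst_conv snd_conv by (simp add: algebra_simps)
  also have "norm \<dots> \<le> norm (\<alpha> s * d2 + c * (d1 + d2)) + norm (- 2 * \<i> * lam * \<kappa> s * d2 + \<alpha> s * d1 - c * (d1 + d2))"
    by (rule norm_Pair_le)
  also have "\<dots> \<le> (norm (\<alpha> s) * norm d2 + norm c * (norm d1 + norm d2)) +
      (2 * norm lam * \<kappa> s * norm d2 + norm (\<alpha> s) * norm d1 + norm c * (norm d1 + norm d2))"
  proof (rule add_mono)
    have c12: "norm (c * (d1 + d2)) \<le> norm c * (norm d1 + norm d2)"
      unfolding norm_mult[of c] by (intro mult_left_mono norm_triangle_ineq) auto
    show "norm (\<alpha> s * d2 + c * (d1 + d2)) \<le> norm (\<alpha> s) * norm d2 + norm c * (norm d1 + norm d2)"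
      by (rule norm_triangle_mono[OF _ c12]) (simp add: norm_mult)
    have "norm (- 2 * \<i> * lam * \<kappa> s * d2) = 2 * norm lam * \<kappa> s * norm d2"
      using \<kappa>0[OF s] by (simp add: norm_mult)
    then have "norm (- 2 * \<i> * lam * \<kappa> s * d2 + \<alpha> s * d1) \<le> 2 * norm lam * \<kappa> s * norm d2 + norm (\<alpha> s) * norm d1"
      by (intro norm_triangle_mono) (auto simp: norm_mult)
    with c12 show "norm (- 2 * \<i> * lam * \<kappa> s * d2 + \<alpha> s * d1 - c * (d1 + d2)) \<le>
       2 * norm lam * \<kappa> s * norm d2 + norm (\<alpha> s) * norm d1 + norm c * (norm d1 + norm d2)"
      by (intro norm_triangle_le_diff add_mono)
  qed
  also have "\<dots> \<le> (norm (\<alpha> s) * norm (v - w) + norm c * (norm (v - w) + norm (v - w))) +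
      (2 * norm lam * \<kappa> s * norm (v - w) + norm (\<alpha> s) * norm (v - w) + norm c * (norm (v - w) + norm (v - w)))"
    using \<kappa>0[OF s] by (intro add_mono mult_left_mono d) auto
  also have "\<dots> = lipc lam s * norm (v - w)"
    unfolding nc lipc_def by (simp add: algebra_simps)
  finally show ?thesis .
qed

lemma rhs_0_le: "s \<in> {a..b} \<Longrightarrow> norm (rhs lam s 0) \<le> lipc lam s"
proof -
  assume s: "s \<in> {a..b}"
  have "norm (rhs lam s 0) \<le> norm (\<gamma> s / (2 * \<i> * lam)) + norm (\<alpha> s - \<gamma> s / (2 * \<i> * lam))"
    unfolding rhs_def by (rule order_trans[OF norm_Pair_le]) simp
  also have "\<dots> \<le> norm (\<gamma> s / (2 * \<i> * lam)) + (norm (\<alpha> s) + norm (\<gamma> s / (2 * \<i> * lam)))"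
    by (intro add_mono norm_triangle_ineq4) auto
  also have "\<dots> = norm (\<alpha> s) + norm (\<gamma> s) / norm lam" by (simp add: norm_divide norm_mult)
  also have "\<dots> \<le> lipc lam s"
  proof -
    have "0 \<le> norm (\<gamma> s) / norm lam" "0 \<le> norm (\<alpha> s)" by simp_all
    moreover have "0 \<le> 2 * norm lam * \<kappa> s" using \<kappa>0[OF s] by simp
    moreover have "2 * norm (\<gamma> s) / norm lam = 2 * (norm (\<gamma> s) / norm lam)" by simp
    ultimately show ?thesis unfolding lipc_def by linarith
  qed
  finally show ?thesis .
qed

lemma lipc_nonneg: "s \<in> {a..b} \<Longrightarrow> 0 \<le> lipc lam s"
  using \<kappa>0[of s] by (simp add: lipc_def)

lemma rhs_components_integrable:
  assumes "continuous_on {a..b} x1" "continuous_on {a..b} x2"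
  shows "(\<lambda>s. fst (rhs lam s (x1 s, x2 s))) absolutely_integrable_on {a..b}"
    "(\<lambda>s. snd (rhs lam s (x1 s, x2 s))) absolutely_integrable_on {a..b}"
proof -
  have g: "(\<lambda>s. \<gamma> s / (2 * \<i> * lam) * (1 + x1 s + x2 s)) absolutely_integrable_on {a..b}"
    by (intro absolutely_integrable_mult_continuous(1) set_integrable_divide \<gamma> continuous_intros assms)
  show "(\<lambda>s. fst (rhs lam s (x1 s, x2 s))) absolutely_integrable_on {a..b}"
    unfolding rhs_def fst_conv snd_conv
    by (intro set_integral_add(1) g absolutely_integrable_mult_continuous(1)[OF \<alpha>] assms)
  show "(\<lambda>s. snd (rhs lam s (x1 s, x2 s))) absolutely_integrable_on {a..b}"
    unfolding rhs_def fst_conv snd_conv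
    by (intro set_integral_add(1) set_integral_diff(1) g absolutely_integrable_mult_continuous(1)[OF \<alpha>] continuous_intros assms
       absolutely_integrable_continuous_real \<kappa>c)
qed

lemma rhs_integrable:
  assumes "continuous_on {a..b} x"
  shows "(\<lambda>s. rhs lam s (x s)) absolutely_integrable_on {a..b}"
proof (rule absolutely_integrable_componentwise)
  fix i :: "complex \<times> complex" assume "i \<in> Basis"
  have c: "continuous_on {a..b} (\<lambda>s. fst (x s))" "continuous_on {a..b} (\<lambda>s. snd (x s))"
    by (intro continuous_intros assms)+
  from rhs_components_integrable[OF c, of lam] \<open>i \<in> Basis\<close>
  show "(\<lambda>s. rhs lam s (x s) \<bullet> i) absolutely_integrable_on {a..b}"
    by (auto simp: Basis_prod_def inner_prod_def dest: absolutely_integrable_component)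
qed

lemma integral_rhs:
  assumes x: "continuous_on {a..b} x" and t: "t \<in> {a..b}"
  shows "fst (integral {a..t} (\<lambda>s. rhs lam s (x s))) = integral {a..t} (\<lambda>s. fst (rhs lam s (x s)))"
    "snd (integral {a..t} (\<lambda>s. rhs lam s (x s))) = integral {a..t} (\<lambda>s. snd (rhs lam s (x s)))"
proof -
  have i: "(\<lambda>s. rhs lam s (x s)) integrable_on {a..t}"
    by (rule absolutely_integrable_on_subinterval_integrable[OF rhs_integrable[OF x]]) (use t in auto)
  show "fst (integral {a..t} (\<lambda>s. rhs lam s (x s))) = integral {a..t} (\<lambda>s. fst (rhs lam s (x s)))"
    "snd (integral {a..t} (\<lambda>s. rhs lam s (x s))) = integral {a..t} (\<lambda>s. snd (rhs lam s (x s)))"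
    using integral_linear[OF i bounded_linear_fst] integral_linear[OF i bounded_linear_snd] by (auto simp: o_def)
qed

text \<open>Collects the powers \<open>lam\<close>, 1 and \<open>1 / lam\<close>, each with a
  coefficient free of \<open>lam\<close>: the form in which integration stays within Laurent
  families.\<close>

lemma rhs_split:
  "rhs lam s (u, v) = (\<alpha> s * v + 1 / lam * (\<gamma> s / (2 * \<i>) * (1 + u + v)),
     lam * (- 2 * \<i> * \<kappa> s * v) + (\<alpha> s * (1 + u) + 1 / lam * (- \<gamma> s / (2 * \<i>) * (1 + u + v))))"
proof -
  define Z l where "Z = \<gamma> s / (2 * \<i>)" and "l = 1 / lam"
  have 1: "\<gamma> s / (2 * \<i> * lam) = l * Z"
    by (simp only: Z_def l_def times_divide_times_eq mult_1_left mult.commute)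
  have 2: "- \<gamma> s / (2 * \<i>) = - Z" unfolding Z_def by (rule minus_divide_left[symmetric])
  show ?thesis
    unfolding rhs_def 1 2 Z_def[symmetric] l_def[symmetric] fst_conv snd_conv by (simp add: algebra_simps)
qed

text \<open>A Picard step integrates fixed coefficients against affine combinations of the previous
  iterate and multiplies the results by \<open>lam\<close>, 1 or \<open>1 / lam\<close>; each of
  these operations keeps the Laurent shape.\<close>

lemma laurent_family_picard:
  "laurent_family a b (\<lambda>t lam. fst (picard a (rhs lam) n t)) \<and> laurent_family a b (\<lambda>t lam. snd (picard a (rhs lam) n t))"
proof (induction n)
  case 0
  then show ?case using laurent_family_const[of a b 0] by simp
next
  case (Suc n)
  define u v where "u = (\<lambda>t lam. fst (picard a (rhs lam) n t))" and "v = (\<lambda>t lam. snd (picard a (rhs lam) n t))"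
  have u: "laurent_family a b u" and v: "laurent_family a b v" using Suc by (auto simp: u_def v_def)
  have uv: "picard a (rhs lam) n t = (u t lam, v t lam)" for lam t by (simp add: u_def v_def)
  have uc: "continuous_on {a..b} (\<lambda>s. u s lam)" and vc: "continuous_on {a..b} (\<lambda>s. v s lam)" for lam
    using laurent_family_continuous_on u v by blast+
  have pc: "continuous_on {a..b} (\<lambda>s. (u s lam, v s lam))" for lam by (intro continuous_intros uc vc)
  note const = laurent_family_const[of a b 1]
  have w: "laurent_family a b (\<lambda>t lam. 1 + u t lam + v t lam)" by (intro laurent_family.add const u v)
  have w1: "laurent_family a b (\<lambda>t lam. 1 + u t lam)" by (intro laurent_family.add const u)
  have \<gamma>': "(\<lambda>s. \<gamma> s / (2 * \<i>)) absolutely_integrable_on {a..b}" "(\<lambda>s. - \<gamma> s / (2 * \<i>)) absolutely_integrable_on {a..b}"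
  proof -
    show *: "(\<lambda>s. \<gamma> s / (2 * \<i>)) absolutely_integrable_on {a..b}" by (intro set_integrable_divide \<gamma>)
    show "(\<lambda>s. - \<gamma> s / (2 * \<i>)) absolutely_integrable_on {a..b}"
      using set_integral_diff(1)[OF absolutely_integrable_zero *] by (simp only: diff_0 minus_divide_left)
  qed
  have \<kappa>': "(\<lambda>s. - 2 * \<i> * \<kappa> s) absolutely_integrable_on {a..b}"
    by (intro absolutely_integrable_continuous_real continuous_intros \<kappa>c)
  have abs_int: "(\<lambda>s. \<beta> s * g s) integrable_on {a..t}"
    if "\<beta> absolutely_integrable_on {a..b}" "continuous_on {a..b} g" "t \<in> {a..b}" for \<beta> g :: "real \<Rightarrow> complex" and t
    by (rule absolutely_integrable_on_subinterval_integrable[OF absolutely_integrable_mult_continuous(1)[OF that(1,2)]])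
       (use that(3) in auto)
  let ?I1 = "\<lambda>t lam. integral {a..t} (\<lambda>s. \<alpha> s * v s lam)"
    and ?I2 = "\<lambda>t lam. integral {a..t} (\<lambda>s. \<gamma> s / (2 * \<i>) * (1 + u s lam + v s lam))"
    and ?I3 = "\<lambda>t lam. integral {a..t} (\<lambda>s. - 2 * \<i> * \<kappa> s * v s lam)"
    and ?I4 = "\<lambda>t lam. integral {a..t} (\<lambda>s. \<alpha> s * (1 + u s lam))"
    and ?I5 = "\<lambda>t lam. integral {a..t} (\<lambda>s. - \<gamma> s / (2 * \<i>) * (1 + u s lam + v s lam))"
  have J1: "laurent_family a b (\<lambda>t lam. lam ^ 0 * (1 / lam) ^ 0 * ?I1 t lam + lam ^ 0 * (1 / lam) ^ 1 * ?I2 t lam)"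
    by (intro laurent_family.add laurent_family_integral \<alpha> \<gamma>' v w)
  have J2: "laurent_family a b (\<lambda>t lam. lam ^ 1 * (1 / lam) ^ 0 * ?I3 t lam +
     (lam ^ 0 * (1 / lam) ^ 0 * ?I4 t lam + lam ^ 0 * (1 / lam) ^ 1 * ?I5 t lam))"
    by (intro laurent_family.add laurent_family_integral \<alpha> \<gamma>' \<kappa>' v w w1)
  show ?case
  proof
    show "laurent_family a b (\<lambda>t lam. fst (picard a (rhs lam) (Suc n) t))"
    proof (rule laurent_family.cong[OF J1])
      fix t and lam :: complex assume t: "t \<in> {a..b}"
      have "fst (picard a (rhs lam) (Suc n) t) = integral {a..t} (\<lambda>s. \<alpha> s * v s lam + 1 / lam * (\<gamma> s / (2 * \<i>) * (1 + u s lam + v s lam)))"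
        unfolding picard.simps uv integral_rhs(1)[OF pc t] by (simp only: rhs_split fst_conv snd_conv)
      also have "\<dots> = ?I1 t lam + integral {a..t} (\<lambda>s. 1 / lam * (\<gamma> s / (2 * \<i>) * (1 + u s lam + v s lam)))"
      proof (rule integral_add)
        show "(\<lambda>s. \<alpha> s * v s lam) integrable_on {a..t}" by (intro abs_int \<alpha> vc t)
        show "(\<lambda>s. 1 / lam * (\<gamma> s / (2 * \<i>) * (1 + u s lam + v s lam))) integrable_on {a..t}"
          by (intro integrable_on_mult_right abs_int \<gamma>'(1) continuous_intros uc vc t)
      qed
      finally show "fst (picard a (rhs lam) (Suc n) t) = lam ^ 0 * (1 / lam) ^ 0 * ?I1 t lam + lam ^ 0 * (1 / lam) ^ 1 * ?I2 t lam"
        by simp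
    qed
    show "laurent_family a b (\<lambda>t lam. snd (picard a (rhs lam) (Suc n) t))"
    proof (rule laurent_family.cong[OF J2])
      fix t and lam :: complex assume t: "t \<in> {a..b}"
      have "snd (picard a (rhs lam) (Suc n) t) = integral {a..t} (\<lambda>s. lam * (- 2 * \<i> * \<kappa> s * v s lam) +
         (\<alpha> s * (1 + u s lam) + 1 / lam * (- \<gamma> s / (2 * \<i>) * (1 + u s lam + v s lam))))"
        unfolding picard.simps uv integral_rhs(2)[OF pc t] by (simp only: rhs_split fst_conv snd_conv)
      also have "\<dots> = integral {a..t} (\<lambda>s. lam * (- 2 * \<i> * \<kappa> s * v s lam)) + (?I4 t lam + integral {a..t} (\<lambda>s. 1 / lam * (- \<gamma> s / (2 * \<i>) * (1 + u s lam + v s lam))))"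
      proof -
        have i: "(\<lambda>s. lam * (- 2 * \<i> * \<kappa> s * v s lam)) integrable_on {a..t}"
          by (intro integrable_on_mult_right abs_int \<kappa>' vc t)
        have i': "(\<lambda>s. \<alpha> s * (1 + u s lam)) integrable_on {a..t}"
          by (intro abs_int \<alpha> continuous_intros uc t)
        have i'': "(\<lambda>s. 1 / lam * (- \<gamma> s / (2 * \<i>) * (1 + u s lam + v s lam))) integrable_on {a..t}"
          by (intro integrable_on_mult_right abs_int \<gamma>'(2) continuous_intros uc vc t)
        show ?thesis by (simp only: integral_add i i' i'' integrable_add)
      qed
      finally show "snd (picard a (rhs lam) (Suc n) t) = lam ^ 1 * (1 / lam) ^ 0 * ?I3 t lam +
     (lam ^ 0 * (1 / lam) ^ 0 * ?I4 t lam + lam ^ 0 * (1 / lam) ^ 1 * ?I5 t lam)"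
        by simp
    qed
  qed
qed

end

section \<open>Solutions of the amplitude system and their analyticity in the parameter\<close>

context perturbed_phase begin

text \<open>The value at \<open>b\<close> of the weight exponent in the Picard estimate. It depends
  on \<open>lam\<close> only through the modulus, which permits bounds that are uniform on discs
  away from 0.\<close>

definition mass :: "complex \<Rightarrow> real" where
  "mass lam = integral {a..b} (lipc lam)"

lemma mass_eq:
  "mass lam = 2 * integral {a..b} (\<lambda>s. norm (\<alpha> s)) + 2 * integral {a..b} (\<lambda>s. norm (\<gamma> s)) / norm lam
     + 2 * norm lam * integral {a..b} \<kappa>"
proof -
  have i: "(\<lambda>s. norm (\<alpha> s)) integrable_on {a..b}" "(\<lambda>s. norm (\<gamma> s)) integrable_on {a..b}"
    using \<alpha> \<gamma> by (simp_all add: absolutely_integrable_on_def)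
  have "mass lam = integral {a..b} (\<lambda>s. 2 * norm (\<alpha> s) + 2 * norm (\<gamma> s) / norm lam + 2 * norm lam * \<kappa> s)"
    unfolding mass_def lipc_def ..
  also have "\<dots> = integral {a..b} (\<lambda>s. 2 * norm (\<alpha> s)) + integral {a..b} (\<lambda>s. 2 * norm (\<gamma> s) / norm lam)
      + integral {a..b} (\<lambda>s. 2 * norm lam * \<kappa> s)"
    using i \<kappa>i(2) by (simp only: integral_add integrable_add integrable_on_mult_right integrable_on_divide)
  finally show ?thesis by simp
qed

lemma solution_ex:
  "\<exists>x. continuous_on {a..b} x \<and> (\<forall>t\<in>{a..b}. x t = integral {a..t} (\<lambda>s. rhs lam s (x s))) \<and>
    (\<forall>n. \<forall>t\<in>{a..b}. norm (x t - picard a (rhs lam) n t) \<le> 2 * mass lam * (1 / 2) ^ n * exp (2 * mass lam))"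
proof -
  define m where "m = (\<lambda>t. integral {a..t} (lipc lam))"
  have li: "lipc lam integrable_on {c..d}" if "a \<le> c" "d \<le> b" for c d
    by (rule absolutely_integrable_on_subinterval_integrable[OF lipc_integrable that])
  have m_le: "m t \<le> mass lam" if "t \<in> {a..b}" for t
    unfolding m_def mass_def by (rule integral_subset_le) (use that li lipc_nonneg in auto)
  have mass0: "mass lam \<ge> 0" unfolding mass_def by (rule integral_nonneg) (use li lipc_nonneg in auto)
  obtain x where x: "continuous_on {a..b} x" "\<And>t. t \<in> {a..b} \<Longrightarrow> x t = integral {a..t} (\<lambda>s. rhs lam s (x s))"
    "\<And>n t. t \<in> {a..b} \<Longrightarrow> norm (x t - picard a (rhs lam) n t) \<le> 2 * mass lam * (1 / 2) ^ n * exp (2 * m t)"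
  proof (rule picard_convergence[where k = "lipc lam" and a = a and b = b and m = m and G = "rhs lam" and C = "mass lam"])
    show "norm (integral {a..t} (\<lambda>s. rhs lam s 0)) \<le> mass lam" if t: "t \<in> {a..b}" for t
    proof (rule order_trans[OF _ m_le[OF t]])
      show "norm (integral {a..t} (\<lambda>s. rhs lam s 0)) \<le> m t" unfolding m_def
      proof (rule integral_norm_bound_integral)
        show "(\<lambda>s. rhs lam s 0) integrable_on {a..t}"
          by (rule absolutely_integrable_on_subinterval_integrable[OF rhs_integrable]) (use t in auto)
      qed (use t li rhs_0_le in auto)
    qed
  qed (auto simp: m_def intro: lipc_integrable rhs_lipschitz rhs_integrable)
  have "norm (x t - picard a (rhs lam) n t) \<le> 2 * mass lam * (1 / 2) ^ n * exp (2 * mass lam)" if "t \<in> {a..b}" for n t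
    by (rule order_trans[OF x(3)[OF that] mult_left_mono]) (use m_le[OF that] mass0 in auto)
  with x show ?thesis by blast
qed

text \<open>An arbitrary choice for each \<open>lam\<close> separately; analyticity in
  \<open>lam\<close> is recovered from the Picard error bound, which is therefore part of the
  specification.\<close>

definition sol :: "complex \<Rightarrow> real \<Rightarrow> complex \<times> complex" where
  "sol lam = (SOME x. continuous_on {a..b} x \<and> (\<forall>t\<in>{a..b}. x t = integral {a..t} (\<lambda>s. rhs lam s (x s))) \<and>
    (\<forall>n. \<forall>t\<in>{a..b}. norm (x t - picard a (rhs lam) n t) \<le> 2 * mass lam * (1 / 2) ^ n * exp (2 * mass lam)))"

lemma sol: "continuous_on {a..b} (sol lam)" "t \<in> {a..b} \<Longrightarrow> sol lam t = integral {a..t} (\<lambda>s. rhs lam s (sol lam s))"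
  "t \<in> {a..b} \<Longrightarrow> norm (sol lam t - picard a (rhs lam) n t) \<le> 2 * mass lam * (1 / 2) ^ n * exp (2 * mass lam)"
  using someI_ex[OF solution_ex[of lam]] unfolding sol_def[symmetric] by blast+

definition x1 :: "real \<Rightarrow> complex \<Rightarrow> complex" where "x1 t lam = fst (sol lam t)"
definition x2 :: "real \<Rightarrow> complex \<Rightarrow> complex" where "x2 t lam = snd (sol lam t)"

lemma x12_continuous: "continuous_on {a..b} (\<lambda>t. x1 t lam)" "continuous_on {a..b} (\<lambda>t. x2 t lam)"
  unfolding x1_def x2_def by (intro continuous_intros sol(1))+

lemma sol_eq: "sol lam = (\<lambda>t. (x1 t lam, x2 t lam))"
  by (simp add: x1_def x2_def)

lemma x12_eq:
  assumes "t \<in> {a..b}"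
  shows "x1 t lam = integral {a..t} (\<lambda>s. fst (rhs lam s (x1 s lam, x2 s lam)))"
    "x2 t lam = integral {a..t} (\<lambda>s. snd (rhs lam s (x1 s lam, x2 s lam)))"
  using sol(2)[OF assms, of lam] integral_rhs[OF sol(1) assms, of lam] by (auto simp: sol_eq prod_eq_iff)

lemma x12_abs_cont: "abs_cont_on a b (\<lambda>t. x1 t lam)" "abs_cont_on a b (\<lambda>t. x2 t lam)"
  by (rule abs_cont_on_cong[OF abs_cont_on_integral[OF rhs_components_integrable(1)[OF x12_continuous]] x12_eq(1)[symmetric]], assumption)
     (rule abs_cont_on_cong[OF abs_cont_on_integral[OF rhs_components_integrable(2)[OF x12_continuous]] x12_eq(2)[symmetric]], assumption)

lemma x12_derivative:
  obtains N where "negligible N"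
    "\<And>t. t \<in> {a<..<b} - N \<Longrightarrow> ((\<lambda>t. x1 t lam) has_vector_derivative fst (rhs lam t (x1 t lam, x2 t lam))) (at t)"
    "\<And>t. t \<in> {a<..<b} - N \<Longrightarrow> ((\<lambda>t. x2 t lam) has_vector_derivative snd (rhs lam t (x1 t lam, x2 t lam))) (at t)"
proof -
  let ?f = "\<lambda>s. fst (rhs lam s (x1 s lam, x2 s lam))" and ?g = "\<lambda>s. snd (rhs lam s (x1 s lam, x2 s lam))"
  have i: "?f integrable_on {a..b}" "?g integrable_on {a..b}"
    using rhs_components_integrable[OF x12_continuous[of lam], of lam] by (auto simp: absolutely_integrable_on_def)
  obtain N1 where N1: "negligible N1"
    "\<And>x. x \<in> {a<..<b} - N1 \<Longrightarrow> ((\<lambda>x. integral {a..x} ?f) has_vector_derivative ?f x) (at x)"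
    using indefinite_integral_has_vector_derivative_AE[OF i(1)] by blast
  obtain N2 where N2: "negligible N2"
    "\<And>x. x \<in> {a<..<b} - N2 \<Longrightarrow> ((\<lambda>x. integral {a..x} ?g) has_vector_derivative ?g x) (at x)"
    using indefinite_integral_has_vector_derivative_AE[OF i(2)] by blast
  show ?thesis
  proof (rule that[of "N1 \<union> N2"])
    show "negligible (N1 \<union> N2)" using N1(1) N2(1) by simp
    fix t assume t: "t \<in> {a<..<b} - (N1 \<union> N2)"
    have t': "t \<in> {a<..<b}" "t \<in> {a<..<b} - N1" "t \<in> {a<..<b} - N2" using t by auto
    show "((\<lambda>t. x1 t lam) has_vector_derivative ?f t) (at t)"
      by (rule has_vector_derivative_transform_within_open[OF N1(2)[OF t'(2)] open_greaterThanLessThan t'(1)])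
         (simp add: x12_eq(1))
    show "((\<lambda>t. x2 t lam) has_vector_derivative ?g t) (at t)"
      by (rule has_vector_derivative_transform_within_open[OF N2(2)[OF t'(3)] open_greaterThanLessThan t'(1)])
         (simp add: x12_eq(2))
  qed
qed

text \<open>On the disc of radius |z|/2 the modulus of the parameter stays between |z|/2 and 2|z|.
  This bounds \<open>mass\<close> by a constant \<open>B\<close> and makes the geometric error
  uniform on the disc.\<close>

lemma sol_uniform_limit:
  assumes t: "t \<in> {a..b}" and "z \<noteq> 0"
  shows "uniform_limit (cball z (norm z / 2)) (\<lambda>n lam. picard a (rhs lam) n t) (\<lambda>lam. sol lam t) sequentially"
proof -
  define B where "B = 2 * integral {a..b} (\<lambda>s. norm (\<alpha> s)) + 2 * integral {a..b} (\<lambda>s. norm (\<gamma> s)) / (norm z / 2)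
     + 2 * (2 * norm z) * integral {a..b} \<kappa>"
  have mass_B: "0 \<le> mass w" "mass w \<le> B" if w: "w \<in> cball z (norm z / 2)" for w
  proof -
    show "0 \<le> mass w" unfolding mass_def
      by (rule integral_nonneg[OF absolutely_integrable_on_subinterval_integrable[OF lipc_integrable]]) (use lipc_nonneg in auto)
    have "norm z - norm w \<le> norm z / 2" "norm w - norm z \<le> norm z / 2"
      using w norm_triangle_ineq2[of z w] norm_triangle_ineq2[of w z] by (auto simp: dist_norm norm_minus_commute)
    then have nw: "norm z / 2 \<le> norm w" "norm w \<le> 2 * norm z" by auto
    have pos: "0 \<le> integral {a..b} (\<lambda>s. norm (\<gamma> s))" "0 \<le> integral {a..b} \<kappa>"
      using \<gamma> \<kappa>i(2) \<kappa>0 by (auto intro!: integral_nonneg simp: absolutely_integrable_on_def less_imp_le)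
    have 1: "2 * integral {a..b} (\<lambda>s. norm (\<gamma> s)) / norm w \<le> 2 * integral {a..b} (\<lambda>s. norm (\<gamma> s)) / (norm z / 2)"
      using nw(1) pos(1) \<open>z \<noteq> 0\<close> by (intro divide_left_mono) (auto intro!: mult_pos_pos)
    have 2: "2 * norm w * integral {a..b} \<kappa> \<le> 2 * (2 * norm z) * integral {a..b} \<kappa>"
      using nw(2) pos(2) by (intro mult_right_mono) auto
    show "mass w \<le> B" unfolding mass_eq B_def using 1 2 by linarith
  qed
  show ?thesis
  proof (rule uniform_limitI)
    fix e :: real assume "e > 0"
    have "(\<lambda>n. 2 * B * (1 / 2) ^ n * exp (2 * B)) \<longlonglongrightarrow> 2 * B * 0 * exp (2 * B)"
      by (intro tendsto_intros LIMSEQ_power_zero) simp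
    then have "\<forall>\<^sub>F n in sequentially. 2 * B * (1 / 2) ^ n * exp (2 * B) < e" using \<open>e > 0\<close> by (intro order_tendstoD(2)) auto
    then show "\<forall>\<^sub>F n in sequentially. \<forall>w\<in>cball z (norm z / 2). dist (picard a (rhs w) n t) (sol w t) < e"
    proof (rule eventually_mono, intro ballI)
      fix n w assume n: "2 * B * (1 / 2) ^ n * exp (2 * B) < e" and w: "w \<in> cball z (norm z / 2)"
      have "norm (sol w t - picard a (rhs w) n t) \<le> 2 * mass w * (1 / 2) ^ n * exp (2 * mass w)" by (rule sol(3)[OF t])
      also have "\<dots> \<le> 2 * B * (1 / 2) ^ n * exp (2 * B)"
        using mass_B[OF w] by (intro mult_mono) auto
      finally show "dist (picard a (rhs w) n t) (sol w t) < e" using n by (simp add: dist_norm norm_minus_commute)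
    qed
  qed
qed

lemma x12_holomorphic:
  assumes t: "t \<in> {a..b}"
  shows "(\<lambda>lam. x1 t lam) holomorphic_on - {0}" "(\<lambda>lam. x2 t lam) holomorphic_on - {0}"
proof -
  have sub: "cball z (norm z / 2) \<subseteq> - {0}" if "z \<noteq> 0" for z :: complex using that by auto
  have u: "uniform_limit (cball z (norm z / 2)) (\<lambda>n lam. fst (picard a (rhs lam) n t)) (\<lambda>lam. x1 t lam) sequentially"
    "uniform_limit (cball z (norm z / 2)) (\<lambda>n lam. snd (picard a (rhs lam) n t)) (\<lambda>lam. x2 t lam) sequentially"
    if "z \<noteq> 0" for z
    using bounded_linear.uniform_limit[OF bounded_linear_fst sol_uniform_limit[OF t that]]
      bounded_linear.uniform_limit[OF bounded_linear_snd sol_uniform_limit[OF t that]]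
    by (simp_all add: x1_def x2_def)
  show "(\<lambda>lam. x1 t lam) holomorphic_on - {0}"
  proof (rule holomorphic_uniform_sequence)
    show "(\<lambda>lam. fst (picard a (rhs lam) n t)) holomorphic_on - {0}" for n
      by (rule laurent_family_holomorphic_on[OF conjunct1[OF laurent_family_picard] t])
    show "\<exists>d>0. cball z d \<subseteq> - {0} \<and> uniform_limit (cball z d) (\<lambda>n lam. fst (picard a (rhs lam) n t)) (\<lambda>lam. x1 t lam) sequentially"
      if "z \<in> - {0}" for z using that u(1)[of z] sub[of z] by (intro exI[of _ "norm z / 2"]) auto
  qed (auto intro: open_Compl)
  show "(\<lambda>lam. x2 t lam) holomorphic_on - {0}"
  proof (rule holomorphic_uniform_sequence)
    show "(\<lambda>lam. snd (picard a (rhs lam) n t)) holomorphic_on - {0}" for n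
      by (rule laurent_family_holomorphic_on[OF conjunct2[OF laurent_family_picard] t])
    show "\<exists>d>0. cball z d \<subseteq> - {0} \<and> uniform_limit (cball z d) (\<lambda>n lam. snd (picard a (rhs lam) n t)) (\<lambda>lam. x2 t lam) sequentially"
      if "z \<in> - {0}" for z using that u(2)[of z] sub[of z] by (intro exI[of _ "norm z / 2"]) auto
  qed (auto intro: open_Compl)
qed

text \<open>The integrating factor with exponent \<open>2 * \<i> * lam * T\<close> cancels the only
  term whose coefficient grows with \<open>lam\<close>. What remains contains \<open>lam\<close> in
  a denominator and in an exponential that is bounded on the half-plane.\<close>

lemma x2_duhamel:
  assumes t: "t \<in> {a..b}"
  shows "x2 t lam = integral {a..t} (\<lambda>\<tau>. exp (- 2 * \<i> * lam * of_real (T t - T \<tau>)) *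
    (\<alpha> \<tau> * (1 + x1 \<tau> lam) - \<gamma> \<tau> / (2 * \<i> * lam) * (1 + x1 \<tau> lam + x2 \<tau> lam)))"
proof -
  define w where "w = (\<lambda>\<tau>. \<alpha> \<tau> * (1 + x1 \<tau> lam) - \<gamma> \<tau> / (2 * \<i> * lam) * (1 + x1 \<tau> lam + x2 \<tau> lam))"
  define Y where "Y = (\<lambda>\<tau>. exp (2 * \<i> * lam * of_real (T \<tau>)) * x2 \<tau> lam)"
  have ac: "abs_cont_on a b Y" unfolding Y_def
    by (intro abs_cont_on_mult x12_abs_cont abs_cont_on_exp
        abs_cont_on_linear[OF _ bounded_linear_mult_right] abs_cont_on_linear[OF T_ac bounded_linear_of_real])
  obtain N where N: "negligible N"
    "\<And>t. t \<in> {a<..<b} - N \<Longrightarrow> ((\<lambda>t. x2 t lam) has_vector_derivative snd (rhs lam t (x1 t lam, x2 t lam))) (at t)"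
    using x12_derivative[of lam] by metis
  have der: "(Y has_vector_derivative exp (2 * \<i> * lam * of_real (T \<tau>)) * w \<tau>) (at \<tau>)" if \<tau>: "\<tau> \<in> {a<..<b} - N" for \<tau>
  proof -
    have T': "(T has_real_derivative \<kappa> \<tau>) (at \<tau>)" using T_der \<tau> by blast
    have "((\<lambda>\<tau>. exp (2 * \<i> * lam * of_real (T \<tau>))) has_vector_derivative
        exp (2 * \<i> * lam * of_real (T \<tau>)) * (2 * \<i> * lam * of_real (\<kappa> \<tau>))) (at \<tau>)"
      by (intro has_vector_derivative_exp_compose has_vector_derivative_mult_right has_vector_derivative_of_real T')
    from has_vector_derivative_mult[OF this N(2)[OF \<tau>]]
    show ?thesis unfolding Y_def w_def by (simp add: rhs_def algebra_simps)
  qed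
  have "Y t - Y a = integral {a..t} (\<lambda>\<tau>. exp (2 * \<i> * lam * of_real (T \<tau>)) * w \<tau>)"
    by (rule abs_cont_on_integral_of_derivative(2)[OF ac N(1) der t])
  moreover have "Y a = 0" using x12_eq(2)[of a lam] ab by (simp add: Y_def)
  ultimately have Yt: "Y t = integral {a..t} (\<lambda>\<tau>. exp (2 * \<i> * lam * of_real (T \<tau>)) * w \<tau>)" by simp
  have ex: "exp (- 2 * \<i> * lam * of_real (T t)) * (exp (2 * \<i> * lam * of_real (T \<tau>)) * c) =
     exp (- 2 * \<i> * lam * of_real (T t - T \<tau>)) * c" for \<tau> c
  proof -
    have e: "- 2 * \<i> * lam * of_real (T t - T \<tau>) = - 2 * \<i> * lam * of_real (T t) + 2 * \<i> * lam * of_real (T \<tau>)"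
      by (simp add: algebra_simps)
    show ?thesis unfolding e exp_add by (simp only: mult.assoc)
  qed
  have "x2 t lam = exp (- 2 * \<i> * lam * of_real (T t)) * Y t"
    unfolding Y_def ex by simp
  also have "\<dots> = integral {a..t} (\<lambda>\<tau>. exp (- 2 * \<i> * lam * of_real (T t)) * (exp (2 * \<i> * lam * of_real (T \<tau>)) * w \<tau>))"
    unfolding Yt by (rule integral_mult_right[symmetric])
  also have "\<dots> = integral {a..t} (\<lambda>\<tau>. exp (- 2 * \<i> * lam * of_real (T t - T \<tau>)) * w \<tau>)"
    by (simp only: ex)
  finally show ?thesis by (simp only: w_def)
qed

end

section \<open>Smallness of the amplitudes for large parameters\<close>

context perturbed_phase begin

text \<open>Gronwall's inequality for the original system would be useless, since
  \<open>lipc\<close> grows with |lam|. Duhamel's formula for \<open>x2\<close> trades that growth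
  for a bounded exponential; the kernel \<open>k\<close> is then free of \<open>lam\<close>, and
  only the inhomogeneous terms have to be small: the oscillatory integral of \<alpha> and the term
  \<gamma>/lam.\<close>

lemma x12_small:
  assumes s: "0 \<le> s" and "\<epsilon> > 0"
  obtains R where "R > 0" "\<And>lam t. norm lam > R \<Longrightarrow> Im lam \<le> s \<Longrightarrow> t \<in> {a..b} \<Longrightarrow> norm (x1 t lam) + norm (x2 t lam) \<le> \<epsilon>"
proof -
  define K where "K = exp (2 * s * T b)"
  have "T b \<ge> 0" using T_ge0[of b] ab by simp
  then have K: "K \<ge> 1" using s by (simp add: K_def)
  define k where "k = (\<lambda>s. K * (norm (\<alpha> s) + norm (\<gamma> s)))"
  have na: "(\<lambda>s. norm (\<alpha> s)) absolutely_integrable_on {a..b}" "(\<lambda>s. norm (\<gamma> s)) absolutely_integrable_on {a..b}"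
    using \<alpha> \<gamma> by (simp_all add: absolutely_integrable_on_def)
  have k: "k absolutely_integrable_on {a..b}" unfolding k_def
    by (intro set_integrable_mult_right set_integral_add(1) na)
  have k0: "k x \<ge> 0" for x using K by (simp add: k_def)
  define m where "m = (\<lambda>t. integral {a..t} k)"
  define \<Gamma> where "\<Gamma> = integral {a..b} (\<lambda>s. norm (\<gamma> s))"
  have ni: "(\<lambda>s. norm (\<gamma> s)) integrable_on {c..d}" if "a \<le> c" "d \<le> b" for c d
    by (rule absolutely_integrable_on_subinterval_integrable[OF na(2) that])
  have ki: "k integrable_on {c..d}" if "a \<le> c" "d \<le> b" for c d
    by (rule absolutely_integrable_on_subinterval_integrable[OF k that])
  have \<Gamma>0: "\<Gamma> \<ge> 0" unfolding \<Gamma>_def by (rule integral_nonneg) (use ni in auto)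
  have m_le: "m t \<le> m b" if "t \<in> {a..b}" for t
    unfolding m_def by (rule integral_subset_le) (use that ki k0 in auto)
  \<comment> \<open>Gronwall turns the inhomogeneity \<open>2 * \<epsilon>'\<close> into at most
    \<open>4 * \<epsilon>' * exp (2 * m b)\<close>.\<close>
  define \<epsilon>' where "\<epsilon>' = \<epsilon> / (4 * exp (2 * m b))"
  have \<epsilon>': "\<epsilon>' > 0" using \<open>\<epsilon> > 0\<close> by (simp add: \<epsilon>'_def)
  obtain R0 where R0: "R0 > 0" "\<And>lam t. norm lam > R0 \<Longrightarrow> Im lam \<le> s \<Longrightarrow> t \<in> {a..b} \<Longrightarrow>
    norm (integral {a..t} (\<lambda>\<tau>. exp (- 2 * \<i> * lam * of_real (T t - T \<tau>)) * \<alpha> \<tau>)) \<le> \<epsilon>'"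
    using oscillatory_integral_tendsto_0[OF \<alpha> s \<epsilon>'] by blast
  \<comment> \<open>\<open>R0\<close> makes the oscillatory integral small, 1 allows
    |\<gamma>|/|lam| to be replaced by |\<gamma>|, and the last entry brings the inhomogeneous
    \<gamma> term below \<open>\<epsilon>'\<close>.\<close>
  define R where "R = max (max R0 1) (K * \<Gamma> / \<epsilon>')"
  show ?thesis
  proof (rule that[of R])
    show "R > 0" using R0(1) by (simp add: R_def)
    fix lam :: complex and t0 assume lam: "norm lam > R" "Im lam \<le> s" and t0: "t0 \<in> {a..b}"
    have lamR: "norm lam > R0" "norm lam > 1" "norm lam > K * \<Gamma> / \<epsilon>'" using lam(1) by (auto simp: R_def)
    then have lam0: "norm lam > 0" by linarith
    define N where "N = (\<lambda>t. norm (x1 t lam) + norm (x2 t lam))"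
    have Nc: "continuous_on {a..b} N" unfolding N_def by (intro continuous_intros x12_continuous)
    have N0: "N t \<ge> 0" for t by (simp add: N_def)
    have KG: "K * \<Gamma> / norm lam \<le> \<epsilon>'"
      using lamR(3) \<epsilon>' lam0 by (simp add: field_simps)
    have ineq: "N t \<le> 2 * \<epsilon>' + integral {a..t} (\<lambda>s. k s * N s)" if t: "t \<in> {a..b}" for t
    proof -
      define c where "c = (\<lambda>\<tau>. \<gamma> \<tau> / (2 * \<i> * lam))"
      define X where "X = (\<lambda>\<tau>. 1 + x1 \<tau> lam + x2 \<tau> lam)"
      define E where "E = (\<lambda>\<tau>. exp (- 2 * \<i> * lam * of_real (T t - T \<tau>)))"
      have EK: "norm (E \<tau>) \<le> K" if "\<tau> \<in> {a..t}" for \<tau>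
        unfolding E_def K_def using norm_exp_phase_le[OF lam(2) s] that t by auto
      have Ec: "continuous_on {a..b} E" unfolding E_def by (intro continuous_intros T_cont)
      have cX: "(\<lambda>\<tau>. c \<tau> * X \<tau>) absolutely_integrable_on {a..b}" unfolding c_def X_def
        by (intro absolutely_integrable_mult_continuous(1) set_integrable_divide \<gamma> continuous_intros x12_continuous)
      have ax: "(\<lambda>\<tau>. \<alpha> \<tau> * x1 \<tau> lam) absolutely_integrable_on {a..b}" "(\<lambda>\<tau>. \<alpha> \<tau> * x2 \<tau> lam) absolutely_integrable_on {a..b}"
        by (intro absolutely_integrable_mult_continuous(1) \<alpha> x12_continuous)+
      note sub = absolutely_integrable_on_subinterval_integrable[where a = a and b = b and c = a and d = t]
      have at: "a \<le> a" "t \<le> b" using t by auto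
      \<comment> \<open>The constant in \<open>1 + x1\<close> is left out of the \<alpha> term of
        \<open>f2\<close>: its contribution is the oscillatory integral, whose smallness would be
        lost by taking absolute values.\<close>
      define f1 f2 where "f1 = (\<lambda>\<tau>. \<alpha> \<tau> * x2 \<tau> lam + c \<tau> * X \<tau>)" and "f2 = (\<lambda>\<tau>. E \<tau> * (\<alpha> \<tau> * x1 \<tau> lam - c \<tau> * X \<tau>))"
      have f1: "f1 absolutely_integrable_on {a..b}" unfolding f1_def by (intro set_integral_add(1) ax cX)
      have f2: "f2 absolutely_integrable_on {a..b}" unfolding f2_def
        by (intro absolutely_integrable_mult_continuous(2) Ec set_integral_diff(1) ax cX)
      have Ea: "(\<lambda>\<tau>. E \<tau> * \<alpha> \<tau>) absolutely_integrable_on {a..b}" by (rule absolutely_integrable_mult_continuous(2)[OF \<alpha> Ec])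
      have 1: "x1 t lam = integral {a..t} f1"
        unfolding f1_def c_def X_def using x12_eq(1)[OF t, of lam] by (simp add: rhs_def)
      have "x2 t lam = integral {a..t} (\<lambda>\<tau>. E \<tau> * (\<alpha> \<tau> * (1 + x1 \<tau> lam) - c \<tau> * X \<tau>))"
        unfolding E_def c_def X_def by (rule x2_duhamel[OF t])
      also have "\<dots> = integral {a..t} (\<lambda>\<tau>. E \<tau> * \<alpha> \<tau> + f2 \<tau>)"
        by (rule integral_cong) (simp add: f2_def algebra_simps)
      also have "\<dots> = integral {a..t} (\<lambda>\<tau>. E \<tau> * \<alpha> \<tau>) + integral {a..t} f2"
        by (rule integral_add[OF sub[OF Ea at] sub[OF f2 at]])
      finally have x2_split: "x2 t lam = integral {a..t} (\<lambda>\<tau>. E \<tau> * \<alpha> \<tau>) + integral {a..t} f2" .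
      have 2: "norm (x2 t lam) \<le> \<epsilon>' + norm (integral {a..t} f2)"
        unfolding x2_split using norm_triangle_ineq[of "integral {a..t} (\<lambda>\<tau>. E \<tau> * \<alpha> \<tau>)" "integral {a..t} f2"] R0(2)[OF lamR(1) lam(2) t]
        unfolding E_def by linarith
      define g where "g = (\<lambda>\<tau>. K * norm (\<gamma> \<tau>) / norm lam + k \<tau> * N \<tau>)"
      define h1 h2 where "h1 = (\<lambda>\<tau>. norm (\<alpha> \<tau>) * norm (x2 \<tau> lam) + norm (\<gamma> \<tau>) / norm lam / 2 * (1 + N \<tau>))"
        and "h2 = (\<lambda>\<tau>. K * (norm (\<alpha> \<tau>) * norm (x1 \<tau> lam) + norm (\<gamma> \<tau>) / norm lam / 2 * (1 + N \<tau>)))"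
      have h1: "h1 absolutely_integrable_on {a..b}" and h2: "h2 absolutely_integrable_on {a..b}"
        unfolding h1_def h2_def
        by (intro set_integrable_mult_right set_integral_add(1) absolutely_integrable_mult_continuous(1) na
            set_integrable_divide continuous_intros x12_continuous Nc)+
      have g: "g absolutely_integrable_on {a..b}" unfolding g_def
        by (intro set_integral_add(1) set_integrable_mult_right set_integrable_divide absolutely_integrable_mult_continuous(1) na k Nc)
      have nX: "norm (X \<tau>) \<le> 1 + N \<tau>" for \<tau>
        unfolding X_def N_def using norm_triangle_ineq[of "1 + x1 \<tau> lam" "x2 \<tau> lam"] norm_triangle_ineq[of 1 "x1 \<tau> lam"] by simp
      have nc: "norm (c \<tau>) = norm (\<gamma> \<tau>) / norm lam / 2" for \<tau> by (simp add: c_def norm_divide norm_mult)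
      have cX_le: "norm (c \<tau> * X \<tau>) \<le> norm (\<gamma> \<tau>) / norm lam / 2 * (1 + N \<tau>)" for \<tau>
        unfolding norm_mult nc by (rule mult_left_mono[OF nX]) simp
      have f1_le: "norm (f1 \<tau>) \<le> h1 \<tau>" for \<tau>
        unfolding f1_def h1_def by (rule norm_triangle_mono[OF _ cX_le]) (simp add: norm_mult)
      have f2_le: "norm (f2 \<tau>) \<le> h2 \<tau>" if "\<tau> \<in> {a..t}" for \<tau>
      proof -
        have "norm (\<alpha> \<tau> * x1 \<tau> lam - c \<tau> * X \<tau>) \<le> norm (\<alpha> \<tau>) * norm (x1 \<tau> lam) + norm (\<gamma> \<tau>) / norm lam / 2 * (1 + N \<tau>)"
          by (rule norm_triangle_le_diff[OF add_mono[OF _ cX_le]]) (simp add: norm_mult)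
        then show ?thesis unfolding f2_def h2_def norm_mult[of "E \<tau>"] using EK[OF that] K by (intro mult_mono) auto
      qed
      \<comment> \<open>The factor 1/|lam| is kept in the inhomogeneous part of the \<gamma> terms
        and given up in the part multiplied by \<open>N\<close>, which goes into \<open>k\<close>.
        The halves from the two equations add up to one.\<close>
      have h_le: "h1 \<tau> + h2 \<tau> \<le> g \<tau>" for \<tau>
      proof -
        define G where "G = norm (\<gamma> \<tau>) / norm lam"
        have "norm (\<gamma> \<tau>) * 1 \<le> norm (\<gamma> \<tau>) * norm lam" using lamR(2) by (intro mult_left_mono) auto
        then have G: "0 \<le> G" "G \<le> norm (\<gamma> \<tau>)" using lam0 by (auto simp: G_def divide_le_eq)
        have "h1 \<tau> \<le> K * (norm (\<alpha> \<tau>) * norm (x2 \<tau> lam) + G / 2 * (1 + N \<tau>))"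
          unfolding h1_def G_def[symmetric] using mult_right_mono[OF K, of "norm (\<alpha> \<tau>) * norm (x2 \<tau> lam) + G / 2 * (1 + N \<tau>)"] G(1) N0[of \<tau>]
          by simp
        then have "h1 \<tau> + h2 \<tau> \<le> K * (norm (\<alpha> \<tau>) * N \<tau> + G * (1 + N \<tau>))"
          unfolding h2_def G_def[symmetric] N_def by (simp add: algebra_simps)
        also have "\<dots> = K * G + K * (norm (\<alpha> \<tau>) * N \<tau> + G * N \<tau>)" by (simp add: algebra_simps)
        also have "\<dots> \<le> K * G + K * (norm (\<alpha> \<tau>) * N \<tau> + norm (\<gamma> \<tau>) * N \<tau>)"
          using K G N0 by (intro add_left_mono mult_left_mono mult_right_mono) auto
        also have "\<dots> = g \<tau>" unfolding g_def k_def G_def by (simp add: algebra_simps)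
        finally show ?thesis .
      qed
      have "norm (integral {a..t} f1) \<le> integral {a..t} h1"
        using f1_le by (rule integral_norm_bound_integral[OF sub[OF f1 at] sub[OF h1 at]])
      moreover have "norm (integral {a..t} f2) \<le> integral {a..t} h2"
        using f2_le by (rule integral_norm_bound_integral[OF sub[OF f2 at] sub[OF h2 at]])
      moreover have "integral {a..t} h1 + integral {a..t} h2 = integral {a..t} (\<lambda>\<tau>. h1 \<tau> + h2 \<tau>)"
        by (rule integral_add[symmetric, OF sub[OF h1 at] sub[OF h2 at]])
      moreover have "\<dots> \<le> integral {a..t} g"
        by (rule integral_le[OF integrable_add[OF sub[OF h1 at] sub[OF h2 at]] sub[OF g at] h_le])
      moreover have "integral {a..t} g \<le> \<epsilon>' + integral {a..t} (\<lambda>s. k s * N s)"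
      proof -
        have "integral {a..t} g = integral {a..t} (\<lambda>\<tau>. K * norm (\<gamma> \<tau>) / norm lam) + integral {a..t} (\<lambda>s. k s * N s)"
          unfolding g_def using at
          by (intro integral_add integrable_on_divide integrable_on_mult_right ni sub[OF absolutely_integrable_mult_continuous(1)[OF k Nc]]) auto
        also have "integral {a..t} (\<lambda>\<tau>. K * norm (\<gamma> \<tau>) / norm lam) = K * integral {a..t} (\<lambda>s. norm (\<gamma> s)) / norm lam" by simp
        also have "\<dots> \<le> K * \<Gamma> / norm lam"
          unfolding \<Gamma>_def using K at lam0
          by (intro divide_right_mono mult_left_mono integral_subset_le ni) auto
        finally show ?thesis using KG by simp
      qed
      ultimately show ?thesis using 1 2 by (simp add: N_def)
    qed
    have "N t0 \<le> 2 * (2 * \<epsilon>') * exp (2 * m t0)"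
      using gronwall[where k = k and m = m, OF k _ _ Nc ineq _ t0] k0 \<epsilon>' by (simp add: m_def)
    also have "\<dots> \<le> 2 * (2 * \<epsilon>') * exp (2 * m b)" using m_le[OF t0] \<epsilon>' by (intro mult_left_mono) auto
    also have "\<dots> = \<epsilon>" by (simp add: \<epsilon>'_def)
    finally show "norm (x1 t0 lam) + norm (x2 t0 lam) \<le> \<epsilon>" by (simp add: N_def)
  qed
qed

end

section \<open>Absolute continuity and integrability under changes of variable\<close>

lemma abs_cont_on_compose_homeomorphism:
  fixes \<phi> :: "real \<Rightarrow> real"
  assumes F: "abs_cont_on a b F"
    and img: "\<And>u v. c \<le> u \<Longrightarrow> u \<le> v \<Longrightarrow> v \<le> d \<Longrightarrow> \<phi> ` {u..v} = {\<phi> u..\<phi> v} \<or> \<phi> ` {u..v} = {\<phi> v..\<phi> u}"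
    and inj: "inj_on \<phi> {c..d}" and into: "\<phi> ` {c..d} \<subseteq> {a..b}"
    and lip: "\<And>u v. c \<le> u \<Longrightarrow> u \<le> v \<Longrightarrow> v \<le> d \<Longrightarrow> \<bar>\<phi> v - \<phi> u\<bar> \<le> L * (v - u)"
  shows "abs_cont_on c d (\<lambda>t. F (\<phi> t))"
  unfolding abs_cont_on_def
proof (intro allI impI)
  fix e :: real assume "e > 0"
  then obtain \<delta> where \<delta>: "\<delta> > 0" "\<And>D S. D division_of S \<and> S \<subseteq> {a..b} \<and> (\<Sum>K\<in>D. measure lborel K) < \<delta> \<Longrightarrow>
     (\<Sum>K\<in>D. norm (F (Sup K) - F (Inf K))) < e" using F unfolding abs_cont_on_def by meson
  show "\<exists>\<delta>>0. \<forall>D S. D division_of S \<and> S \<subseteq> {c..d} \<and> (\<Sum>K\<in>D. measure lborel K) < \<delta> \<longrightarrow>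
     (\<Sum>K\<in>D. norm (F (\<phi> (Sup K)) - F (\<phi> (Inf K)))) < e"
  proof (intro exI[of _ "\<delta> / (\<bar>L\<bar> + 1)"] conjI allI impI)
    show "\<delta> / (\<bar>L\<bar> + 1) > 0" using \<delta>(1) by (simp add: add_nonneg_pos)
    fix D S assume "D division_of S \<and> S \<subseteq> {c..d} \<and> (\<Sum>K\<in>D. measure lborel K) < \<delta> / (\<bar>L\<bar> + 1)"
    then have D: "D division_of S" "S \<subseteq> {c..d}" "(\<Sum>K\<in>D. measure lborel K) < \<delta> / (\<bar>L\<bar> + 1)" by auto
    define D' where "D' = (\<lambda>K. \<phi> ` K) ` D"
    have K: "K = {Inf K..Sup K}" "Inf K \<le> Sup K" "c \<le> Inf K" "Sup K \<le> d" "K \<subseteq> {c..d}" if "K \<in> D" for K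
      using content_eq_Sup_Inf(2-5)[OF D(1) that] D(2) division_ofD(2)[OF D(1) that] by auto
    have K': "\<phi> ` K = {Inf (\<phi> ` K)..Sup (\<phi> ` K)}" "Inf (\<phi> ` K) \<le> Sup (\<phi> ` K)"
      "norm (F (Sup (\<phi> ` K)) - F (Inf (\<phi> ` K))) = norm (F (\<phi> (Sup K)) - F (\<phi> (Inf K)))"
      "Sup (\<phi> ` K) - Inf (\<phi> ` K) \<le> (\<bar>L\<bar> + 1) * measure lborel K" if KD: "K \<in> D" for K
    proof -
      define u v where "u = Inf K" and "v = Sup K"
      have uv: "K = {u..v}" "c \<le> u" "u \<le> v" "v \<le> d" using K[OF KD] by (auto simp: u_def v_def)
      have mK: "measure lborel K = v - u" using uv by simp
      have "\<bar>\<phi> v - \<phi> u\<bar> \<le> L * (v - u)" by (rule lip[OF uv(2-4)])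
      also have "\<dots> \<le> (\<bar>L\<bar> + 1) * (v - u)" using uv(3) by (intro mult_right_mono) auto
      finally have l: "\<bar>\<phi> v - \<phi> u\<bar> \<le> (\<bar>L\<bar> + 1) * (v - u)" .
      have ne: "\<phi> ` K \<noteq> {}" using uv by auto
      have *: "(\<phi> ` K = {\<phi> u..\<phi> v} \<and> \<phi> u \<le> \<phi> v) \<or> (\<phi> ` K = {\<phi> v..\<phi> u} \<and> \<phi> v \<le> \<phi> u)"
        using img[OF uv(2-4)] ne unfolding uv(1) by (metis atLeastatMost_empty_iff)
      show "\<phi> ` K = {Inf (\<phi> ` K)..Sup (\<phi> ` K)}" "Inf (\<phi> ` K) \<le> Sup (\<phi> ` K)"
        using * by (metis cInf_atLeastAtMost cSup_atLeastAtMost)+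
      show "norm (F (Sup (\<phi> ` K)) - F (Inf (\<phi> ` K))) = norm (F (\<phi> (Sup K)) - F (\<phi> (Inf K)))"
        using * unfolding u_def[symmetric] v_def[symmetric] by (auto simp: norm_minus_commute)
      show "Sup (\<phi> ` K) - Inf (\<phi> ` K) \<le> (\<bar>L\<bar> + 1) * measure lborel K"
        unfolding mK using * l by auto
    qed
    have injD: "inj_on (\<lambda>K. \<phi> ` K) D"
      by (rule inj_onI) (use inj K(5) in \<open>metis inj_on_image_eq_iff\<close>)
    have "D' division_of \<phi> ` S"
    proof (rule division_ofI)
      show "finite D'" unfolding D'_def using D(1) by auto
      show "\<Union>D' = \<phi> ` S" unfolding D'_def using division_ofD(6)[OF D(1)] by auto
      fix J assume "J \<in> D'"
      then obtain K1 where K1: "K1 \<in> D" "J = \<phi> ` K1" by (auto simp: D'_def)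
      show "J \<subseteq> \<phi> ` S" "J \<noteq> {}" using K1 division_ofD(2,3)[OF D(1) K1(1)] by auto
      have "J = cbox (Inf J) (Sup J)" using K'(1)[OF K1(1)] K1(2) by simp
      then show "\<exists>a b. J = cbox a b" by blast
      fix J2 assume "J2 \<in> D'" "J \<noteq> J2"
      then obtain K2 where K2: "K2 \<in> D" "J2 = \<phi> ` K2" by (auto simp: D'_def)
      have "interior K1 \<inter> interior K2 = {}" using division_ofD(5)[OF D(1) K1(1) K2(1)] \<open>J \<noteq> J2\<close> K1 K2 by blast
      then have int12: "interior (K1 \<inter> K2) = {}" by simp
      \<comment> \<open>Two closed intervals whose intersection has empty interior share at most one
        point, and by injectivity so do their images.\<close>
      have "K1 \<inter> K2 = {max (Inf K1) (Inf K2)..min (Sup K1) (Sup K2)}"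
        using K(1)[OF K1(1)] K(1)[OF K2(1)] by (metis Int_atLeastAtMost)
      with int12 have "{max (Inf K1) (Inf K2)<..<min (Sup K1) (Sup K2)} = {}" by (metis interior_atLeastAtMost_real)
      then have "\<not> max (Inf K1) (Inf K2) < min (Sup K1) (Sup K2)" by (metis greaterThanLessThan_empty_iff not_le)
      with \<open>K1 \<inter> K2 = _\<close> have "K1 \<inter> K2 \<subseteq> {max (Inf K1) (Inf K2)}" by auto
      then have "\<phi> ` (K1 \<inter> K2) \<subseteq> {\<phi> (max (Inf K1) (Inf K2))}" by auto
      moreover have "J \<inter> J2 = \<phi> ` (K1 \<inter> K2)"
        using inj_on_image_Int[OF inj K(5)[OF K1(1)] K(5)[OF K2(1)]] K1(2) K2(2) by simp
      ultimately have "J \<inter> J2 \<subseteq> {\<phi> (max (Inf K1) (Inf K2))}" by simp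
      then have "interior (J \<inter> J2) \<subseteq> {}" using interior_mono interior_singleton by metis
      then show "interior J \<inter> interior J2 = {}" by simp
    qed
    moreover have "\<phi> ` S \<subseteq> {a..b}" using into D(2) by blast
    moreover have "(\<Sum>J\<in>D'. measure lborel J) < \<delta>"
    proof -
      have "(\<Sum>J\<in>D'. measure lborel J) = (\<Sum>K\<in>D. measure lborel (\<phi> ` K))"
        unfolding D'_def by (simp add: sum.reindex[OF injD])
      also have "\<dots> \<le> (\<Sum>K\<in>D. (\<bar>L\<bar> + 1) * measure lborel K)"
      proof (rule sum_mono)
        fix K assume "K \<in> D"
        from K'[OF this] show "measure lborel (\<phi> ` K) \<le> (\<bar>L\<bar> + 1) * measure lborel K"
          by (metis content_real)
      qed
      also have "\<dots> = (\<bar>L\<bar> + 1) * (\<Sum>K\<in>D. measure lborel K)" by (simp only: sum_distrib_left)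
      also have "\<dots> < \<delta>" using D(3) by (simp add: pos_less_divide_eq add_nonneg_pos mult.commute)
      finally show ?thesis .
    qed
    ultimately have "(\<Sum>J\<in>D'. norm (F (Sup J) - F (Inf J))) < e" using \<delta>(2) by blast
    moreover have "(\<Sum>J\<in>D'. norm (F (Sup J) - F (Inf J))) = (\<Sum>K\<in>D. norm (F (\<phi> (Sup K)) - F (\<phi> (Inf K))))"
      unfolding D'_def sum.reindex[OF injD] o_def by (rule sum.cong[OF refl K'(3)])
    ultimately show "(\<Sum>K\<in>D. norm (F (\<phi> (Sup K)) - F (\<phi> (Inf K)))) < e" by simp
  qed
qed

lemma abs_cont_on_reflect: "abs_cont_on a b F \<Longrightarrow> abs_cont_on a b (\<lambda>t. F (a + b - t))"
proof (rule abs_cont_on_compose_homeomorphism[where L = 1])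
  fix u v :: real
  have "(\<lambda>t. a + b - t) ` {u..v} = {a + b - v..a + b - u}" by (rule image_diff_atLeastAtMost)
  then show "(\<lambda>t. a + b - t) ` {u..v} = {a + b - u..a + b - v} \<or> (\<lambda>t. a + b - t) ` {u..v} = {a + b - v..a + b - u}" by blast
qed (auto simp: inj_on_def)

lemma absolutely_integrable_reflect_Icc:
  fixes f :: "real \<Rightarrow> 'a::euclidean_space"
  assumes "f absolutely_integrable_on {a..b}"
  shows "(\<lambda>x. f (a + b - x)) absolutely_integrable_on {a..b}"
proof -
  have *: "(\<lambda>x. g (a + b - x)) integrable_on {a..b}" if "g integrable_on {a..b}" for g :: "real \<Rightarrow> 'b::euclidean_space"
  proof -
    obtain I where "(g has_integral I) {a..b}" using \<open>g integrable_on _\<close> by blast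
    then have "((\<lambda>x. g (x + (a + b))) has_integral I) {a - (a + b)..b - (a + b)}" by (rule has_integral_shift_real_ivl)
    then have "((\<lambda>x. g (x + (a + b))) has_integral I) {- b..- a}" by simp
    then have "((\<lambda>x. g (- x + (a + b))) has_integral I) {a..b}" using has_integral_reflect_real[where f = "\<lambda>x. g (- x + (a + b))" and a = a and b = b and i = I] by simp
    then show ?thesis by (auto simp: algebra_simps)
  qed
  show ?thesis using assms *[of f] *[of "\<lambda>x. norm (f x)"] by (simp add: absolutely_integrable_on_def)
qed

section \<open>The du Bois-Reymond lemma\<close>

text \<open>\<open>flat 0\<close> is the classical smooth function exp(-1/x) for x > 0, extended by
  0. The powers of 1/x are there so that derivatives remain linear combinations of members of the
  family.\<close>

definition flat :: "nat \<Rightarrow> real \<Rightarrow> real" where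
  "flat i x = (if 0 < x then (1 / x) ^ i * exp (- (1 / x)) else 0)"

lemma power_le_fact_exp: "0 \<le> x \<Longrightarrow> x ^ n \<le> fact n * exp (x::real)"
proof -
  assume x: "0 \<le> x"
  have "(\<Sum>n\<in>{n}. inverse (fact n) * x ^ n) \<le> (\<Sum>n. inverse (fact n) * x ^ n)"
    by (rule sum_le_suminf[OF summable_exp]) (use x in auto)
  then have "inverse (fact n) * x ^ n \<le> exp x" by (simp add: exp_def)
  then show ?thesis by (simp add: field_simps)
qed

text \<open>At the argument 1/x, the exponential beats the power of degree \<open>i + 2\<close>:
  this absorbs the singular factor and leaves a square. Quadratic decay is what gives the derivative
  0 at the origin.\<close>

lemma flat_le_square: "\<bar>flat i x\<bar> \<le> fact (i + 2) * x\<^sup>2"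
proof (cases "0 < x")
  case True
  have "(1 / x) ^ i * (1 / x)\<^sup>2 \<le> fact (i + 2) * exp (1 / x)"
    unfolding power_add[symmetric] by (rule power_le_fact_exp) (use True in simp)
  then have le: "(1 / x) ^ i * (1 / x)\<^sup>2 * (x\<^sup>2 * exp (- (1 / x))) \<le> fact (i + 2) * exp (1 / x) * (x\<^sup>2 * exp (- (1 / x)))"
    by (rule mult_right_mono) simp
  have 1: "(1 / x)\<^sup>2 * x\<^sup>2 = 1" "exp (1 / x) * exp (- (1 / x)) = 1"
    using True by (simp_all add: power_divide flip: exp_add)
  have "(1 / x) ^ i * (1 / x)\<^sup>2 * (x\<^sup>2 * exp (- (1 / x))) = (1 / x) ^ i * ((1 / x)\<^sup>2 * x\<^sup>2) * exp (- (1 / x))"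
    by (simp only: mult.assoc)
  then have e1: "(1 / x) ^ i * (1 / x)\<^sup>2 * (x\<^sup>2 * exp (- (1 / x))) = (1 / x) ^ i * exp (- (1 / x))" unfolding 1 mult_1_right .
  have "fact (i + 2) * exp (1 / x) * (x\<^sup>2 * exp (- (1 / x))) = fact (i + 2) * x\<^sup>2 * (exp (1 / x) * exp (- (1 / x)))"
    by (simp only: mult_ac)
  then have e2: "fact (i + 2) * exp (1 / x) * (x\<^sup>2 * exp (- (1 / x))) = fact (i + 2) * x\<^sup>2" unfolding 1 mult_1_right .
  have "(1 / x) ^ i * exp (- (1 / x)) \<le> fact (i + 2) * x\<^sup>2" using le unfolding e1 e2 .
  then show ?thesis using True by (simp add: flat_def)
qed (simp add: flat_def)

lemma flat_derivative: "(flat i has_real_derivative flat (i + 2) x - real i * flat (i + 1) x) (at x)"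
proof (cases x "0::real" rule: linorder_cases)
  case less
  have "((\<lambda>x. 0) has_real_derivative 0) (at x)" by simp
  then have "(flat i has_real_derivative 0) (at x)"
    by (rule has_field_derivative_transform_within_open[where S = "{..<0}"]) (use less in \<open>auto simp: flat_def\<close>)
  then show ?thesis using less by (simp add: flat_def)
next
  case equal
  have "(flat i has_derivative (\<lambda>h. 0)) (at 0)"
    unfolding has_derivative_at_alt
  proof (intro conjI allI impI)
    fix e :: real assume "e > 0"
    show "\<exists>d>0. \<forall>y. norm (y - 0) < d \<longrightarrow> norm (flat i y - flat i 0 - 0) \<le> e * norm (y - 0)"
    proof (intro exI[of _ "e / fact (i + 2)"] conjI allI impI)
      show "e / fact (i + 2) > 0" using \<open>e > 0\<close> by simp
      fix y :: real assume y: "norm (y - 0) < e / fact (i + 2)"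
      have "norm (flat i y - flat i 0 - 0) \<le> fact (i + 2) * y\<^sup>2"
        using flat_le_square[of i y] by (simp add: flat_def)
      also have "\<dots> = (fact (i + 2) * \<bar>y\<bar>) * \<bar>y\<bar>" by (simp add: power2_eq_square)
      also have "\<dots> \<le> e * \<bar>y\<bar>"
      proof (rule mult_right_mono)
        have "\<bar>y\<bar> < e / fact (i + 2)" using y by simp
        then have "\<bar>y\<bar> * fact (i + 2) < e" by (subst (asm) pos_less_divide_eq) auto
        then show "fact (i + 2) * \<bar>y\<bar> \<le> e" by (simp only: mult.commute less_imp_le)
      qed simp
      finally show "norm (flat i y - flat i 0 - 0) \<le> e * norm (y - 0)" by simp
    qed
  qed simp
  moreover have "(*) (0::real) = (\<lambda>h. 0)" by auto
  ultimately show ?thesis using equal by (simp add: has_field_derivative_def flat_def)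
next
  case greater
  have "((\<lambda>x. (1 / x) ^ i * exp (- (1 / x))) has_real_derivative flat (i + 2) x - real i * flat (i + 1) x) (at x)"
    using greater by (auto intro!: derivative_eq_intros simp: flat_def power2_eq_square divide_simps; cases i; simp add: field_simps)
  then show ?thesis
    by (rule has_field_derivative_transform_within_open[where S = "{0<..}"]) (use greater in \<open>auto simp: flat_def\<close>)
qed

text \<open>\<open>smooth\<close> speaks of all iterated derivatives, and a class closed under
  differentiation settles them by one induction. Affine arguments sit in the base case because
  cut-offs need translation, scaling and reflection.\<close>

inductive flat_algebra :: "(real \<Rightarrow> complex) \<Rightarrow> bool" where
  flat: "flat_algebra (\<lambda>x. of_real (flat i (p * x + q)))"
| scale: "flat_algebra f \<Longrightarrow> flat_algebra (\<lambda>x. c * f x)"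
| add: "flat_algebra f \<Longrightarrow> flat_algebra g \<Longrightarrow> flat_algebra (\<lambda>x. f x + g x)"
| mult: "flat_algebra f \<Longrightarrow> flat_algebra g \<Longrightarrow> flat_algebra (\<lambda>x. f x * g x)"

lemma flat_algebra_derivative:
  "flat_algebra f \<Longrightarrow> \<exists>g. flat_algebra g \<and> (\<forall>x. (f has_vector_derivative g x) (at x))"
proof (induction rule: flat_algebra.induct)
  case (flat i p q)
  let ?g = "\<lambda>x. of_real p * of_real (flat (i + 2) (p * x + q)) + (- of_real (p * real i)) * of_real (flat (i + 1) (p * x + q)) :: complex"
  have "flat_algebra ?g" by (intro flat_algebra.intros)
  moreover have "((\<lambda>x. of_real (flat i (p * x + q))) has_vector_derivative ?g x) (at x)" for x
  proof -
    have "((\<lambda>x. flat i (p * x + q)) has_real_derivative (flat (i + 2) (p * x + q) - real i * flat (i + 1) (p * x + q)) * p) (at x)"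
      by (rule DERIV_chain2[OF flat_derivative]) (auto intro!: derivative_eq_intros)
    from has_vector_derivative_of_real[OF this, where 'a = complex] show ?thesis by (simp add: algebra_simps)
  qed
  ultimately show ?case by blast
next
  case (scale f c)
  then obtain g where "flat_algebra g" "\<And>x. (f has_vector_derivative g x) (at x)" by blast
  then show ?case by (intro exI[of _ "\<lambda>x. c * g x"]) (auto intro: flat_algebra.intros has_vector_derivative_mult_right)
next
  case (add f g)
  then obtain f' g' where *: "flat_algebra f'" "\<And>x. (f has_vector_derivative f' x) (at x)"
    "flat_algebra g'" "\<And>x. (g has_vector_derivative g' x) (at x)" by blast
  then show ?case by (intro exI[of _ "\<lambda>x. f' x + g' x"]) (auto intro: flat_algebra.intros has_vector_derivative_add)
next
  case (mult f g)
  then obtain f' g' where *: "flat_algebra f'" "\<And>x. (f has_vector_derivative f' x) (at x)"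
    "flat_algebra g'" "\<And>x. (g has_vector_derivative g' x) (at x)" by blast
  then show ?case
    by (intro exI[of _ "\<lambda>x. f x * g' x + f' x * g x"]) (auto intro!: flat_algebra.intros has_vector_derivative_mult mult.hyps)
qed

lemma flat_algebra_smooth:
  assumes "flat_algebra f"
  shows "smooth f"
proof -
  have step: "flat_algebra (\<lambda>x. vector_derivative f (at x))" if f: "flat_algebra f" for f
  proof -
    obtain g where g: "flat_algebra g" "\<And>x. (f has_vector_derivative g x) (at x)" using flat_algebra_derivative[OF f] by blast
    then have "(\<lambda>x. vector_derivative f (at x)) = g" by (auto intro: vector_derivative_at)
    with g show ?thesis by simp
  qed
  have "flat_algebra (((\<lambda>f x. vector_derivative f (at x)) ^^ n) f)" for n
    by (induction n) (use assms step in auto)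
  then show ?thesis unfolding smooth_def
    using flat_algebra_derivative by (meson differentiableI_vector)
qed

lemma smooth_antiderivative:
  assumes "smooth \<psi>" "\<And>x. (\<phi> has_vector_derivative \<psi> x) (at x)"
  shows "smooth \<phi>"
  unfolding smooth_def
proof (intro allI)
  fix n x
  have eq: "(\<lambda>x. vector_derivative \<phi> (at x)) = \<psi>" using assms(2) by (auto intro: vector_derivative_at)
  show "((\<lambda>f x. vector_derivative f (at x)) ^^ n) \<phi> differentiable (at x)"
  proof (cases n)
    case 0
    then show ?thesis using assms(2) by (auto intro: differentiableI_vector)
  next
    case (Suc m)
    then show ?thesis using assms(1) unfolding smooth_def by (simp add: funpow_Suc_right eq del: funpow.simps)
  qed
qed

definition bump :: "nat \<Rightarrow> real \<Rightarrow> real \<Rightarrow> real \<Rightarrow> real" where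
  "bump n c \<delta> x = flat 0 (real (Suc n) * (x - c)) * flat 0 (real (Suc n) * (c + \<delta> - x))"

lemma bump_bounds: "0 \<le> bump n c \<delta> x" "bump n c \<delta> x \<le> 1"
proof -
  have "0 \<le> flat 0 y" "flat 0 y \<le> 1" for y by (auto simp: flat_def)
  then show "0 \<le> bump n c \<delta> x" "bump n c \<delta> x \<le> 1" unfolding bump_def by (auto intro: mult_le_one)
qed

lemma bump_eq_0: "x \<notin> {c<..<c + \<delta>} \<Longrightarrow> bump n c \<delta> x = 0"
  by (auto simp: bump_def flat_def zero_less_mult_iff)

lemma bump_tendsto_1: "x \<in> {c<..<c + \<delta>} \<Longrightarrow> (\<lambda>n. bump n c \<delta> x) \<longlonglongrightarrow> 1"
proof -
  assume x: "x \<in> {c<..<c + \<delta>}"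
  have *: "(\<lambda>n. flat 0 (real (Suc n) * y)) \<longlonglongrightarrow> 1" if "y > 0" for y
  proof -
    have "(\<lambda>n. exp (- (inverse (real (Suc n)) * (1 / y)))) \<longlonglongrightarrow> exp (- (0 * (1 / y)))"
      by (intro tendsto_intros LIMSEQ_inverse_real_of_nat)
    moreover have "flat 0 (real (Suc n) * y) = exp (- (inverse (real (Suc n)) * (1 / y)))" for n
      using that by (simp add: flat_def divide_inverse)
    ultimately show ?thesis by simp
  qed
  have "(\<lambda>n. bump n c \<delta> x) \<longlonglongrightarrow> 1 * 1"
    unfolding bump_def by (intro tendsto_mult *) (use x in auto)
  then show ?thesis by simp
qed

lemma bump_smooth: "flat_algebra (\<lambda>x. of_real (bump n c \<delta> x))"
proof -
  have "flat_algebra (\<lambda>x. of_real (flat 0 (real (Suc n) * x + - (real (Suc n) * c))) *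
      of_real (flat 0 (- real (Suc n) * x + real (Suc n) * (c + \<delta>))))"
    by (intro flat_algebra.intros)
  then show ?thesis by (simp add: bump_def algebra_simps)
qed

lemma flat_algebra_continuous: "flat_algebra f \<Longrightarrow> continuous_on S f"
  using flat_algebra_derivative has_vector_derivative_continuous continuous_at_imp_continuous_on by metis

text \<open>The right-hand side is free of \<open>c\<close>. Hence the difference of two bumps of
  equal width has integral zero and a compactly supported primitive, which is how bumps produce test
  functions.\<close>

lemma bump_integral:
  assumes "a \<le> c" "c + \<delta> \<le> b" "\<delta> > 0"
  shows "((\<lambda>x. of_real (bump n c \<delta> x) :: complex) has_integral integral {0..\<delta>} (\<lambda>x. of_real (bump n 0 \<delta> x))) {a..b}"
proof -
  have "((\<lambda>x. of_real (bump n 0 \<delta> x) :: complex) has_integral integral {0..\<delta>} (\<lambda>x. of_real (bump n 0 \<delta> x))) {0..\<delta>}"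
    by (intro integrable_integral integrable_continuous_real flat_algebra_continuous[OF bump_smooth])
  then have "((\<lambda>x. of_real (bump n 0 \<delta> (x + - c)) :: complex) has_integral integral {0..\<delta>} (\<lambda>x. of_real (bump n 0 \<delta> x))) {0 - - c..\<delta> - - c}"
    by (rule has_integral_shift_real_ivl)
  moreover have "bump n 0 \<delta> (x + - c) = bump n c \<delta> x" for x by (simp add: bump_def algebra_simps)
  ultimately have "((\<lambda>x. of_real (bump n c \<delta> x) :: complex) has_integral integral {0..\<delta>} (\<lambda>x. of_real (bump n 0 \<delta> x))) {c..c + \<delta>}"
    by (simp add: add.commute)
  then show ?thesis
    by (rule has_integral_on_superset) (use assms bump_eq_0 in auto)
qed

text \<open>Testing against primitives of differences of translated bumps, which increase to indicator functions of intervals,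
  shows that integrals over translated intervals agree.\<close>

lemma du_bois_reymond_translate:
  fixes G :: "real \<Rightarrow> complex"
  assumes G: "G absolutely_integrable_on {a..b}"
    and test: "\<And>\<phi>. test_function a b \<phi> \<Longrightarrow> integral {a..b} (\<lambda>x. G x * vector_derivative \<phi> (at x)) = 0"
    and cd: "a < c" "c + \<delta> < b" "a < d" "d + \<delta> < b" "\<delta> > 0"
  shows "integral {c..c + \<delta>} G = integral {d..d + \<delta>} G"
proof -
  \<comment> \<open>A multiple by -1 is added instead of subtracting, to match the closure rules of
    \<open>flat_algebra\<close>.\<close>
  define \<psi> :: "nat \<Rightarrow> real \<Rightarrow> complex" where "\<psi> = (\<lambda>n x. of_real (bump n c \<delta> x) + (-1) * of_real (bump n d \<delta> x))"
  have alg: "flat_algebra (\<psi> n)" for n unfolding \<psi>_def by (intro flat_algebra.intros bump_smooth)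
  have \<psi>c: "continuous_on S (\<psi> n)" for n S by (rule flat_algebra_continuous[OF alg])
  \<comment> \<open>Between \<open>l\<close> and \<open>r\<close> lie the supports of both bumps.
    The primitive vanishes to the left of \<open>l\<close> trivially and to the right of
    \<open>r\<close> because the two integrals cancel.\<close>
  define l r where "l = min c d" and "r = max c d + \<delta>"
  have lr: "a < l" "r < b" "l \<le> c" "l \<le> d" "c + \<delta> \<le> r" "d + \<delta> \<le> r" "l \<le> r" using cd by (auto simp: l_def r_def)
  have \<psi>0: "\<psi> n x = 0" if "x \<notin> {l<..<r}" for n x
    using that lr bump_eq_0[of x c \<delta> n] bump_eq_0[of x d \<delta> n] by (auto simp: \<psi>_def)
  have \<psi>I: "integral {a..y} (\<psi> n) = 0" if "r \<le> y" for n y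
  proof -
    let ?J = "integral {0..\<delta>} (\<lambda>x. of_real (bump n 0 \<delta> x) :: complex)"
    have "(\<psi> n has_integral ?J + (-1) * ?J) {a..y}" unfolding \<psi>_def
      by (intro has_integral_add has_integral_mult_right bump_integral) (use lr cd that in auto)
    then show ?thesis by (simp add: integral_unique)
  qed
  define \<phi> where "\<phi> = (\<lambda>n x. integral {a..x} (\<psi> n))"
  have \<phi>0: "\<phi> n x = 0" if "x \<notin> {l..r}" for n x
  proof (cases "x \<ge> r")
    case True then show ?thesis by (simp add: \<phi>_def \<psi>I)
  next
    case False
    then have "x < l" using that by auto
    then have "integral {a..x} (\<psi> n) = integral {a..x} (\<lambda>x. 0)" by (intro integral_cong \<psi>0) auto
    then show ?thesis by (simp add: \<phi>_def)
  qed
  have der: "(\<phi> n has_vector_derivative \<psi> n x) (at x)" for n x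
  proof (cases "x < l")
    case True
    have "((\<lambda>_. 0) has_vector_derivative 0) (at x)" by simp
    then have "(\<phi> n has_vector_derivative 0) (at x)"
      by (rule has_vector_derivative_transform_within_open[where S = "{..<l}"]) (use True \<phi>0 in auto)
    then show ?thesis using \<psi>0[of x n] True by simp
  next
    case False
    have "(\<phi> n has_vector_derivative \<psi> n x) (at x within {a..x + 1})"
      unfolding \<phi>_def by (rule integral_has_vector_derivative[OF \<psi>c]) (use False lr in auto)
    moreover have "at x within {a..x + 1} = at x" using False lr by (intro at_within_Icc_at) auto
    ultimately show ?thesis by simp
  qed
  have "test_function a b (\<phi> n)" for n
    unfolding test_function_def
  proof (intro conjI exI[of _ "{l..r}"])
    show "smooth (\<phi> n)" by (rule smooth_antiderivative[OF flat_algebra_smooth[OF alg] der])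
  qed (use lr \<phi>0 in auto)
  from test[OF this] have zero: "integral {a..b} (\<lambda>x. G x * \<psi> n x) = 0" for n
    using vector_derivative_at[OF der] by simp
  let ?g = "\<lambda>x. (if x \<in> {c<..<c + \<delta>} then G x else 0) + (-1) * (if x \<in> {d<..<d + \<delta>} then G x else 0)"
  have "(\<lambda>n. integral {a..b} (\<lambda>x. G x * \<psi> n x)) \<longlonglongrightarrow> integral {a..b} ?g"
  proof (rule dominated_convergence(2)[where h = "\<lambda>x. 2 * norm (G x)"])
    show "(\<lambda>x. G x * \<psi> n x) integrable_on {a..b}" for n
      using absolutely_integrable_mult_continuous(1)[OF G \<psi>c] by (simp add: absolutely_integrable_on_def)
    show "(\<lambda>x. 2 * norm (G x)) integrable_on {a..b}" using G by (simp add: absolutely_integrable_on_def)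
    fix x
    show "norm (G x * \<psi> n x) \<le> 2 * norm (G x)" for n
    proof -
      have "\<psi> n x = of_real (bump n c \<delta> x - bump n d \<delta> x)" by (simp add: \<psi>_def)
      then have "norm (\<psi> n x) = \<bar>bump n c \<delta> x - bump n d \<delta> x\<bar>" by (simp only: norm_of_real)
      also have "\<dots> \<le> 2" using bump_bounds[of n c \<delta> x] bump_bounds[of n d \<delta> x] by linarith
      finally have "norm (G x) * norm (\<psi> n x) \<le> norm (G x) * 2" by (rule mult_left_mono) simp
      then show ?thesis by (simp add: norm_mult mult.commute)
    qed
    have *: "(\<lambda>n. of_real (bump n e \<delta> x) :: complex) \<longlonglongrightarrow> (if x \<in> {e<..<e + \<delta>} then 1 else 0)" for e
      using tendsto_of_real[OF bump_tendsto_1[of x e \<delta>], where 'a = complex] bump_eq_0[of x e \<delta>] by auto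
    have "(\<lambda>n. G x * \<psi> n x) \<longlonglongrightarrow> G x * ((if x \<in> {c<..<c + \<delta>} then 1 else 0) + (-1) * (if x \<in> {d<..<d + \<delta>} then 1 else 0))"
      unfolding \<psi>_def by (intro tendsto_intros *)
    then show "(\<lambda>n. G x * \<psi> n x) \<longlonglongrightarrow> ?g x" by (auto split: if_splits)
  qed
  then have "integral {a..b} ?g = 0" using LIMSEQ_unique[OF _ tendsto_const[of 0]] unfolding zero by blast
  moreover have I: "((\<lambda>x. if x \<in> {e<..<e + \<delta>} then G x else 0) has_integral integral {e..e + \<delta>} G) {a..b}"
    if "a < e" "e + \<delta> < b" for e
  proof -
    have "(G has_integral integral {e..e + \<delta>} G) {e..e + \<delta>}"
      by (intro integrable_integral absolutely_integrable_on_subinterval_integrable[OF G]) (use that in auto)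
    then have "(G has_integral integral {e..e + \<delta>} G) {e<..<e + \<delta>}"
      by (simp only: has_integral_Icc_iff_Ioo)
    moreover have "{e<..<e + \<delta>} \<subseteq> {a..b}" using that by auto
    ultimately show ?thesis by (subst has_integral_restrict)
  qed
  then have "(?g has_integral integral {c..c + \<delta>} G + (-1) * integral {d..d + \<delta>} G) {a..b}"
    using cd by (intro has_integral_add has_integral_mult_right) auto
  ultimately show ?thesis by (simp add: integral_unique)
qed

text \<open>The primitive \<Gamma> of \<open>G\<close> has equal increments over translated
  intervals. Differentiating these increments in their common length, at length 0 and at two points
  where \<Gamma> has derivative \<open>G\<close>, gives equal values of \<open>G\<close>.\<close>

theorem du_bois_reymond:
  fixes G :: "real \<Rightarrow> complex"
  assumes G: "G absolutely_integrable_on {a..b}"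
    and test: "\<And>\<phi>. test_function a b \<phi> \<Longrightarrow> integral {a..b} (\<lambda>x. G x * vector_derivative \<phi> (at x)) = 0"
  shows "\<exists>C N. negligible N \<and> (\<forall>x\<in>{a<..<b} - N. G x = C)"
proof -
  have Gi: "G integrable_on {a..b}" using G by (simp add: absolutely_integrable_on_def)
  define \<Gamma> where "\<Gamma> = (\<lambda>x. integral {a..x} G)"
  obtain N where N: "negligible N" "\<And>x. x \<in> {a<..<b} - N \<Longrightarrow> (\<Gamma> has_vector_derivative G x) (at x)"
    using indefinite_integral_has_vector_derivative_AE[OF Gi] unfolding \<Gamma>_def by blast
  have eq: "G c = G d" if c: "c \<in> {a<..<b} - N" and d: "d \<in> {a<..<b} - N" for c d
  proof -
    \<comment> \<open>Half the distance from the right-hand point to \<open>b\<close>, so that both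
      translated intervals stay inside the open interval.\<close>
    define \<eta> where "\<eta> = (b - max c d) / 2"
    have \<eta>: "\<eta> > 0" "c + \<eta> < b" "d + \<eta> < b" using c d by (auto simp: \<eta>_def field_simps max_def)
    have diff: "\<Gamma> (e + \<delta>) - \<Gamma> e = integral {e..e + \<delta>} G" if "0 \<le> \<delta>" "\<delta> \<le> \<eta>" "e \<in> {a<..<b}" "e + \<eta> < b" for e \<delta>
      unfolding \<Gamma>_def by (rule integral_diff_subinterval[OF Gi]) (use that in auto)
    have same: "\<Gamma> (d + \<delta>) - \<Gamma> d + \<Gamma> c = \<Gamma> (c + \<delta>)" if "\<delta> \<in> {0..\<eta>}" for \<delta>
    proof (cases "\<delta> = 0")
      case False
      then have "integral {c..c + \<delta>} G = integral {d..d + \<delta>} G"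
        by (intro du_bois_reymond_translate[OF G test]) (use that c d \<eta> in auto)
      then show ?thesis using diff[of \<delta> c] diff[of \<delta> d] that c d \<eta> by (auto simp: algebra_simps)
    qed simp
    have der: "((\<lambda>\<delta>. \<Gamma> (e + \<delta>)) has_vector_derivative G e) (at 0 within {0..\<eta>})" if "e \<in> {a<..<b} - N" for e
    proof -
      have "((\<lambda>\<delta>. \<Gamma> (e + \<delta>)) has_vector_derivative 1 *\<^sub>R G (e + 0)) (at 0)"
      proof -
        have 1: "((\<lambda>\<delta>. e + \<delta>) has_vector_derivative 0 + 1) (at 0)"
          by (intro has_vector_derivative_add has_vector_derivative_const has_vector_derivative_id)
        have 2: "(\<Gamma> has_vector_derivative G (e + 0)) (at (e + 0))" using N(2)[OF that] by simp
        from vector_diff_chain_at[OF 1 2] show ?thesis by (simp add: o_def)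
      qed
      then show ?thesis by (simp add: has_vector_derivative_at_within)
    qed
    have "((\<lambda>\<delta>. \<Gamma> (d + \<delta>) - \<Gamma> d + \<Gamma> c) has_vector_derivative G d - 0 + 0) (at 0 within {0..\<eta>})"
      by (intro has_vector_derivative_add has_vector_derivative_diff has_vector_derivative_const der[OF d])
    then have "((\<lambda>\<delta>. \<Gamma> (d + \<delta>) - \<Gamma> d + \<Gamma> c) has_vector_derivative G d) (at 0 within {0..\<eta>})" by simp
    then have "((\<lambda>\<delta>. \<Gamma> (c + \<delta>)) has_vector_derivative G d) (at 0 within {0..\<eta>})"
      by (rule has_vector_derivative_transform[rotated 2]) (use same \<eta> in auto)
    from vector_derivative_unique_within[OF _ der[OF c] this] show "G c = G d"
      using \<eta>(1) by (simp add: trivial_limit_within islimpt_Icc)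
  qed
  show ?thesis
  proof (cases "{a<..<b} - N = {}")
    case True
    then have "\<forall>x\<in>{a<..<b} - N. G x = 0" by blast
    with N(1) show ?thesis by blast
  next
    case False
    then obtain d where "d \<in> {a<..<b} - N" by blast
    then have "\<forall>x\<in>{a<..<b} - N. G x = G d" using eq by blast
    with N(1) show ?thesis by blast
  qed
qed

section \<open>The equation in the variable x\<close>

lemma L2_on_absolutely_integrable:
  assumes "L2_on a b u"
  shows "u absolutely_integrable_on {a..b}" "(\<lambda>x. (u x)\<^sup>2) absolutely_integrable_on {a..b}"
proof -
  have m: "u \<in> borel_measurable (lebesgue_on {a..b})" and i: "(\<lambda>x. (cmod (u x))\<^sup>2) integrable_on {a..b}"
    using assms by (auto simp: L2_on_def absolutely_integrable_on_def)
  show "u absolutely_integrable_on {a..b}"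
  proof (rule measurable_bounded_by_integrable_imp_absolutely_integrable[OF m])
    show "(\<lambda>x. 1 + (cmod (u x))\<^sup>2) integrable_on {a..b}" by (intro integrable_add i integrable_const_ivl)
    show "norm (u x) \<le> 1 + (cmod (u x))\<^sup>2" for x
    proof -
      have "2 * cmod (u x) \<le> (cmod (u x))\<^sup>2 + 1" using zero_le_power2[of "cmod (u x) - 1"] unfolding power2_diff by simp
      then show ?thesis using norm_ge_zero[of "u x"] by linarith
    qed
  qed simp
  have m2: "(\<lambda>x. (u x)\<^sup>2) \<in> borel_measurable (lebesgue_on {a..b})" using m by measurable
  show "(\<lambda>x. (u x)\<^sup>2) absolutely_integrable_on {a..b}"
    by (rule measurable_bounded_by_integrable_imp_absolutely_integrable[OF m2 _ i]) (auto simp: norm_power)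
qed

lemma abs_cont_on_real_deriv:
  fixes F :: "real \<Rightarrow> real"
  assumes ac: "abs_cont_on a b F" and "a \<le> b"
  obtains N where "negligible N" "\<And>x. x \<in> {a<..<b} - N \<Longrightarrow> (F has_real_derivative deriv F x) (at x)"
    "deriv F absolutely_integrable_on {a..b}"
proof -
  obtain w N where N: "negligible N" "\<And>x. x \<in> {a<..<b} - N \<Longrightarrow> (F has_vector_derivative w x) (at x)"
    using abs_cont_on_AE_derivative[OF assms] by metis
  have d: "(F has_real_derivative deriv F x) (at x)" if "x \<in> {a<..<b} - N" for x
    using N(2)[OF that] DERIV_imp_deriv by (metis has_real_derivative_iff_has_vector_derivative)
  have "(F has_vector_derivative deriv F x) (at x)" if "x \<in> {a<..<b} - N" for x
    using d[OF that] by (simp add: has_real_derivative_iff_has_vector_derivative)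
  from abs_cont_on_integral_of_derivative(1)[OF ac N(1) this] show ?thesis using that[OF N(1) d] by blast
qed

lemma abs_cont_on_of_real: "abs_cont_on a b F \<Longrightarrow> abs_cont_on a b (\<lambda>x. of_real (F x) :: complex)"
  by (rule abs_cont_on_linear[OF _ bounded_linear_of_real])

lemma absolutely_integrable_of_real:
  fixes f :: "real \<Rightarrow> real"
  assumes "f absolutely_integrable_on S"
  shows "(\<lambda>x. of_real (f x) :: complex) absolutely_integrable_on S"
  using absolutely_integrable_linear[OF assms bounded_linear_of_real[where 'a = complex]] by (simp add: o_def)

lemma test_function_props:
  assumes "test_function a b \<phi>"
  shows "\<phi> a = 0" "\<phi> b = 0" "\<And>x. (\<phi> has_vector_derivative vector_derivative \<phi> (at x)) (at x)"
    "continuous_on S (\<lambda>x. vector_derivative \<phi> (at x))" "continuous_on S \<phi>"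
proof -
  let ?D = "\<lambda>f x. vector_derivative f (at x) :: complex"
  obtain K where K: "K \<subseteq> {a<..<b}" "\<And>x. x \<notin> K \<Longrightarrow> \<phi> x = 0" and s: "\<And>n x. (?D ^^ n) \<phi> differentiable (at x)"
    using assms unfolding test_function_def smooth_def by blast
  have "a \<notin> K" "b \<notin> K" using K(1) by auto
  then show "\<phi> a = 0" "\<phi> b = 0" using K(2) by blast+
  have 0: "\<phi> differentiable (at x)" for x using s[of 0 x] by simp
  have 1: "?D \<phi> differentiable (at x)" for x using s[of 1 x] by simp
  show "(\<phi> has_vector_derivative vector_derivative \<phi> (at x)) (at x)" for x
    using 0[of x] by (simp add: vector_derivative_works)
  show "continuous_on S (\<lambda>x. vector_derivative \<phi> (at x))" "continuous_on S \<phi>"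
    using 0 1 by (auto intro!: continuous_at_imp_continuous_on differentiable_imp_continuous_within)
qed

locale sturm_liouville =
  fixes a b :: real and r \<rho> :: "real \<Rightarrow> real" and p u h :: "real \<Rightarrow> complex"
  assumes ab: "a < b"
    and r0: "\<And>x. x \<in> {a..b} \<Longrightarrow> r x > 0" and \<rho>0: "\<And>x. x \<in> {a..b} \<Longrightarrow> \<rho> x > 0"
    and r: "abs_cont_on a b r" and \<rho>: "abs_cont_on a b \<rho>"
    and p: "p absolutely_integrable_on {a..b}"
    and u: "L2_on a b u"
    and \<rho>'u: "(\<lambda>x. of_real (deriv \<rho> x) * u x) absolutely_integrable_on {a..b}"
    and r'u: "(\<lambda>x. of_real (deriv r x) * u x) absolutely_integrable_on {a..b}"
    and pu: "(\<lambda>x. p x * u x) absolutely_integrable_on {a..b}"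
    and h: "L2_on a b h"
    and hu: "distr_antideriv a b h (leibniz_product a b (\<lambda>x. 1 / (r x * \<rho> x)) u)"
begin

lemma rc: "continuous_on {a..b} r" and \<rho>c: "continuous_on {a..b} \<rho>"
  using r \<rho> by (auto intro: abs_cont_on_imp_continuous_on)

lemma rn0: "x \<in> {a..b} \<Longrightarrow> r x \<noteq> 0" and \<rho>n0: "x \<in> {a..b} \<Longrightarrow> \<rho> x \<noteq> 0"
  using r0[of x] \<rho>0[of x] by auto

definition Ft :: "real \<Rightarrow> complex" where
  "Ft x = - of_real (deriv \<rho> x / \<rho> x) - of_real (deriv r x / r x) + p x / of_real ((r x)\<^sup>2)"

definition \<kappa> :: "real \<Rightarrow> real" where "\<kappa> x = \<rho> x / r x"
definition \<alpha> :: "real \<Rightarrow> complex" where "\<alpha> x = of_real (\<kappa> x) * h x - Ft x / 2"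
definition \<gamma> :: "real \<Rightarrow> complex" where "\<gamma> x = Ft x * h x - of_real (\<kappa> x) * (h x)\<^sup>2"

lemma coefficients_differentiable:
  obtains N where "negligible N"
    "\<And>x. x \<in> {a<..<b} - N \<Longrightarrow> (r has_real_derivative deriv r x) (at x)"
    "\<And>x. x \<in> {a<..<b} - N \<Longrightarrow> (\<rho> has_real_derivative deriv \<rho> x) (at x)"
proof -
  obtain N1 where N1: "negligible N1" "\<And>x. x \<in> {a<..<b} - N1 \<Longrightarrow> (r has_real_derivative deriv r x) (at x)"
    using abs_cont_on_real_deriv[OF r less_imp_le[OF ab]] by metis
  obtain N2 where N2: "negligible N2" "\<And>x. x \<in> {a<..<b} - N2 \<Longrightarrow> (\<rho> has_real_derivative deriv \<rho> x) (at x)"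
    using abs_cont_on_real_deriv[OF \<rho> less_imp_le[OF ab]] by metis
  show ?thesis using that[of "N1 \<union> N2"] N1 N2 by auto
qed

lemma deriv_integrable: "(\<lambda>x. of_real (deriv r x) :: complex) absolutely_integrable_on {a..b}"
  "(\<lambda>x. of_real (deriv \<rho> x) :: complex) absolutely_integrable_on {a..b}"
  using abs_cont_on_real_deriv[OF r less_imp_le[OF ab]] abs_cont_on_real_deriv[OF \<rho> less_imp_le[OF ab]]
  by (metis absolutely_integrable_of_real)+

lemma inv_integrable:
  fixes f :: "real \<Rightarrow> complex"
  assumes "f absolutely_integrable_on {a..b}"
  shows "(\<lambda>x. f x / of_real (r x)) absolutely_integrable_on {a..b}" "(\<lambda>x. f x / of_real (\<rho> x)) absolutely_integrable_on {a..b}"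
proof -
  have "(\<lambda>x. f x * (1 / of_real (r x))) absolutely_integrable_on {a..b}"
    "(\<lambda>x. f x * (1 / of_real (\<rho> x))) absolutely_integrable_on {a..b}"
    by (intro absolutely_integrable_mult_continuous(1) assms continuous_intros rc \<rho>c; use rn0 \<rho>n0 in force)+
  then show "(\<lambda>x. f x / of_real (r x)) absolutely_integrable_on {a..b}" "(\<lambda>x. f x / of_real (\<rho> x)) absolutely_integrable_on {a..b}"
    by simp_all
qed

text \<open>The factors 1/r and 1/\<rho> are continuous, so only the three products with \<rho>', r'
  and p matter. Applied with \<open>v = 1\<close> and with \<open>v = h\<close>.\<close>

lemma Ft_mult_integrable:
  assumes "(\<lambda>x. of_real (deriv \<rho> x) * v x) absolutely_integrable_on {a..b}"
    "(\<lambda>x. of_real (deriv r x) * v x) absolutely_integrable_on {a..b}"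
    "(\<lambda>x. p x * v x) absolutely_integrable_on {a..b}"
  shows "(\<lambda>x. Ft x * v x) absolutely_integrable_on {a..b}"
proof -
  have "(\<lambda>x. p x * v x / of_real (r x) / of_real (r x) - of_real (deriv \<rho> x) * v x / of_real (\<rho> x)
     - of_real (deriv r x) * v x / of_real (r x)) absolutely_integrable_on {a..b}"
    by (intro set_integral_diff(1) inv_integrable assms)
  moreover have "p x * v x / of_real (r x) / of_real (r x) - of_real (deriv \<rho> x) * v x / of_real (\<rho> x)
     - of_real (deriv r x) * v x / of_real (r x) = Ft x * v x" for x
    by (simp add: Ft_def power2_eq_square algebra_simps)
  ultimately show ?thesis by simp
qed

lemma Ft_integrable: "Ft absolutely_integrable_on {a..b}"
  using Ft_mult_integrable[of "\<lambda>_. 1"] deriv_integrable p by simp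

text \<open>With m = 1/(r \<rho>), the Leibniz product is the distributional derivative of m u minus
  the indefinite integral of m' u, so \<open>h\<close> differs from that function by a constant
  almost everywhere. The continuous part of the conclusion is this constant minus the indefinite
  integral.\<close>

lemma antiderivative_representation:
  obtains V N where "continuous_on {a..b} V" "negligible N"
    "\<And>x. x \<in> {a<..<b} - N \<Longrightarrow> h x = of_real (1 / (r x * \<rho> x)) * u x + V x"
proof -
  define m where "m = (\<lambda>x. 1 / (r x * \<rho> x))"
  obtain N where N: "negligible N"
    "\<And>x. x \<in> {a<..<b} - N \<Longrightarrow> (r has_real_derivative deriv r x) (at x)"
    "\<And>x. x \<in> {a<..<b} - N \<Longrightarrow> (\<rho> has_real_derivative deriv \<rho> x) (at x)"
    using coefficients_differentiable by blast
  have ui: "u absolutely_integrable_on {a..b}" and hi: "h absolutely_integrable_on {a..b}"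
    using L2_on_absolutely_integrable(1) u h by auto
  have mc: "continuous_on {a..b} (\<lambda>x. of_real (m x) :: complex)"
    unfolding m_def by (intro continuous_intros rc \<rho>c) (use rn0 \<rho>n0 in force)
  define q where "q = (\<lambda>x. of_real (deriv m x) * u x)"
  \<comment> \<open>Off a null set m' can be expanded, which expresses \<open>q\<close> through r' u
    and \<rho>' u with continuous factors.\<close>
  have q: "q absolutely_integrable_on {a..b}"
  proof (rule absolutely_integrable_spike)
    show "(\<lambda>x. - (of_real (deriv r x) * u x / of_real (r x) / of_real (r x) / of_real (\<rho> x)
       + of_real (deriv \<rho> x) * u x / of_real (\<rho> x) / of_real (\<rho> x) / of_real (r x))) absolutely_integrable_on {a..b}"
      (is "?q absolutely_integrable_on _")
    proof -
      have "(\<lambda>x. 0 - (of_real (deriv r x) * u x / of_real (r x) / of_real (r x) / of_real (\<rho> x)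
       + of_real (deriv \<rho> x) * u x / of_real (\<rho> x) / of_real (\<rho> x) / of_real (r x))) absolutely_integrable_on {a..b}"
        by (intro set_integral_diff(1) set_integral_add(1) inv_integrable r'u \<rho>'u absolutely_integrable_zero)
      then show ?thesis by simp
    qed
    show "negligible (N \<union> {a, b})" using N(1) by simp
    fix x assume x: "x \<in> {a..b} - (N \<union> {a, b})"
    then have x': "x \<in> {a<..<b} - N" "x \<in> {a..b}" by auto
    have "(m has_real_derivative - (deriv r x * \<rho> x + r x * deriv \<rho> x) / (r x * \<rho> x)\<^sup>2) (at x)"
      unfolding m_def using rn0[OF x'(2)] \<rho>n0[OF x'(2)]
      by (auto intro!: derivative_eq_intros N(2,3) x'(1) simp: power2_eq_square)
    then have m': "deriv m x = - (deriv r x * \<rho> x + r x * deriv \<rho> x) / (r x * \<rho> x)\<^sup>2" by (rule DERIV_imp_deriv)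
    show "q x = ?q x" unfolding q_def m' using rn0[OF x'(2)] \<rho>n0[OF x'(2)]
      by (simp add: power2_eq_square field_simps)
  qed
  define V where "V = (\<lambda>x. integral {a..x} q)"
  have Vac: "abs_cont_on a b V" unfolding V_def by (rule abs_cont_on_integral[OF q])
  have Vc: "continuous_on {a..b} V" by (rule abs_cont_on_imp_continuous_on[OF Vac])
  have qi: "q integrable_on {a..b}" using q by (simp add: absolutely_integrable_on_def)
  obtain N2 where N2: "negligible N2" "\<And>x. x \<in> {a<..<b} - N2 \<Longrightarrow> (V has_vector_derivative q x) (at x)"
    using indefinite_integral_has_vector_derivative_AE[OF qi] unfolding V_def by blast
  define G where "G = (\<lambda>x. h x - of_real (m x) * u x + V x)"
  have mu: "(\<lambda>x. of_real (m x) * u x) absolutely_integrable_on {a..b}"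
    by (rule absolutely_integrable_mult_continuous(2)[OF ui mc])
  have G: "G absolutely_integrable_on {a..b}" unfolding G_def
    by (intro set_integral_diff(1) set_integral_add(1) hi mu absolutely_integrable_continuous_real Vc)
  have test: "integral {a..b} (\<lambda>x. G x * vector_derivative \<phi> (at x)) = 0" if \<phi>: "test_function a b \<phi>" for \<phi>
  proof -
    define \<phi>' where "\<phi>' = (\<lambda>x. vector_derivative \<phi> (at x))"
    note tp = test_function_props[OF \<phi>, folded \<phi>'_def]
    have \<phi>d: "(\<phi> has_vector_derivative \<phi>' x) (at x)" for x
      unfolding \<phi>'_def by (rule test_function_props(3)[OF \<phi>])
    have \<phi>'i: "\<phi>' absolutely_integrable_on {a..b}" by (rule absolutely_integrable_continuous_real[OF tp(4)])
    have i: "(\<lambda>x. f x * \<phi>' x) integrable_on {a..b}" if "f absolutely_integrable_on {a..b}" for f :: "real \<Rightarrow> complex"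
      using absolutely_integrable_mult_continuous(1)[OF that tp(4)] by (simp add: absolutely_integrable_on_def)
    have \<phi>ac: "abs_cont_on a b \<phi>"
    proof (rule abs_cont_on_cong[OF abs_cont_on_integral[OF \<phi>'i]])
      fix x assume x: "x \<in> {a..b}"
      have "(\<phi>' has_integral \<phi> x - \<phi> a) {a..x}"
        by (rule fundamental_theorem_of_calculus) (use x \<phi>d in \<open>auto intro: has_vector_derivative_at_within\<close>)
      then show "integral {a..x} \<phi>' = \<phi> x" using tp(1) by (simp add: integral_unique)
    qed
    \<comment> \<open>Integration by parts; the boundary terms vanish because a test function is
      zero at both ends.\<close>
    have "V b * \<phi> b - V a * \<phi> a = integral {a..b} (\<lambda>x. V x * \<phi>' x + q x * \<phi> x)"
    proof (rule abs_cont_on_integral_of_derivative(2)[OF abs_cont_on_mult[OF Vac \<phi>ac] N2(1)])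
      show "((\<lambda>x. V x * \<phi> x) has_vector_derivative V x * \<phi>' x + q x * \<phi> x) (at x)" if "x \<in> {a<..<b} - N2" for x
        by (rule has_vector_derivative_mult[OF N2(2)[OF that] \<phi>d])
    qed (use ab in auto)
    also have "\<dots> = integral {a..b} (\<lambda>x. V x * \<phi>' x) + integral {a..b} (\<lambda>x. q x * \<phi> x)"
      using absolutely_integrable_mult_continuous(1)[OF q tp(5)]
      by (intro integral_add i absolutely_integrable_continuous_real Vc) (simp add: absolutely_integrable_on_def)
    finally have V\<phi>: "integral {a..b} (\<lambda>x. V x * \<phi>' x) = - integral {a..b} (\<lambda>x. q x * \<phi> x)"
      using tp(1,2) by (simp add: eq_neg_iff_add_eq_0)
    have "leibniz_product a b m u \<phi> = distr_deriv a b h \<phi>"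
      using hu \<phi> unfolding distr_antideriv_def m_def by blast
    then have eq: "- integral {a..b} (\<lambda>x. of_real (m x) * u x * \<phi>' x) - integral {a..b} (\<lambda>x. q x * \<phi> x) = - integral {a..b} (\<lambda>x. h x * \<phi>' x)"
      unfolding leibniz_product_def distr_deriv_def q_def \<phi>'_def .
    have "integral {a..b} (\<lambda>x. G x * \<phi>' x) = integral {a..b} (\<lambda>x. h x * \<phi>' x - of_real (m x) * u x * \<phi>' x + V x * \<phi>' x)"
      by (simp add: G_def algebra_simps)
    also have "\<dots> = integral {a..b} (\<lambda>x. h x * \<phi>' x) - integral {a..b} (\<lambda>x. of_real (m x) * u x * \<phi>' x) + integral {a..b} (\<lambda>x. V x * \<phi>' x)"
      using i[OF hi] i[OF mu] i[OF absolutely_integrable_continuous_real[OF Vc]]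
      by (simp only: integral_add integral_diff integrable_diff)
    also have "\<dots> = 0" unfolding V\<phi> using eq by (simp add: algebra_simps)
    finally show ?thesis unfolding \<phi>'_def .
  qed
  have "\<exists>C M. negligible M \<and> (\<forall>x\<in>{a<..<b} - M. G x = C)" by (rule du_bois_reymond[OF G test])
  then obtain C M where M: "negligible M" "\<forall>x\<in>{a<..<b} - M. G x = C" by blast
  show ?thesis
  proof (rule that[of "\<lambda>x. C - V x" M])
    show "continuous_on {a..b} (\<lambda>x. C - V x)" by (intro continuous_intros Vc)
    show "h x = of_real (1 / (r x * \<rho> x)) * u x + (C - V x)" if "x \<in> {a<..<b} - M" for x
      using bspec[OF M(2) that] by (simp add: G_def m_def algebra_simps)
  qed (rule M(1))
qed

text \<open>Almost everywhere \<open>h\<close> is a continuous multiple of \<open>u\<close> plus a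
  continuous function. This carries the hypotheses on r' u, \<rho>' u and p u over to
  \<open>h\<close>, and so makes \<gamma> integrable.\<close>

lemma mult_h_integrable:
  fixes f :: "real \<Rightarrow> complex"
  assumes f: "f absolutely_integrable_on {a..b}" and fu: "(\<lambda>x. f x * u x) absolutely_integrable_on {a..b}"
  shows "(\<lambda>x. f x * h x) absolutely_integrable_on {a..b}"
proof -
  obtain V N where V: "continuous_on {a..b} V" and N: "negligible N"
    "\<And>x. x \<in> {a<..<b} - N \<Longrightarrow> h x = of_real (1 / (r x * \<rho> x)) * u x + V x"
    using antiderivative_representation by blast
  show ?thesis
  proof (rule absolutely_integrable_spike)
    show "(\<lambda>x. f x * u x / of_real (r x) / of_real (\<rho> x) + f x * V x) absolutely_integrable_on {a..b}"
      by (intro set_integral_add(1) inv_integrable fu absolutely_integrable_mult_continuous(1) f V)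
    show "negligible (N \<union> {a, b})" using N(1) by simp
    show "f x * h x = f x * u x / of_real (r x) / of_real (\<rho> x) + f x * V x" if "x \<in> {a..b} - (N \<union> {a, b})" for x
      using N(2)[of x] that by (simp add: algebra_simps)
  qed
qed

lemma Ft_h_integrable: "(\<lambda>x. Ft x * h x) absolutely_integrable_on {a..b}"
  by (intro Ft_mult_integrable mult_h_integrable deriv_integrable p \<rho>'u r'u pu)

lemma \<kappa>c: "continuous_on {a..b} \<kappa>"
  unfolding \<kappa>_def by (intro continuous_intros rc \<rho>c) (use rn0 in auto)

lemma \<kappa>0: "x \<in> {a..b} \<Longrightarrow> 0 < \<kappa> x"
  unfolding \<kappa>_def by (intro divide_pos_pos r0 \<rho>0)

lemma \<alpha>_integrable: "\<alpha> absolutely_integrable_on {a..b}"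
  unfolding \<alpha>_def
  by (intro set_integral_diff(1) absolutely_integrable_mult_continuous(2) L2_on_absolutely_integrable(1)[OF h]
      set_integrable_divide Ft_integrable continuous_intros \<kappa>c)

lemma \<gamma>_integrable: "\<gamma> absolutely_integrable_on {a..b}"
  unfolding \<gamma>_def
  by (intro set_integral_diff(1) absolutely_integrable_mult_continuous(2) L2_on_absolutely_integrable(2)[OF h]
      Ft_h_integrable continuous_intros \<kappa>c)

definition E :: "real \<Rightarrow> complex" where
  "E x = of_real (1 / sqrt (r x * \<rho> x)) * exp (1/2 * integral {a..x} (\<lambda>\<tau>. p \<tau> / of_real ((r \<tau>)\<^sup>2)))"

text \<open>Written as a single exponential, of half the integral of p/r^2 minus half of ln(r
  \<rho>), \<open>E\<close> shows both its absolute continuity and its logarithmic derivative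
  \<open>Ft / 2\<close>. The logarithm is Lipschitz on the range of r \<rho>, whose minimum is
  positive.\<close>

lemma E_props:
  shows "abs_cont_on a b E"
    "\<exists>N. negligible N \<and> (\<forall>x \<in> {a<..<b} - N. (E has_vector_derivative Ft x / 2 * E x) (at x))"
proof -
  define I where "I = (\<lambda>x. integral {a..x} (\<lambda>\<tau>. p \<tau> / of_real ((r \<tau>)\<^sup>2)))"
  have pr: "(\<lambda>\<tau>. p \<tau> / of_real ((r \<tau>)\<^sup>2)) absolutely_integrable_on {a..b}"
    using inv_integrable(1)[OF inv_integrable(1)[OF p]] by (simp add: power2_eq_square)
  then have pri: "(\<lambda>\<tau>. p \<tau> / of_real ((r \<tau>)\<^sup>2)) integrable_on {a..b}" by (simp add: absolutely_integrable_on_def)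
  have Iac: "abs_cont_on a b I" unfolding I_def by (rule abs_cont_on_integral[OF pr])
  obtain N1 where N1: "negligible N1" "\<And>x. x \<in> {a<..<b} - N1 \<Longrightarrow> (I has_vector_derivative p x / of_real ((r x)\<^sup>2)) (at x)"
    using indefinite_integral_has_vector_derivative_AE[OF pri] unfolding I_def by blast
  define w where "w = (\<lambda>x. r x * \<rho> x)"
  have w0: "w x > 0" if "x \<in> {a..b}" for x using r0[OF that] \<rho>0[OF that] by (simp add: w_def)
  have wac: "abs_cont_on a b w" unfolding w_def by (intro abs_cont_on_mult r \<rho>)
  have wc: "continuous_on {a..b} w" by (rule abs_cont_on_imp_continuous_on[OF wac])
  have "{a..b} \<noteq> {}" using ab by auto
  then obtain x0 where x0: "x0 \<in> {a..b}" "\<And>x. x \<in> {a..b} \<Longrightarrow> w x0 \<le> w x"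
    using continuous_attains_inf[OF compact_Icc _ wc] by blast
  have lnac: "abs_cont_on a b (\<lambda>x. ln (w x))"
  proof (rule abs_cont_on_lipschitz_compose[OF wac, where C = "1 / w x0"])
    have *: "ln s - ln t \<le> 1 / w x0 * \<bar>s - t\<bar>" if "w x0 \<le> s" "w x0 \<le> t" for s t
    proof -
      have pos: "s > 0" "t > 0" using that w0[OF x0(1)] by auto
      then have "ln s - ln t \<le> s / t - 1" using ln_le_minus_one[of "s / t"] by (simp add: ln_div)
      also have "\<dots> = (s - t) / t" using pos by (simp add: field_simps)
      also have "\<dots> \<le> \<bar>s - t\<bar> / t" using pos by (intro divide_right_mono) auto
      also have "\<dots> \<le> \<bar>s - t\<bar> / w x0" using that w0[OF x0(1)] by (intro divide_left_mono mult_pos_pos pos) auto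
      finally show ?thesis by simp
    qed
    show "norm (ln (w y) - ln (w x)) \<le> 1 / w x0 * norm (w y - w x)" if "x \<in> {a..b}" "y \<in> {a..b}" for x y
      using *[of "w x" "w y"] *[of "w y" "w x"] x0(2)[OF that(1)] x0(2)[OF that(2)]
      by (simp add: abs_le_iff abs_minus_commute)
  qed
  have Eeq: "E x = exp (1/2 * I x + of_real (- 1/2 * ln (w x)))" if "x \<in> {a..b}" for x
  proof -
    have "1 / sqrt (w x) = exp (- 1/2 * ln (w x))"
      using w0[OF that] by (simp add: exp_minus inverse_eq_divide ln_sqrt[symmetric] del: ln_sqrt)
    moreover have "E x = of_real (1 / sqrt (w x)) * exp (1/2 * I x)" by (simp add: E_def I_def w_def)
    ultimately show ?thesis unfolding exp_add exp_of_real by (simp only: mult.commute)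
  qed
  have Eac: "abs_cont_on a b (\<lambda>x. exp (1/2 * I x + of_real (- 1/2 * ln (w x))))"
    by (intro abs_cont_on_exp abs_cont_on_add abs_cont_on_linear[OF Iac bounded_linear_mult_right]
        abs_cont_on_of_real abs_cont_on_linear[OF lnac bounded_linear_mult_right])
  show "abs_cont_on a b E" by (rule abs_cont_on_cong[OF Eac]) (simp add: Eeq)
  obtain N where N: "negligible N"
    "\<And>x. x \<in> {a<..<b} - N \<Longrightarrow> (r has_real_derivative deriv r x) (at x)"
    "\<And>x. x \<in> {a<..<b} - N \<Longrightarrow> (\<rho> has_real_derivative deriv \<rho> x) (at x)"
    using coefficients_differentiable by blast
  show "\<exists>N. negligible N \<and> (\<forall>x \<in> {a<..<b} - N. (E has_vector_derivative Ft x / 2 * E x) (at x))"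
  proof (intro exI[of _ "N \<union> N1"] conjI ballI)
    show "negligible (N \<union> N1)" using N(1) N1(1) by simp
    fix x assume x: "x \<in> {a<..<b} - (N \<union> N1)"
    then have x': "x \<in> {a<..<b} - N" "x \<in> {a<..<b} - N1" "x \<in> {a..b}" "x \<in> {a<..<b}" by auto
    have n0: "r x \<noteq> 0" "\<rho> x \<noteq> 0" using rn0 \<rho>n0 x'(3) by auto
    have ln': "((\<lambda>x. - 1/2 * ln (w x)) has_real_derivative - 1/2 * (deriv r x / r x + deriv \<rho> x / \<rho> x)) (at x)"
      using w0[OF x'(3)] n0 unfolding w_def
      by (auto intro!: derivative_eq_intros N(2,3) x'(1) simp: field_simps)
    have d1: "((\<lambda>x. exp (1/2 * I x + of_real (- 1/2 * ln (w x)))) has_vector_derivative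
        exp (1/2 * I x + of_real (- 1/2 * ln (w x))) *
        (1/2 * (p x / of_real ((r x)\<^sup>2)) + of_real (- 1/2 * (deriv r x / r x + deriv \<rho> x / \<rho> x)))) (at x)"
      by (intro has_vector_derivative_exp_compose has_vector_derivative_add has_vector_derivative_mult_right
          N1(2) x'(2) has_vector_derivative_of_real ln')
    have d2: "exp (1/2 * I x + of_real (- 1/2 * ln (w x))) *
        (1/2 * (p x / of_real ((r x)\<^sup>2)) + of_real (- 1/2 * (deriv r x / r x + deriv \<rho> x / \<rho> x))) = Ft x / 2 * E x"
      unfolding Eeq[OF x'(3), symmetric] Ft_def by (simp add: algebra_simps)
    from d1 have "((\<lambda>x. exp (1/2 * I x + of_real (- 1/2 * ln (w x)))) has_vector_derivative Ft x / 2 * E x) (at x)" unfolding d2 .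
    then show "(E has_vector_derivative Ft x / 2 * E x) (at x)"
      by (rule has_vector_derivative_transform_within_open[OF _ open_greaterThanLessThan x'(4)]) (simp add: Eeq)
  qed
qed

end

section \<open>Solutions in the variable t\<close>

context sturm_liouville begin

abbreviation T :: "real \<Rightarrow> real" where "T \<equiv> tvar a r \<rho>"

lemma T_eq: "T x = integral {a..x} \<kappa>"
  unfolding tvar_def \<kappa>_def ..

sublocale fw: perturbed_phase a b \<kappa> T \<alpha> \<gamma>
  by unfold_locales (use ab \<kappa>c \<kappa>0 T_eq \<alpha>_integrable \<gamma>_integrable in auto)

text \<open>Common interface of the construction from \<open>a\<close> and of its mirror image from
  \<open>b\<close>. Initial values are not recorded, and smallness is stated separately because it
  holds in different half-planes.\<close>

definition amplitudes :: "(real \<Rightarrow> complex \<Rightarrow> complex) \<Rightarrow> (real \<Rightarrow> complex \<Rightarrow> complex) \<Rightarrow> bool" where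
  "amplitudes X1 X2 \<longleftrightarrow>
    (\<forall>t\<in>{a..b}. (\<lambda>lam. X1 t lam) holomorphic_on - {0} \<and> (\<lambda>lam. X2 t lam) holomorphic_on - {0}) \<and>
    (\<forall>lam. abs_cont_on a b (\<lambda>t. X1 t lam) \<and> abs_cont_on a b (\<lambda>t. X2 t lam) \<and>
      (\<exists>N. negligible N \<and> (\<forall>t\<in>{a<..<b} - N.
        ((\<lambda>t. X1 t lam) has_vector_derivative \<alpha> t * X2 t lam + \<gamma> t / (2 * \<i> * lam) * (1 + X1 t lam + X2 t lam)) (at t) \<and>
        ((\<lambda>t. X2 t lam) has_vector_derivative - 2 * \<i> * lam * \<kappa> t * X2 t lam + \<alpha> t * (1 + X1 t lam)
          - \<gamma> t / (2 * \<i> * lam) * (1 + X1 t lam + X2 t lam)) (at t))))"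

lemma amplitudes_forward:
  assumes "0 \<le> s"
  shows "\<exists>X1 X2. amplitudes X1 X2 \<and>
    (\<forall>\<epsilon>>0. \<exists>R>0. \<forall>lam t. norm lam > R \<longrightarrow> Im lam \<le> s \<longrightarrow> t \<in> {a..b} \<longrightarrow> norm (X1 t lam) + norm (X2 t lam) \<le> \<epsilon>)"
proof (rule exI[of _ fw.x1], rule exI[of _ fw.x2], intro conjI allI impI)
  show "amplitudes fw.x1 fw.x2"
    unfolding amplitudes_def
  proof (intro conjI ballI allI)
    fix lam
    obtain N where "negligible N"
      "\<And>t. t \<in> {a<..<b} - N \<Longrightarrow> ((\<lambda>t. fw.x1 t lam) has_vector_derivative fst (fw.rhs lam t (fw.x1 t lam, fw.x2 t lam))) (at t)"
      "\<And>t. t \<in> {a<..<b} - N \<Longrightarrow> ((\<lambda>t. fw.x2 t lam) has_vector_derivative snd (fw.rhs lam t (fw.x1 t lam, fw.x2 t lam))) (at t)"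
      using fw.x12_derivative[of lam] by metis
    then show "\<exists>N. negligible N \<and> (\<forall>t\<in>{a<..<b} - N.
        ((\<lambda>t. fw.x1 t lam) has_vector_derivative \<alpha> t * fw.x2 t lam + \<gamma> t / (2 * \<i> * lam) * (1 + fw.x1 t lam + fw.x2 t lam)) (at t) \<and>
        ((\<lambda>t. fw.x2 t lam) has_vector_derivative - 2 * \<i> * lam * \<kappa> t * fw.x2 t lam + \<alpha> t * (1 + fw.x1 t lam)
          - \<gamma> t / (2 * \<i> * lam) * (1 + fw.x1 t lam + fw.x2 t lam)) (at t))"
      unfolding fw.rhs_def fst_conv snd_conv by (intro exI[of _ N] conjI ballI)
  qed (auto intro: fw.x12_holomorphic fw.x12_abs_cont)
  fix \<epsilon> :: real assume "\<epsilon> > 0"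
  obtain R where "R > 0" "\<And>lam t. norm lam > R \<Longrightarrow> Im lam \<le> s \<Longrightarrow> t \<in> {a..b} \<Longrightarrow> norm (fw.x1 t lam) + norm (fw.x2 t lam) \<le> \<epsilon>"
    using fw.x12_small[OF assms \<open>\<epsilon> > 0\<close>] by metis
  then show "\<exists>R>0. \<forall>lam t. norm lam > R \<longrightarrow> Im lam \<le> s \<longrightarrow> t \<in> {a..b} \<longrightarrow> norm (fw.x1 t lam) + norm (fw.x2 t lam) \<le> \<epsilon>"
    by (intro exI[of _ R]) simp
qed

text \<open>The reflection \<open>x \<mapsto> a + b - x\<close> combined with \<open>\<lambda> \<mapsto> -\<lambda>\<close> preserves the amplitude system and
  exchanges the half-planes.\<close>

sublocale bw: perturbed_phase a b "\<lambda>x. \<kappa> (a + b - x)" "\<lambda>x. integral {a..x} (\<lambda>x. \<kappa> (a + b - x))"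
  "\<lambda>x. - \<alpha> (a + b - x)" "\<lambda>x. \<gamma> (a + b - x)"
proof unfold_locales
  show "continuous_on {a..b} (\<lambda>x. \<kappa> (a + b - x))"
    by (rule continuous_on_compose2[OF \<kappa>c]) (auto intro!: continuous_intros)
  show "(\<lambda>x. - \<alpha> (a + b - x)) absolutely_integrable_on {a..b}"
    using set_integral_diff(1)[OF absolutely_integrable_zero absolutely_integrable_reflect_Icc[OF \<alpha>_integrable]] by simp
  show "(\<lambda>x. \<gamma> (a + b - x)) absolutely_integrable_on {a..b}"
    by (rule absolutely_integrable_reflect_Icc[OF \<gamma>_integrable])
qed (use ab \<kappa>0 in auto)

text \<open>Reflection reverses the sign of every derivative. In the terms containing
  \<open>lam\<close> this is undone by passing to \<open>- lam\<close>; in the others \<alpha>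
  absorbs it, so the mirrored system has -\<alpha> and the same sign of \<gamma>. The condition Im
  lam \<ge> -s becomes Im (-lam) \<le> s.\<close>

lemma amplitudes_backward:
  assumes "0 \<le> s"
  shows "\<exists>X1 X2. amplitudes X1 X2 \<and>
    (\<forall>\<epsilon>>0. \<exists>R>0. \<forall>lam t. norm lam > R \<longrightarrow> - s \<le> Im lam \<longrightarrow> t \<in> {a..b} \<longrightarrow> norm (X1 t lam) + norm (X2 t lam) \<le> \<epsilon>)"
proof (rule exI[of _ "\<lambda>t lam. bw.x1 (a + b - t) (- lam)"], rule exI[of _ "\<lambda>t lam. bw.x2 (a + b - t) (- lam)"],
    intro conjI allI impI)
  let ?X1 = "\<lambda>t lam. bw.x1 (a + b - t) (- lam)" and ?X2 = "\<lambda>t lam. bw.x2 (a + b - t) (- lam)"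
  have mem: "a + b - t \<in> {a..b}" if "t \<in> {a..b}" for t using that by auto
  show "amplitudes ?X1 ?X2"
    unfolding amplitudes_def
  proof (intro conjI ballI allI)
    fix t assume t: "t \<in> {a..b}"
    have um: "uminus holomorphic_on - {0 :: complex}" "uminus ` (- {0 :: complex}) \<subseteq> - {0}" by (auto intro!: holomorphic_intros)
    show "(\<lambda>lam. ?X1 t lam) holomorphic_on - {0}" "(\<lambda>lam. ?X2 t lam) holomorphic_on - {0}"
      using holomorphic_on_compose_gen[OF um(1) bw.x12_holomorphic(1)[OF mem[OF t]] um(2)]
        holomorphic_on_compose_gen[OF um(1) bw.x12_holomorphic(2)[OF mem[OF t]] um(2)] by (simp_all add: o_def)
  next
    fix lam
    show "abs_cont_on a b (\<lambda>t. ?X1 t lam)" "abs_cont_on a b (\<lambda>t. ?X2 t lam)"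
      by (intro abs_cont_on_reflect bw.x12_abs_cont)+
    obtain N where N: "negligible N"
      "\<And>t. t \<in> {a<..<b} - N \<Longrightarrow> ((\<lambda>t. bw.x1 t (- lam)) has_vector_derivative fst (bw.rhs (- lam) t (bw.x1 t (- lam), bw.x2 t (- lam)))) (at t)"
      "\<And>t. t \<in> {a<..<b} - N \<Longrightarrow> ((\<lambda>t. bw.x2 t (- lam)) has_vector_derivative snd (bw.rhs (- lam) t (bw.x1 t (- lam), bw.x2 t (- lam)))) (at t)"
      using bw.x12_derivative[of "- lam"] by metis
    show "\<exists>N. negligible N \<and> (\<forall>t\<in>{a<..<b} - N.
        ((\<lambda>t. ?X1 t lam) has_vector_derivative \<alpha> t * ?X2 t lam + \<gamma> t / (2 * \<i> * lam) * (1 + ?X1 t lam + ?X2 t lam)) (at t) \<and>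
        ((\<lambda>t. ?X2 t lam) has_vector_derivative - 2 * \<i> * lam * \<kappa> t * ?X2 t lam + \<alpha> t * (1 + ?X1 t lam)
          - \<gamma> t / (2 * \<i> * lam) * (1 + ?X1 t lam + ?X2 t lam)) (at t))"
    proof (intro exI[of _ "(\<lambda>t. a + b - t) ` N"] conjI ballI)
      show "negligible ((\<lambda>t. a + b - t) ` N)"
        by (rule negligible_differentiable_image_negligible[OF order_refl N(1)])
           (auto intro!: derivative_intros simp: differentiable_on_def)
      fix t assume t: "t \<in> {a<..<b} - (\<lambda>t. a + b - t) ` N"
      have t': "a + b - t \<in> {a<..<b} - N"
      proof -
        have "a + b - t \<notin> N"
        proof
          assume "a + b - t \<in> N"
          then have "a + b - (a + b - t) \<in> (\<lambda>t. a + b - t) ` N" by (rule imageI)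
          then show False using t by simp
        qed
        then show ?thesis using t by auto
      qed
      have refl: "((\<lambda>t. a + b - t) has_vector_derivative - 1) (at t)"
        by (auto intro!: derivative_eq_intros)
      have c: "\<gamma> t / (2 * \<i> * (- lam)) = - (\<gamma> t / (2 * \<i> * lam))" by simp
      show "((\<lambda>t. ?X1 t lam) has_vector_derivative \<alpha> t * ?X2 t lam + \<gamma> t / (2 * \<i> * lam) * (1 + ?X1 t lam + ?X2 t lam)) (at t)"
        using vector_diff_chain_at[OF refl N(2)[OF t']]
        by (simp add: bw.rhs_def o_def algebra_simps)
      show "((\<lambda>t. ?X2 t lam) has_vector_derivative - 2 * \<i> * lam * \<kappa> t * ?X2 t lam + \<alpha> t * (1 + ?X1 t lam)
          - \<gamma> t / (2 * \<i> * lam) * (1 + ?X1 t lam + ?X2 t lam)) (at t)"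
        using vector_diff_chain_at[OF refl N(3)[OF t']]
        by (simp add: bw.rhs_def o_def algebra_simps)
    qed
  qed
  fix \<epsilon> :: real assume "\<epsilon> > 0"
  obtain R where R: "R > 0" "\<And>lam t. norm lam > R \<Longrightarrow> Im lam \<le> s \<Longrightarrow> t \<in> {a..b} \<Longrightarrow> norm (bw.x1 t lam) + norm (bw.x2 t lam) \<le> \<epsilon>"
    using bw.x12_small[OF assms \<open>\<epsilon> > 0\<close>] by metis
  show "\<exists>R>0. \<forall>lam t. norm lam > R \<longrightarrow> - s \<le> Im lam \<longrightarrow> t \<in> {a..b} \<longrightarrow> norm (?X1 t lam) + norm (?X2 t lam) \<le> \<epsilon>"
  proof (intro exI[of _ R] conjI allI impI)
    fix lam t assume "norm lam > R" "- s \<le> Im lam" "t \<in> {a..b}"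
    then show "norm (?X1 t lam) + norm (?X2 t lam) \<le> \<epsilon>" using R(2)[of "- lam" "a + b - t"] by auto
  qed (rule R(1))
qed

section \<open>The inverse of the phase and the passage between the variables\<close>

lemma \<kappa>_lower:
  obtains k where "k > 0" "\<And>x y. a \<le> x \<Longrightarrow> x \<le> y \<Longrightarrow> y \<le> b \<Longrightarrow> k * (y - x) \<le> T y - T x"
proof -
  have "{a..b} \<noteq> {}" using ab by auto
  then obtain x0 where x0: "x0 \<in> {a..b}" "\<And>x. x \<in> {a..b} \<Longrightarrow> \<kappa> x0 \<le> \<kappa> x"
    using continuous_attains_inf[OF compact_Icc _ \<kappa>c] by blast
  show ?thesis
  proof (rule that[OF \<kappa>0[OF x0(1)]])
    fix x y assume xy: "a \<le> x" "x \<le> y" "y \<le> b"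
    have "\<kappa> x0 * (y - x) = integral {x..y} (\<lambda>_. \<kappa> x0)" using xy by simp
    also have "\<dots> \<le> integral {x..y} \<kappa>"
      by (rule integral_le[OF integrable_const_ivl absolutely_integrable_on_subinterval_integrable[OF fw.\<kappa>i(1)]]) (use xy x0 in auto)
    also have "\<dots> = T y - T x" using fw.T_diff[OF xy] by simp
    finally show "\<kappa> x0 * (y - x) \<le> T y - T x" .
  qed
qed

abbreviation X :: "real \<Rightarrow> real" where "X \<equiv> xvar a b r \<rho>"

lemma T_less: "a \<le> x \<Longrightarrow> x < y \<Longrightarrow> y \<le> b \<Longrightarrow> T x < T y"
proof -
  assume xy: "a \<le> x" "x < y" "y \<le> b"
  obtain k where "k > 0" "\<And>x y. a \<le> x \<Longrightarrow> x \<le> y \<Longrightarrow> y \<le> b \<Longrightarrow> k * (y - x) \<le> T y - T x" using \<kappa>_lower by blast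
  from this(2)[of x y] mult_pos_pos[OF this(1), of "y - x"] xy show ?thesis by simp
qed

lemma T_inj: "inj_on T {a..b}"
proof (rule inj_onI)
  fix x y assume "x \<in> {a..b}" "y \<in> {a..b}" "T x = T y"
  then show "x = y" using T_less[of x y] T_less[of y x] by (cases x y rule: linorder_cases) auto
qed

lemma T_image: "T ` {a..b} = {0..T b}"
proof
  show "T ` {a..b} \<subseteq> {0..T b}" using fw.T_ge0 fw.T_le by auto
  show "{0..T b} \<subseteq> T ` {a..b}"
  proof
    fix t assume "t \<in> {0..T b}"
    then show "t \<in> T ` {a..b}" using IVT'[of T a t b] ab fw.T_cont by (auto simp: fw.T_a)
  qed
qed

lemma X_T: "x \<in> {a..b} \<Longrightarrow> X (T x) = x"
  unfolding xvar_def by (rule the_inv_into_f_f[OF T_inj])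

lemma T_X: "t \<in> {0..T b} \<Longrightarrow> T (X t) = t" and X_mem: "t \<in> {0..T b} \<Longrightarrow> X t \<in> {a..b}"
  unfolding xvar_def using f_the_inv_into_f[OF T_inj, of t] the_inv_into_into[OF T_inj, of t "{a..b}"] T_image by auto

lemma X_mono: "0 \<le> s \<Longrightarrow> s \<le> t \<Longrightarrow> t \<le> T b \<Longrightarrow> X s \<le> X t"
  using T_less[of "X t" "X s"] T_X[of s] T_X[of t] X_mem[of s] X_mem[of t] by fastforce

lemma X_lipschitz:
  obtains L where "L > 0" "\<And>s t. 0 \<le> s \<Longrightarrow> s \<le> t \<Longrightarrow> t \<le> T b \<Longrightarrow> \<bar>X t - X s\<bar> \<le> L * (t - s)"
proof -
  obtain k where k: "k > 0" "\<And>x y. a \<le> x \<Longrightarrow> x \<le> y \<Longrightarrow> y \<le> b \<Longrightarrow> k * (y - x) \<le> T y - T x" using \<kappa>_lower by blast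
  show ?thesis
  proof (rule that[of "1 / k"])
    fix s t assume st: "0 \<le> s" "s \<le> t" "t \<le> T b"
    then have "k * (X t - X s) \<le> t - s" using k(2)[of "X s" "X t"] X_mono[OF st] X_mem[of s] X_mem[of t] T_X[of s] T_X[of t] by auto
    then show "\<bar>X t - X s\<bar> \<le> 1 / k * (t - s)" using X_mono[OF st] k(1) by (simp add: field_simps)
  qed (use k in simp)
qed

lemma abs_cont_on_X: "abs_cont_on a b F \<Longrightarrow> abs_cont_on 0 (T b) (\<lambda>t. F (X t))"
proof -
  assume F: "abs_cont_on a b F"
  obtain L where L: "L > 0" "\<And>s t. 0 \<le> s \<Longrightarrow> s \<le> t \<Longrightarrow> t \<le> T b \<Longrightarrow> \<bar>X t - X s\<bar> \<le> L * (t - s)" using X_lipschitz by blast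
  show ?thesis
  proof (rule abs_cont_on_compose_homeomorphism[OF F _ _ _ L(2)])
    fix u v assume uv: "0 \<le> u" "u \<le> v" "v \<le> T b"
    have "X ` {u..v} = {X u..X v}"
    proof
      show "X ` {u..v} \<subseteq> {X u..X v}" using X_mono uv by auto
      show "{X u..X v} \<subseteq> X ` {u..v}"
      proof
        fix x assume x: "x \<in> {X u..X v}"
        then have xab: "x \<in> {a..b}" using X_mem[of u] X_mem[of v] uv by auto
        have "T (X u) \<le> T x" "T x \<le> T (X v)"
          using x X_mem[of u] X_mem[of v] uv by (auto intro!: fw.T_mono)
        then have "T x \<in> {u..v}" using T_X[of u] T_X[of v] uv by auto
        then show "x \<in> X ` {u..v}" using X_T[OF xab] by (metis imageI)
      qed
    qed
    then show "X ` {u..v} = {X u..X v} \<or> X ` {u..v} = {X v..X u}" by blast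
  next
    show "inj_on X {0..T b}" by (rule inj_on_inverseI[where g = T]) (rule T_X)
    show "X ` {0..T b} \<subseteq> {a..b}" using X_mem by blast
  qed auto
qed

lemma X_derivative:
  assumes t: "t \<in> {0<..<T b}"
  shows "X t \<in> {a<..<b}" "(X has_real_derivative 1 / \<kappa> (X t)) (at t)"
proof -
  have "T (X t) = t" "X t \<in> {a..b}" using T_X[of t] X_mem[of t] t by auto
  then show x: "X t \<in> {a<..<b}" using t fw.T_a by (metis atLeastAtMost_iff greaterThanLessThan_iff less_le order_less_irrefl)
  obtain L where L: "L > 0" "\<And>s t. 0 \<le> s \<Longrightarrow> s \<le> t \<Longrightarrow> t \<le> T b \<Longrightarrow> \<bar>X t - X s\<bar> \<le> L * (t - s)" using X_lipschitz by blast
  \<comment> \<open>Composing the identity with \<open>X\<close> yields the continuity of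
    \<open>X\<close>, which the inverse function rule needs.\<close>
  have "abs_cont_on a b (\<lambda>x. x)"
    by (rule abs_cont_on_cong[OF abs_cont_on_add[OF abs_cont_on_integral[where f = "\<lambda>_. 1::real"] abs_cont_on_const[where c = a]]]) auto
  from abs_cont_on_X[OF this] have "abs_cont_on 0 (T b) X" .
  then have "continuous_on {0..T b} X" by (rule abs_cont_on_imp_continuous_on)
  then have cont: "isCont X t" using t by (intro continuous_on_interior[of "{0..T b}"]) auto
  have "\<kappa> (X t) \<noteq> 0" using \<kappa>0[of "X t"] x by auto
  have "(X has_real_derivative inverse (\<kappa> (X t))) (at t)"
    by (rule DERIV_inverse_function[where f = T and a = 0 and b = "T b"])
       (use fw.T_der[OF x] \<open>\<kappa> (X t) \<noteq> 0\<close> t T_X cont in auto)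
  then show "(X has_real_derivative 1 / \<kappa> (X t)) (at t)" by (simp add: inverse_eq_divide)
qed

text \<open>Each derivative in t is 1/\<kappa> times one in x. The logarithmic derivative of
  \<rho>/r contributes -\<rho>'/\<rho> + r'/r, and -2 r'/r leaves -r'/r; moreover p/(r \<rho>) is
  p/r^2 divided by \<kappa>.\<close>

lemma f_coeff_eq:
  assumes t: "t \<in> {0<..<T b}"
    and r': "(r has_real_derivative deriv r (X t)) (at (X t))"
    and \<rho>': "(\<rho> has_real_derivative deriv \<rho> (X t)) (at (X t))"
  shows "f_coeff a b r \<rho> p t = Ft (X t) / of_real (\<kappa> (X t))"
proof -
  note x = X_derivative[OF t]
  have n0: "r (X t) \<noteq> 0" "\<rho> (X t) \<noteq> 0" using rn0[of "X t"] \<rho>n0[of "X t"] x(1) by auto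
  have 1: "deriv (\<lambda>s. r (X s)) t = deriv r (X t) * (1 / \<kappa> (X t))"
    by (rule DERIV_imp_deriv[OF DERIV_chain2[OF r' x(2)]])
  have "((\<lambda>x. \<rho> x / r x) has_real_derivative (deriv \<rho> (X t) * r (X t) - \<rho> (X t) * deriv r (X t)) / (r (X t) * r (X t))) (at (X t))"
    by (rule DERIV_divide[OF \<rho>' r' n0(1)])
  then have 2: "deriv (\<lambda>s. \<rho> (X s) / r (X s)) t =
      (deriv \<rho> (X t) * r (X t) - \<rho> (X t) * deriv r (X t)) / (r (X t) * r (X t)) * (1 / \<kappa> (X t))"
    by (intro DERIV_imp_deriv DERIV_chain2[OF _ x(2)])
  show ?thesis
    unfolding f_coeff_def Let_def 1 2 Ft_def \<kappa>_def using n0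
    by (simp add: field_simps power2_eq_square)
qed

text \<open>Multiplication of the system in t by \<kappa> = dt/dx gives the system in x; in
  particular \<gamma> is \<kappa> times \<open>g_coeff\<close>.\<close>

lemma solution_transfer:
  fixes y w :: "real \<Rightarrow> complex" and lam :: complex
  assumes y: "abs_cont_on a b y" and w: "abs_cont_on a b w" and N: "negligible N"
    and y': "\<And>x. x \<in> {a<..<b} - N \<Longrightarrow> (y has_vector_derivative \<kappa> x * (h x * y x + w x)) (at x)"
    and w': "\<And>x. x \<in> {a<..<b} - N \<Longrightarrow>
      (w has_vector_derivative - lam\<^sup>2 * \<kappa> x * y x + \<gamma> x * y x + (Ft x - \<kappa> x * h x) * w x) (at x)"
  shows "solution_with_quasi_deriv a b r \<rho> p h lam y (\<lambda>x. of_real (\<kappa> x) * w x)"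
  unfolding solution_with_quasi_deriv_def
proof (rule exI[of _ "\<lambda>t. y (X t)"], rule exI[of _ "\<lambda>t. w (X t)"], intro conjI ballI)
  show "abs_cont_on 0 (T b) (\<lambda>t. y (X t))" "abs_cont_on 0 (T b) (\<lambda>t. w (X t))"
    by (rule abs_cont_on_X[OF y] abs_cont_on_X[OF w])+
  show "y x = y (X (T x))" "of_real (\<kappa> x) * w x = of_real (\<rho> x / r x) * w (X (T x))" if "x \<in> {a..b}" for x
    using X_T[OF that] by (simp_all add: \<kappa>_def)
  obtain N2 where N2: "negligible N2"
    "\<And>x. x \<in> {a<..<b} - N2 \<Longrightarrow> (r has_real_derivative deriv r x) (at x)"
    "\<And>x. x \<in> {a<..<b} - N2 \<Longrightarrow> (\<rho> has_real_derivative deriv \<rho> x) (at x)"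
    using coefficients_differentiable by blast
  \<comment> \<open>\<open>T\<close> is differentiable in the interior and therefore maps null sets
    there to null sets. The endpoints are added because the derivatives required are
    two-sided.\<close>
  define Z where "Z = T ` ((N \<union> N2) \<inter> {a<..<b}) \<union> {0, T b}"
  have "negligible (T ` ((N \<union> N2) \<inter> {a<..<b}))"
  proof (rule negligible_differentiable_image_negligible[OF order_refl])
    show "negligible ((N \<union> N2) \<inter> {a<..<b})" using N N2(1) by (simp add: negligible_Int)
    show "T differentiable_on (N \<union> N2) \<inter> {a<..<b}"
      unfolding differentiable_on_def
    proof
      fix x assume "x \<in> (N \<union> N2) \<inter> {a<..<b}"
      then have "(T has_real_derivative \<kappa> x) (at x)" using fw.T_der by blast
      then have "T differentiable (at x)" unfolding real_differentiable_def by blast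
      then show "T differentiable (at x within (N \<union> N2) \<inter> {a<..<b})" by (rule differentiable_at_withinI)
    qed
  qed
  then have Z: "Z \<in> null_sets lebesgue" unfolding Z_def by (simp add: negligible_iff_null_sets[symmetric])
  let ?P = "\<lambda>t. ((\<lambda>t. y (X t)) has_vector_derivative (sigma_coeff a b r \<rho> h t * y (X t) + w (X t))) (at t) \<and>
     ((\<lambda>t. w (X t)) has_vector_derivative
        ((- lam\<^sup>2 + g_coeff a b r \<rho> p h t) * y (X t) + (f_coeff a b r \<rho> p t - sigma_coeff a b r \<rho> h t) * w (X t))) (at t)"
  have P: "?P t" if t: "t \<in> {0..T b} - Z" for t
  proof -
    have t': "t \<in> {0<..<T b}" using t by (auto simp: Z_def)
    note X = X_derivative[OF t']
    have "X t \<notin> N \<union> N2"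
    proof
      assume "X t \<in> N \<union> N2"
      then have "T (X t) \<in> T ` ((N \<union> N2) \<inter> {a<..<b})" using X(1) by blast
      then show False using t T_X[of t] by (auto simp: Z_def)
    qed
    then have x: "X t \<in> {a<..<b} - N" "X t \<in> {a<..<b} - N2" using X(1) by auto
    have k: "of_real (\<kappa> (X t)) \<noteq> (0 :: complex)" using \<kappa>0[of "X t"] X(1) by auto
    have Xv: "(X has_vector_derivative 1 / \<kappa> (X t)) (at t)"
      using X(2) by (simp add: has_real_derivative_iff_has_vector_derivative)
    have s: "sigma_coeff a b r \<rho> h t = h (X t)" by (simp add: sigma_coeff_def)
    have f: "f_coeff a b r \<rho> p t = Ft (X t) / of_real (\<kappa> (X t))" by (rule f_coeff_eq[OF t' N2(2,3)[OF x(2)]])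
    have "((\<lambda>t. y (X t)) has_vector_derivative (1 / \<kappa> (X t)) *\<^sub>R (\<kappa> (X t) * (h (X t) * y (X t) + w (X t)))) (at t)"
      using vector_diff_chain_at[OF Xv y'[OF x(1)]] by (simp add: o_def)
    moreover have "(1 / \<kappa> (X t)) *\<^sub>R (\<kappa> (X t) * (h (X t) * y (X t) + w (X t))) = sigma_coeff a b r \<rho> h t * y (X t) + w (X t)"
      unfolding s using k by (simp add: scaleR_conv_of_real)
    moreover have "((\<lambda>t. w (X t)) has_vector_derivative (1 / \<kappa> (X t)) *\<^sub>R
        (- lam\<^sup>2 * \<kappa> (X t) * y (X t) + \<gamma> (X t) * y (X t) + (Ft (X t) - \<kappa> (X t) * h (X t)) * w (X t))) (at t)"
      using vector_diff_chain_at[OF Xv w'[OF x(1)]] by (simp add: o_def)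
    moreover have "(1 / \<kappa> (X t)) *\<^sub>R
        (- lam\<^sup>2 * \<kappa> (X t) * y (X t) + \<gamma> (X t) * y (X t) + (Ft (X t) - \<kappa> (X t) * h (X t)) * w (X t)) =
        (- lam\<^sup>2 + g_coeff a b r \<rho> p h t) * y (X t) + (f_coeff a b r \<rho> p t - sigma_coeff a b r \<rho> h t) * w (X t)"
      unfolding g_coeff_def f s \<gamma>_def using k by (simp add: scaleR_conv_of_real field_simps power2_eq_square)
    ultimately show ?thesis by simp
  qed
  have "AE t in lebesgue. t \<in> {0..T b} \<longrightarrow> ?P t"
    by (rule AE_I'[OF Z]) (use P in auto)
  then show "AE t in lebesgue_on {0..T b}. ?P t"
    by (subst AE_restrict_space_iff) auto
qed

end

section \<open>Asymptotics\<close>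

context sturm_liouville begin

lemma solution_cong:
  assumes "solution_with_quasi_deriv a b r \<rho> p h lam y y1"
    and "\<And>x. x \<in> {a..b} \<Longrightarrow> z x = y x" "\<And>x. x \<in> {a..b} \<Longrightarrow> z1 x = y1 x"
  shows "solution_with_quasi_deriv a b r \<rho> p h lam z z1"
  using assms unfolding solution_with_quasi_deriv_def by simp

text \<open>The check is made for the brackets z = 1 + x1 + x2 and \<omega> = 1 + x1 - x2. There z'
  = \<alpha> z - i lam \<kappa> (z - \<omega>), and the derivative of the phase cancels the term i
  lam \<kappa> z, so that the first equation of the system appears; the second is analogous, with
  the \<gamma> terms adding up.\<close>

lemma amplitudes_solution:
  assumes amp: "amplitudes X1 X2" and lam: "lam \<noteq> 0"
  shows "solution_with_quasi_deriv a b r \<rho> p h lam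
    (\<lambda>x. E x * exp (\<i> * lam * of_real (T x)) * (1 + (X1 x lam + X2 x lam)))
    (\<lambda>x. of_real (\<kappa> x) * (\<i> * lam * (E x * exp (\<i> * lam * of_real (T x))) * (1 + (X1 x lam - X2 x lam))))"
proof -
  define e where "e = (\<lambda>x. E x * exp (\<i> * lam * of_real (T x)))"
  define z \<omega> where "z = (\<lambda>x. 1 + (X1 x lam + X2 x lam))" and "\<omega> = (\<lambda>x. 1 + (X1 x lam - X2 x lam))"
  have X: "abs_cont_on a b (\<lambda>t. X1 t lam)" "abs_cont_on a b (\<lambda>t. X2 t lam)"
    using amp unfolding amplitudes_def by blast+
  from amp have "\<exists>N. negligible N \<and> (\<forall>t\<in>{a<..<b} - N.
        ((\<lambda>t. X1 t lam) has_vector_derivative \<alpha> t * X2 t lam + \<gamma> t / (2 * \<i> * lam) * (1 + X1 t lam + X2 t lam)) (at t) \<and>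
        ((\<lambda>t. X2 t lam) has_vector_derivative - 2 * \<i> * lam * \<kappa> t * X2 t lam + \<alpha> t * (1 + X1 t lam)
          - \<gamma> t / (2 * \<i> * lam) * (1 + X1 t lam + X2 t lam)) (at t))"
    unfolding amplitudes_def by blast
  then obtain N where N: "negligible N" and X': "\<And>t. t \<in> {a<..<b} - N \<Longrightarrow>
        ((\<lambda>t. X1 t lam) has_vector_derivative \<alpha> t * X2 t lam + \<gamma> t / (2 * \<i> * lam) * (1 + X1 t lam + X2 t lam)) (at t) \<and>
        ((\<lambda>t. X2 t lam) has_vector_derivative - 2 * \<i> * lam * \<kappa> t * X2 t lam + \<alpha> t * (1 + X1 t lam)
          - \<gamma> t / (2 * \<i> * lam) * (1 + X1 t lam + X2 t lam)) (at t)" by blast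
  obtain M where M: "negligible M" and E': "\<And>x. x \<in> {a<..<b} - M \<Longrightarrow> (E has_vector_derivative Ft x / 2 * E x) (at x)"
    using E_props(2) by blast
  have ac: "abs_cont_on a b e" "abs_cont_on a b z" "abs_cont_on a b \<omega>"
    unfolding e_def z_def \<omega>_def
    by (intro abs_cont_on_mult E_props(1) abs_cont_on_exp abs_cont_on_linear[OF _ bounded_linear_mult_right]
        abs_cont_on_of_real fw.T_ac abs_cont_on_add abs_cont_on_diff abs_cont_on_const X)+
  have "solution_with_quasi_deriv a b r \<rho> p h lam (\<lambda>x. e x * z x) (\<lambda>x. of_real (\<kappa> x) * (\<i> * lam * e x * \<omega> x))"
  proof (rule solution_transfer)
    show "abs_cont_on a b (\<lambda>x. e x * z x)" "abs_cont_on a b (\<lambda>x. \<i> * lam * e x * \<omega> x)"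
      by (intro abs_cont_on_mult ac abs_cont_on_const)+
    show "negligible (N \<union> M)" using N M by simp
    fix x assume x: "x \<in> {a<..<b} - (N \<union> M)"
    then have x': "x \<in> {a<..<b}" "x \<in> {a<..<b} - N" "x \<in> {a<..<b} - M" by auto
    define c where "c = \<gamma> x / (2 * \<i> * lam)"
    define k where "k = (of_real (\<kappa> x) :: complex)"
    have cg: "2 * \<i> * lam * c = \<gamma> x" unfolding c_def using lam by simp
    \<comment> \<open>Equivalently \<alpha> + Ft/2 = \<kappa> h and Ft/2 - \<alpha> = Ft - \<kappa>
      h: the two diagonal entries of the system in x.\<close>
    have Fa: "Ft x / 2 = k * h x - \<alpha> x" by (simp add: \<alpha>_def k_def)
    have "((\<lambda>x. exp (\<i> * lam * of_real (T x))) has_vector_derivative exp (\<i> * lam * of_real (T x)) * (\<i> * lam * of_real (\<kappa> x))) (at x)"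
      by (intro has_vector_derivative_exp_compose has_vector_derivative_mult_right has_vector_derivative_of_real fw.T_der x'(1))
    from has_vector_derivative_mult[OF E'[OF x'(3)] this]
    have e': "(e has_vector_derivative (Ft x / 2 + \<i> * lam * k) * e x) (at x)"
      unfolding e_def k_def by (simp add: algebra_simps)
    note d1 = conjunct1[OF X'[OF x'(2)], folded c_def k_def] and d2 = conjunct2[OF X'[OF x'(2)], folded c_def k_def]
    have z': "(z has_vector_derivative 0 + ((\<alpha> x * X2 x lam + c * (1 + X1 x lam + X2 x lam)) +
       (- 2 * \<i> * lam * k * X2 x lam + \<alpha> x * (1 + X1 x lam) - c * (1 + X1 x lam + X2 x lam)))) (at x)"
      unfolding z_def by (intro has_vector_derivative_add has_vector_derivative_const d1 d2)
    have \<omega>': "(\<omega> has_vector_derivative 0 + ((\<alpha> x * X2 x lam + c * (1 + X1 x lam + X2 x lam)) -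
       (- 2 * \<i> * lam * k * X2 x lam + \<alpha> x * (1 + X1 x lam) - c * (1 + X1 x lam + X2 x lam)))) (at x)"
      unfolding \<omega>_def by (intro has_vector_derivative_add has_vector_derivative_diff has_vector_derivative_const d1 d2)
    have eqz: "0 + ((\<alpha> x * X2 x lam + c * (1 + X1 x lam + X2 x lam)) +
       (- 2 * \<i> * lam * k * X2 x lam + \<alpha> x * (1 + X1 x lam) - c * (1 + X1 x lam + X2 x lam))) =
       \<alpha> x * z x - \<i> * lam * k * (z x - \<omega> x)" by (simp add: z_def \<omega>_def algebra_simps)
    have eq\<omega>: "0 + ((\<alpha> x * X2 x lam + c * (1 + X1 x lam + X2 x lam)) -
       (- 2 * \<i> * lam * k * X2 x lam + \<alpha> x * (1 + X1 x lam) - c * (1 + X1 x lam + X2 x lam))) =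
       - \<alpha> x * \<omega> x + 2 * c * z x + \<i> * lam * k * (z x - \<omega> x)" by (simp add: z_def \<omega>_def algebra_simps)
    have "((\<lambda>x. e x * z x) has_vector_derivative
        e x * (\<alpha> x * z x - \<i> * lam * k * (z x - \<omega> x)) + (Ft x / 2 + \<i> * lam * k) * e x * z x) (at x)"
      using has_vector_derivative_mult[OF e' z'] unfolding eqz .
    moreover have "e x * (\<alpha> x * z x - \<i> * lam * k * (z x - \<omega> x)) + (Ft x / 2 + \<i> * lam * k) * e x * z x =
       k * (h x * (e x * z x) + \<i> * lam * e x * \<omega> x)"
      unfolding Fa by (simp add: algebra_simps)
    ultimately show "((\<lambda>x. e x * z x) has_vector_derivative of_real (\<kappa> x) * (h x * (e x * z x) + \<i> * lam * e x * \<omega> x)) (at x)"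
      unfolding k_def by simp
    have "((\<lambda>x. \<i> * lam * (e x * \<omega> x)) has_vector_derivative \<i> * lam *
        (e x * (- \<alpha> x * \<omega> x + 2 * c * z x + \<i> * lam * k * (z x - \<omega> x)) + (Ft x / 2 + \<i> * lam * k) * e x * \<omega> x)) (at x)"
      using has_vector_derivative_mult_right[OF has_vector_derivative_mult[OF e' \<omega>']] unfolding eq\<omega> .
    moreover have "\<i> * lam *
        (e x * (- \<alpha> x * \<omega> x + 2 * c * z x + \<i> * lam * k * (z x - \<omega> x)) + (Ft x / 2 + \<i> * lam * k) * e x * \<omega> x) =
       - lam\<^sup>2 * k * (e x * z x) + \<gamma> x * (e x * z x) + (Ft x - k * h x) * (\<i> * lam * e x * \<omega> x)"
    proof -
      have F1: "Ft x / 2 - \<alpha> x = k * h x - 2 * \<alpha> x" unfolding Fa by simp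
      have "Ft x = 2 * (k * h x - \<alpha> x)" unfolding Fa[symmetric] by simp
      then have F2: "Ft x - k * h x = k * h x - 2 * \<alpha> x" by (simp add: algebra_simps)
      have "\<i> * lam *
        (e x * (- \<alpha> x * \<omega> x + 2 * c * z x + \<i> * lam * k * (z x - \<omega> x)) + (Ft x / 2 + \<i> * lam * k) * e x * \<omega> x) =
        \<i> * lam * e x * \<omega> x * (Ft x / 2 - \<alpha> x) + (2 * \<i> * lam * c) * (e x * z x) + \<i> * \<i> * lam * lam * k * (e x * z x)"
        by (simp add: algebra_simps)
      also have "\<dots> = - lam\<^sup>2 * k * (e x * z x) + \<gamma> x * (e x * z x) + (Ft x - k * h x) * (\<i> * lam * e x * \<omega> x)"
        unfolding cg F1 F2 by (simp add: algebra_simps power2_eq_square)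
      finally show ?thesis .
    qed
    ultimately show "((\<lambda>x. \<i> * lam * e x * \<omega> x) has_vector_derivative
       - lam\<^sup>2 * of_real (\<kappa> x) * (e x * z x) + \<gamma> x * (e x * z x) + (Ft x - of_real (\<kappa> x) * h x) * (\<i> * lam * e x * \<omega> x)) (at x)"
      unfolding k_def by (simp add: mult.assoc)
  qed
  then show ?thesis unfolding e_def z_def \<omega>_def by (simp add: mult.assoc)
qed

section \<open>Linear independence and the final assembly\<close>

lemma E_nonzero: "x \<in> {a..b} \<Longrightarrow> E x \<noteq> 0"
  using r0[of x] \<rho>0[of x] by (simp add: E_def)

text \<open>Two combinations of \<open>e\<^sup>\<plusminus>\<^sup>i\<^sup>\<lambda>\<^sup>T\<close> with amplitudes close to 1 are compared at \<open>x = a\<close> and at a point where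
  \<open>\<bar>2 \<lambda> T\<bar> = 1/4\<close>.\<close>

lemma lin_indep_phases:
  assumes lam: "norm lam \<ge> 1 / (8 * T b)" "lam \<noteq> 0"
    and P: "\<And>x. x \<in> {a..b} \<Longrightarrow> norm (P x) \<le> 1 / 100" and Q: "\<And>x. x \<in> {a..b} \<Longrightarrow> norm (Q x) \<le> 1 / 100"
  shows "lin_indep_on a b (\<lambda>x. E x * exp (\<i> * lam * of_real (T x)) * (1 + P x)) (\<lambda>x. E x * exp (- (\<i> * lam * of_real (T x))) * (1 + Q x))"
  unfolding lin_indep_on_def
proof (intro allI impI)
  fix c d assume cd: "\<forall>x\<in>{a..b}. c * (E x * exp (\<i> * lam * of_real (T x)) * (1 + P x)) + d * (E x * exp (- (\<i> * lam * of_real (T x))) * (1 + Q x)) = 0"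
  have Tb: "T b > 0" using T_less[of a b] ab fw.T_a by simp
  \<comment> \<open>Gives |2 lam t| = 1/4; the lower bound on |lam| in the hypothesis says precisely
    that this value is attained by the phase, i.e. that \<open>t \<le> T b\<close>.\<close>
  define t where "t = 1 / (8 * norm lam)"
  have t: "t \<in> {0..T b}" "t > 0"
  proof -
    show "t > 0" using lam(2) by (simp add: t_def)
    have "1 \<le> norm lam * (8 * T b)" using lam(1) Tb by (simp add: divide_le_eq)
    then have "t \<le> T b" using lam(2) by (simp add: t_def divide_le_eq mult_ac)
    then show "t \<in> {0..T b}" using \<open>t > 0\<close> by simp
  qed
  define x where "x = X t"
  have x: "x \<in> {a..b}" "T x = t" using X_mem[OF t(1)] T_X[OF t(1)] by (auto simp: x_def)
  have am: "a \<in> {a..b}" using ab by simp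
  define \<theta> where "\<theta> = 2 * \<i> * lam * of_real t"
  have n\<theta>: "norm \<theta> = 1 / 4" using lam(2) by (simp add: \<theta>_def t_def norm_mult norm_divide)
  have e1: "c * (1 + P a) + d * (1 + Q a) = 0"
  proof -
    have "E a * (c * (1 + P a) + d * (1 + Q a)) = 0" using bspec[OF cd am] by (simp add: fw.T_a algebra_simps)
    then show ?thesis using E_nonzero[OF am] by simp
  qed
  \<comment> \<open>Multiplication by exp(i lam t) removes the phase of the second solution and
    doubles that of the first, hence the 2 in \<theta>.\<close>
  have e2: "c * exp \<theta> * (1 + P x) + d * (1 + Q x) = 0"
  proof -
    have s: "exp \<theta> = exp (\<i> * lam * of_real t) * exp (\<i> * lam * of_real t)"
      by (simp add: \<theta>_def flip: exp_add) (simp add: algebra_simps)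
    have i: "exp (\<i> * lam * of_real t) * exp (- (\<i> * lam * of_real t)) = 1" by (simp flip: exp_add)
    have "c * (E x * exp (\<i> * lam * of_real t) * (1 + P x)) + d * (E x * exp (- (\<i> * lam * of_real t)) * (1 + Q x)) = 0"
      using bspec[OF cd x(1)] unfolding x(2) .
    then have "exp (\<i> * lam * of_real t) * (c * (E x * exp (\<i> * lam * of_real t) * (1 + P x)) + d * (E x * exp (- (\<i> * lam * of_real t)) * (1 + Q x))) = 0"
      by simp
    moreover have "exp (\<i> * lam * of_real t) * (c * (E x * exp (\<i> * lam * of_real t) * (1 + P x)) + d * (E x * exp (- (\<i> * lam * of_real t)) * (1 + Q x)))
      = E x * (c * (exp (\<i> * lam * of_real t) * exp (\<i> * lam * of_real t)) * (1 + P x) +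
          d * (exp (\<i> * lam * of_real t) * exp (- (\<i> * lam * of_real t))) * (1 + Q x))"
      by (simp only: distrib_left mult_ac)
    ultimately have "E x * (c * exp \<theta> * (1 + P x) + d * (1 + Q x)) = 0" unfolding s i by simp
    then show ?thesis using E_nonzero[OF x(1)] by simp
  qed
  \<comment> \<open>Determinant of the equations \<open>e1\<close> and \<open>e2\<close> for
    \<open>c\<close> and \<open>d\<close>.\<close>
  define D where "D = (1 + P a) * (1 + Q x) - exp \<theta> * ((1 + P x) * (1 + Q a))"
  have nprod: "norm ((1 + v) * (1 + w) - 1) \<le> 3 / 100" if "norm v \<le> 1 / 100" "norm w \<le> 1 / 100" for v w :: complex
  proof -
    have "(1 + v) * (1 + w) - 1 = v + w + v * w" by (simp add: algebra_simps)
    also have "norm \<dots> \<le> norm v + norm w + norm v * norm w" by (intro norm_triangle_mono order_refl) (simp add: norm_mult)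
    also have "\<dots> \<le> 1 / 100 + 1 / 100 + 1 / 100 * 1" using that by (intro add_mono mult_mono) auto
    finally show ?thesis by simp
  qed
  have e14: "exp (1 / 4 :: real) \<le> 2" using exp_bound[of "1 / 4"] by (simp add: power2_eq_square)
  \<comment> \<open>If \<open>D\<close> vanished, |exp \<theta> - 1| would be at most 3/100 + 6/100
    = 9/100; but |\<theta>| = 1/4, and a Taylor remainder of at most 1/8 keeps it at or above
    1/8.\<close>
  have "D \<noteq> 0"
  proof
    assume "D = 0"
    then have "exp \<theta> - 1 = ((1 + P a) * (1 + Q x) - 1) - exp \<theta> * ((1 + P x) * (1 + Q a) - 1)"
      unfolding D_def by (simp add: algebra_simps)
    also have "norm \<dots> \<le> 3 / 100 + 2 * (3 / 100)"
    proof (rule norm_triangle_le_diff[OF add_mono])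
      show "norm ((1 + P a) * (1 + Q x) - 1) \<le> 3 / 100" by (intro nprod P Q am x(1))
      have "norm (exp \<theta>) \<le> exp (norm \<theta>)" by (rule norm_exp)
      then have "norm (exp \<theta>) \<le> 2" using e14 unfolding n\<theta> by linarith
      then show "norm (exp \<theta> * ((1 + P x) * (1 + Q a) - 1)) \<le> 2 * (3 / 100)"
        unfolding norm_mult by (intro mult_mono nprod[unfolded norm_mult] P Q am x(1)) (use nprod P Q am x(1) in auto)
    qed
    finally have small: "norm (exp \<theta> - 1) \<le> 9 / 100" by simp
    have "norm (exp \<theta> - (\<Sum>k\<le>1. \<theta> ^ k / fact k)) \<le> exp \<bar>Re \<theta>\<bar> * (norm \<theta> ^ Suc 1) / fact 1"
      by (rule Taylor_exp)
    also have "\<dots> \<le> exp (1 / 4) * (1 / 16)"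
      using abs_Re_le_cmod[of \<theta>] unfolding n\<theta> by (simp add: power2_eq_square)
    also have "\<dots> \<le> 2 * (1 / 16)" using e14 by (intro mult_right_mono) auto
    finally have "norm (exp \<theta> - 1 - \<theta>) \<le> 1 / 8" by (simp add: algebra_simps)
    moreover have "norm \<theta> - norm (exp \<theta> - 1) \<le> norm (exp \<theta> - 1 - \<theta>)"
      using norm_triangle_ineq2[of \<theta> "exp \<theta> - 1"] by (simp add: norm_minus_commute)
    ultimately show False using small n\<theta> by linarith
  qed
  moreover have "c * D = 0"
  proof -
    have "c * D = (c * (1 + P a) + d * (1 + Q a)) * (1 + Q x) - (c * exp \<theta> * (1 + P x) + d * (1 + Q x)) * (1 + Q a)"
      unfolding D_def by (simp add: algebra_simps)
    then show ?thesis unfolding e1 e2 by simp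
  qed
  ultimately have c: "c = 0" by simp
  have "1 + Q a \<noteq> 0"
  proof
    assume "1 + Q a = 0"
    then have "Q a = - 1" by (simp add: eq_neg_iff_add_eq_0 add.commute)
    then show False using Q[OF am] by simp
  qed
  then show "c = 0 \<and> d = 0" using c e1 by simp
qed

lemma uniform_limit_0:
  fixes f :: "real \<Rightarrow> complex \<Rightarrow> real"
  assumes "\<And>\<epsilon>. \<epsilon> > 0 \<Longrightarrow> \<exists>R>0. \<forall>lam\<in>\<H>. norm lam > R \<longrightarrow> (\<forall>x\<in>{a..b}. \<bar>f x lam\<bar> \<le> \<epsilon>)"
  shows "uniform_limit {a..b} (\<lambda>lam x. f x lam) (\<lambda>_. 0) (inf at_infinity (principal \<H>))"
proof (rule uniform_limitI)
  fix e :: real assume "e > 0"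
  then obtain R where R: "R > 0" "\<And>lam x. lam \<in> \<H> \<Longrightarrow> norm lam > R \<Longrightarrow> x \<in> {a..b} \<Longrightarrow> \<bar>f x lam\<bar> \<le> e / 2"
    using assms[of "e / 2"] by auto
  show "\<forall>\<^sub>F lam in inf at_infinity (principal \<H>). \<forall>x\<in>{a..b}. dist (f x lam) 0 < e"
    unfolding eventually_inf_principal eventually_at_infinity
  proof (intro exI[of _ "R + 1"] allI impI ballI)
    fix lam x assume "R + 1 \<le> norm lam" "lam \<in> \<H>" "x \<in> {a..b}"
    then show "dist (f x lam) 0 < e" using R(2)[of lam x] \<open>e > 0\<close> by (auto simp: dist_real_def)
  qed
qed

text \<open>The half-plane stays a parameter: the \<open>P\<close> amplitudes are small on it, the
  \<open>Q\<close> amplitudes on its image under lam -> -lam. The equation contains lam only through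
  its square, so the solution built from \<open>Q\<close> at \<open>- lam\<close> solves the
  equation at \<open>lam\<close> and carries the opposite phase.\<close>

lemma asymptotics:
  assumes P: "amplitudes P1 P2" and Q: "amplitudes Q1 Q2"
    and Ps: "\<And>\<epsilon>. \<epsilon> > 0 \<Longrightarrow> \<exists>R>0. \<forall>lam t. norm lam > R \<longrightarrow> lam \<in> \<H> \<longrightarrow> t \<in> {a..b} \<longrightarrow> norm (P1 t lam) + norm (P2 t lam) \<le> \<epsilon>"
    and Qs: "\<And>\<epsilon>. \<epsilon> > 0 \<Longrightarrow> \<exists>R>0. \<forall>lam t. norm lam > R \<longrightarrow> - lam \<in> \<H> \<longrightarrow> t \<in> {a..b} \<longrightarrow> norm (Q1 t lam) + norm (Q2 t lam) \<le> \<epsilon>"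
  shows "\<exists>R>0. \<exists>(yp :: real \<Rightarrow> complex \<Rightarrow> complex) ym yp1 ym1
           (\<phi>p :: real \<Rightarrow> complex \<Rightarrow> complex) \<phi>m (\<psi>p :: real \<Rightarrow> complex \<Rightarrow> complex) \<psi>m.
      (\<forall>lam\<in>\<H>. cmod lam > R \<longrightarrow>
         solution_with_quasi_deriv a b r \<rho> p h lam (\<lambda>x. yp x lam) (\<lambda>x. yp1 x lam) \<and>
         solution_with_quasi_deriv a b r \<rho> p h lam (\<lambda>x. ym x lam) (\<lambda>x. ym1 x lam) \<and>
         lin_indep_on a b (\<lambda>x. yp x lam) (\<lambda>x. ym x lam) \<and>
         (\<forall>x\<in>{a..b}.
            yp x lam = of_real (1 / sqrt (r x * \<rho> x))
              * exp (1/2 * integral {a..x} (\<lambda>\<tau>. p \<tau> / of_real ((r \<tau>)\<^sup>2))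
                     + \<i> * lam * of_real (integral {a..x} (\<lambda>\<tau>. \<rho> \<tau> / r \<tau>)))
              * (1 + \<phi>p x lam) \<and>
            ym x lam = of_real (1 / sqrt (r x * \<rho> x))
              * exp (1/2 * integral {a..x} (\<lambda>\<tau>. p \<tau> / of_real ((r \<tau>)\<^sup>2))
                     - \<i> * lam * of_real (integral {a..x} (\<lambda>\<tau>. \<rho> \<tau> / r \<tau>)))
              * (1 + \<phi>m x lam) \<and>
            yp1 x lam = \<i> * lam * of_real (sqrt (\<rho> x / (r x) ^ 3))
              * exp (1/2 * integral {a..x} (\<lambda>\<tau>. p \<tau> / of_real ((r \<tau>)\<^sup>2))
                     + \<i> * lam * of_real (integral {a..x} (\<lambda>\<tau>. \<rho> \<tau> / r \<tau>)))
              * (1 + \<psi>p x lam) \<and>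
            ym1 x lam = - \<i> * lam * of_real (sqrt (\<rho> x / (r x) ^ 3))
              * exp (1/2 * integral {a..x} (\<lambda>\<tau>. p \<tau> / of_real ((r \<tau>)\<^sup>2))
                     - \<i> * lam * of_real (integral {a..x} (\<lambda>\<tau>. \<rho> \<tau> / r \<tau>)))
              * (1 + \<psi>m x lam))) \<and>
      (\<forall>x\<in>{a..b}.
         (\<lambda>lam. \<phi>p x lam) analytic_on {lam\<in>\<H>. cmod lam > R} \<and>
         (\<lambda>lam. \<phi>m x lam) analytic_on {lam\<in>\<H>. cmod lam > R} \<and>
         (\<lambda>lam. \<psi>p x lam) analytic_on {lam\<in>\<H>. cmod lam > R} \<and>
         (\<lambda>lam. \<psi>m x lam) analytic_on {lam\<in>\<H>. cmod lam > R}) \<and>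
      uniform_limit {a..b} (\<lambda>lam x. cmod (\<phi>p x lam) + cmod (\<phi>m x lam)) (\<lambda>_. 0)
        (inf at_infinity (principal \<H>)) \<and>
      uniform_limit {a..b} (\<lambda>lam x. cmod (\<psi>p x lam) + cmod (\<psi>m x lam)) (\<lambda>_. 0)
        (inf at_infinity (principal \<H>))"
proof -
  define \<phi>p where "\<phi>p = (\<lambda>x lam. P1 x lam + P2 x lam)"
  define \<psi>p where "\<psi>p = (\<lambda>x lam. P1 x lam - P2 x lam)"
  define \<phi>m where "\<phi>m = (\<lambda>x lam. Q1 x (- lam) + Q2 x (- lam))"
  define \<psi>m where "\<psi>m = (\<lambda>x lam. Q1 x (- lam) - Q2 x (- lam))"
  define yp where "yp = (\<lambda>x lam. E x * exp (\<i> * lam * of_real (T x)) * (1 + \<phi>p x lam))"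
  define ym where "ym = (\<lambda>x lam. E x * exp (- (\<i> * lam * of_real (T x))) * (1 + \<phi>m x lam))"
  define yp1 where "yp1 = (\<lambda>x lam. of_real (\<kappa> x) * (\<i> * lam * (E x * exp (\<i> * lam * of_real (T x))) * (1 + \<psi>p x lam)))"
  define ym1 where "ym1 = (\<lambda>x lam. of_real (\<kappa> x) * (- \<i> * lam * (E x * exp (- (\<i> * lam * of_real (T x)))) * (1 + \<psi>m x lam)))"
  have small: "\<exists>R>0. \<forall>lam\<in>\<H>. norm lam > R \<longrightarrow> (\<forall>x\<in>{a..b}. norm (\<phi>p x lam) + norm (\<phi>m x lam) \<le> \<epsilon> \<and> norm (\<psi>p x lam) + norm (\<psi>m x lam) \<le> \<epsilon>)"
    if eps: "\<epsilon> > 0" for \<epsilon>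
  proof -
    obtain R1 where R1: "R1 > 0" "\<And>lam t. norm lam > R1 \<Longrightarrow> lam \<in> \<H> \<Longrightarrow> t \<in> {a..b} \<Longrightarrow> norm (P1 t lam) + norm (P2 t lam) \<le> \<epsilon> / 2"
      using Ps[OF half_gt_zero[OF eps]] by blast
    obtain R2 where R2: "R2 > 0" "\<And>lam t. norm lam > R2 \<Longrightarrow> - lam \<in> \<H> \<Longrightarrow> t \<in> {a..b} \<Longrightarrow> norm (Q1 t lam) + norm (Q2 t lam) \<le> \<epsilon> / 2"
      using Qs[OF half_gt_zero[OF eps]] by blast
    show ?thesis
    proof (intro exI[of _ "max R1 R2"] conjI ballI impI)
      show "max R1 R2 > 0" using R1(1) by simp
      fix lam x assume l: "lam \<in> \<H>" "max R1 R2 < norm lam" and x: "x \<in> {a..b}"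
      have 1: "norm (P1 x lam) + norm (P2 x lam) \<le> \<epsilon> / 2" using R1(2)[of lam x] l x by auto
      have 2: "norm (Q1 x (- lam)) + norm (Q2 x (- lam)) \<le> \<epsilon> / 2" using R2(2)[of "- lam" x] l x by auto
      show "norm (\<phi>p x lam) + norm (\<phi>m x lam) \<le> \<epsilon>"
        unfolding \<phi>p_def \<phi>m_def using 1 2 norm_triangle_ineq[of "P1 x lam" "P2 x lam"] norm_triangle_ineq[of "Q1 x (- lam)" "Q2 x (- lam)"] by linarith
      show "norm (\<psi>p x lam) + norm (\<psi>m x lam) \<le> \<epsilon>"
        unfolding \<psi>p_def \<psi>m_def using 1 2 norm_triangle_ineq4[of "P1 x lam" "P2 x lam"] norm_triangle_ineq4[of "Q1 x (- lam)" "Q2 x (- lam)"] by linarith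
    qed
  qed
  obtain R0 where R0: "R0 > 0" "\<And>lam x. lam \<in> \<H> \<Longrightarrow> norm lam > R0 \<Longrightarrow> x \<in> {a..b} \<Longrightarrow> norm (\<phi>p x lam) + norm (\<phi>m x lam) \<le> 1 / 100"
    using small[of "1 / 100"] by auto
  \<comment> \<open>\<open>R0\<close> keeps the amplitudes within the 1/100 that linear independence
    asks for, and \<open>1 / (8 * T b)\<close> leaves room in the interval for its comparison
    point.\<close>
  define R where "R = max R0 (1 / (8 * T b))"
  have "R > 0" using R0(1) by (simp add: R_def)
  have E_exp: "E x * exp v = of_real (1 / sqrt (r x * \<rho> x)) * exp (1/2 * integral {a..x} (\<lambda>\<tau>. p \<tau> / of_real ((r \<tau>)\<^sup>2)) + v)" for x v
    unfolding E_def exp_add by (simp only: mult.assoc)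
  have \<kappa>E: "of_real (\<kappa> x) * (E x * exp v) = of_real (sqrt (\<rho> x / (r x) ^ 3)) * exp (1/2 * integral {a..x} (\<lambda>\<tau>. p \<tau> / of_real ((r \<tau>)\<^sup>2)) + v)"
    if x: "x \<in> {a..b}" for x v
  proof -
    have "\<kappa> x * (1 / sqrt (r x * \<rho> x)) = sqrt ((\<rho> x / r x)\<^sup>2 / (r x * \<rho> x))"
      unfolding \<kappa>_def using r0[OF x] \<rho>0[OF x] by (simp add: real_sqrt_divide real_sqrt_mult)
    also have "(\<rho> x / r x)\<^sup>2 / (r x * \<rho> x) = \<rho> x / (r x) ^ 3"
      using r0[OF x] \<rho>0[OF x] by (simp add: power2_eq_square power3_eq_cube field_simps)
    finally have k: "\<kappa> x * (1 / sqrt (r x * \<rho> x)) = sqrt (\<rho> x / (r x) ^ 3)" .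
    show ?thesis unfolding E_exp k[symmetric] of_real_mult by (simp only: mult.assoc)
  qed
  have hol: "(\<lambda>lam. \<phi>p x lam) holomorphic_on - {0}" "(\<lambda>lam. \<phi>m x lam) holomorphic_on - {0}"
    "(\<lambda>lam. \<psi>p x lam) holomorphic_on - {0}" "(\<lambda>lam. \<psi>m x lam) holomorphic_on - {0}" if x: "x \<in> {a..b}" for x
  proof -
    have p: "(\<lambda>lam. P1 x lam) holomorphic_on - {0}" "(\<lambda>lam. P2 x lam) holomorphic_on - {0}"
      using P x unfolding amplitudes_def by blast+
    have q: "(\<lambda>lam. Q1 x lam) holomorphic_on - {0}" "(\<lambda>lam. Q2 x lam) holomorphic_on - {0}"
      using Q x unfolding amplitudes_def by blast+
    have um: "uminus holomorphic_on - {0 :: complex}" "uminus ` (- {0 :: complex}) \<subseteq> - {0}" by (auto intro!: holomorphic_intros)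
    have q': "(\<lambda>lam. Q1 x (- lam)) holomorphic_on - {0}" "(\<lambda>lam. Q2 x (- lam)) holomorphic_on - {0}"
      using holomorphic_on_compose_gen[OF um(1) q(1) um(2)] holomorphic_on_compose_gen[OF um(1) q(2) um(2)] by (simp_all add: o_def)
    show "(\<lambda>lam. \<phi>p x lam) holomorphic_on - {0}" "(\<lambda>lam. \<phi>m x lam) holomorphic_on - {0}"
      "(\<lambda>lam. \<psi>p x lam) holomorphic_on - {0}" "(\<lambda>lam. \<psi>m x lam) holomorphic_on - {0}"
      unfolding \<phi>p_def \<phi>m_def \<psi>p_def \<psi>m_def by (intro holomorphic_intros p q')+
  qed
  have an: "f analytic_on {lam\<in>\<H>. cmod lam > R}" if "f holomorphic_on - {0}" for f :: "complex \<Rightarrow> complex"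
  proof (rule analytic_on_subset)
    show "f analytic_on - {0}" using that by (simp add: analytic_on_open open_Compl)
    show "{lam\<in>\<H>. cmod lam > R} \<subseteq> - {0}" using \<open>R > 0\<close> by auto
  qed
  show ?thesis
  proof (rule exI[of _ R], intro conjI, rule \<open>R > 0\<close>,
      rule exI[of _ yp], rule exI[of _ ym], rule exI[of _ yp1], rule exI[of _ ym1],
      rule exI[of _ \<phi>p], rule exI[of _ \<phi>m], rule exI[of _ \<psi>p], rule exI[of _ \<psi>m], intro conjI ballI impI)
    fix lam assume l: "lam \<in> \<H>" "R < cmod lam"
    then have "norm lam > 0" using \<open>R > 0\<close> by linarith
    moreover have "norm lam > R0" "norm lam \<ge> 1 / (8 * T b)" using l(2) unfolding R_def by linarith+
    ultimately have lam: "lam \<noteq> 0" "- lam \<noteq> 0" "norm lam > R0" "norm lam \<ge> 1 / (8 * T b)" by auto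
    show "solution_with_quasi_deriv a b r \<rho> p h lam (\<lambda>x. yp x lam) (\<lambda>x. yp1 x lam)"
      unfolding yp_def yp1_def \<phi>p_def \<psi>p_def by (rule amplitudes_solution[OF P lam(1)])
    have "solution_with_quasi_deriv a b r \<rho> p h (- lam) (\<lambda>x. ym x lam) (\<lambda>x. ym1 x lam)"
      by (rule solution_cong[OF amplitudes_solution[OF Q lam(2)]]) (simp_all add: ym_def ym1_def \<phi>m_def \<psi>m_def)
    then show "solution_with_quasi_deriv a b r \<rho> p h lam (\<lambda>x. ym x lam) (\<lambda>x. ym1 x lam)"
      unfolding solution_with_quasi_deriv_def by simp
    show "lin_indep_on a b (\<lambda>x. yp x lam) (\<lambda>x. ym x lam)"
      unfolding yp_def ym_def
    proof (rule lin_indep_phases[OF lam(4,1)])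
      fix x assume "x \<in> {a..b}"
      from R0(2)[OF l(1) lam(3) this] show "norm (\<phi>p x lam) \<le> 1 / 100" "norm (\<phi>m x lam) \<le> 1 / 100"
        using norm_ge_zero[of "\<phi>p x lam"] norm_ge_zero[of "\<phi>m x lam"] by linarith+
    qed
    fix x assume x: "x \<in> {a..b}"
    show "yp x lam = of_real (1 / sqrt (r x * \<rho> x))
              * exp (1/2 * integral {a..x} (\<lambda>\<tau>. p \<tau> / of_real ((r \<tau>)\<^sup>2))
                     + \<i> * lam * of_real (integral {a..x} (\<lambda>\<tau>. \<rho> \<tau> / r \<tau>)))
              * (1 + \<phi>p x lam)"
      unfolding yp_def E_exp tvar_def ..
    show "ym x lam = of_real (1 / sqrt (r x * \<rho> x))
              * exp (1/2 * integral {a..x} (\<lambda>\<tau>. p \<tau> / of_real ((r \<tau>)\<^sup>2))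
                     - \<i> * lam * of_real (integral {a..x} (\<lambda>\<tau>. \<rho> \<tau> / r \<tau>)))
              * (1 + \<phi>m x lam)"
      unfolding ym_def E_exp tvar_def by (simp only: add_uminus_conv_diff)
    have "yp1 x lam = \<i> * lam * (of_real (\<kappa> x) * (E x * exp (\<i> * lam * of_real (T x)))) * (1 + \<psi>p x lam)"
      unfolding yp1_def by (simp only: mult_ac)
    then show "yp1 x lam = \<i> * lam * of_real (sqrt (\<rho> x / (r x) ^ 3))
              * exp (1/2 * integral {a..x} (\<lambda>\<tau>. p \<tau> / of_real ((r \<tau>)\<^sup>2))
                     + \<i> * lam * of_real (integral {a..x} (\<lambda>\<tau>. \<rho> \<tau> / r \<tau>)))
              * (1 + \<psi>p x lam)"
      unfolding \<kappa>E[OF x] tvar_def by (simp only: mult.assoc)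
    have "ym1 x lam = - \<i> * lam * (of_real (\<kappa> x) * (E x * exp (- (\<i> * lam * of_real (T x))))) * (1 + \<psi>m x lam)"
      unfolding ym1_def by (simp only: mult_ac)
    then show "ym1 x lam = - \<i> * lam * of_real (sqrt (\<rho> x / (r x) ^ 3))
              * exp (1/2 * integral {a..x} (\<lambda>\<tau>. p \<tau> / of_real ((r \<tau>)\<^sup>2))
                     - \<i> * lam * of_real (integral {a..x} (\<lambda>\<tau>. \<rho> \<tau> / r \<tau>)))
              * (1 + \<psi>m x lam)"
      unfolding \<kappa>E[OF x] tvar_def by (simp only: mult.assoc add_uminus_conv_diff)
  next
    show "uniform_limit {a..b} (\<lambda>lam x. cmod (\<phi>p x lam) + cmod (\<phi>m x lam)) (\<lambda>_. 0) (inf at_infinity (principal \<H>))"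
    proof (rule uniform_limit_0)
      fix \<epsilon> :: real assume "\<epsilon> > 0"
      from small[OF this] show "\<exists>R>0. \<forall>lam\<in>\<H>. norm lam > R \<longrightarrow> (\<forall>x\<in>{a..b}. \<bar>cmod (\<phi>p x lam) + cmod (\<phi>m x lam)\<bar> \<le> \<epsilon>)"
        by (auto simp: abs_of_nonneg)
    qed
    show "uniform_limit {a..b} (\<lambda>lam x. cmod (\<psi>p x lam) + cmod (\<psi>m x lam)) (\<lambda>_. 0) (inf at_infinity (principal \<H>))"
    proof (rule uniform_limit_0)
      fix \<epsilon> :: real assume "\<epsilon> > 0"
      from small[OF this] show "\<exists>R>0. \<forall>lam\<in>\<H>. norm lam > R \<longrightarrow> (\<forall>x\<in>{a..b}. \<bar>cmod (\<psi>p x lam) + cmod (\<psi>m x lam)\<bar> \<le> \<epsilon>)"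
        by (auto simp: abs_of_nonneg)
    qed
  next
    fix x assume x: "x \<in> {a..b}"
    show "(\<lambda>lam. \<phi>p x lam) analytic_on {lam\<in>\<H>. cmod lam > R}" by (rule an[OF hol(1)[OF x]])
    show "(\<lambda>lam. \<phi>m x lam) analytic_on {lam\<in>\<H>. cmod lam > R}" by (rule an[OF hol(2)[OF x]])
    show "(\<lambda>lam. \<psi>p x lam) analytic_on {lam\<in>\<H>. cmod lam > R}" by (rule an[OF hol(3)[OF x]])
    show "(\<lambda>lam. \<psi>m x lam) analytic_on {lam\<in>\<H>. cmod lam > R}" by (rule an[OF hol(4)[OF x]])
  qed
qed

end

theorem mainTheorem2:
  fixes a b :: real
    and r \<rho> :: "real \<Rightarrow> real"
    and p u h :: "real \<Rightarrow> complex"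
    and q :: distribution
  assumes "a < b"
    and "\<And>x. x \<in> {a..b} \<Longrightarrow> r x > 0"
    and "\<And>x. x \<in> {a..b} \<Longrightarrow> \<rho> x > 0"
    and "abs_cont_on a b r"
    and "abs_cont_on a b \<rho>"
    and "p absolutely_integrable_on {a..b}"
    and "q \<in> W2_minus1 a b"
    and "L2_on a b u"
    and "distr_antideriv a b u q"
    and "(\<lambda>x. of_real (deriv \<rho> x) * u x) absolutely_integrable_on {a..b}"
    and "(\<lambda>x. of_real (deriv r x) * u x) absolutely_integrable_on {a..b}"
    and "(\<lambda>x. p x * u x) absolutely_integrable_on {a..b}"
    and "L2_on a b h"
    and "distr_antideriv a b h (leibniz_product a b (\<lambda>x. 1 / (r x * \<rho> x)) u)"
  shows "\<forall>s>0. \<forall>\<H> \<in> {{lam. Im lam \<ge> - s}, {lam. Im lam \<le> s}}.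
    \<exists>R>0. \<exists>(yp :: real \<Rightarrow> complex \<Rightarrow> complex) ym yp1 ym1
           (\<phi>p :: real \<Rightarrow> complex \<Rightarrow> complex) \<phi>m (\<psi>p :: real \<Rightarrow> complex \<Rightarrow> complex) \<psi>m.
      (\<forall>lam\<in>\<H>. cmod lam > R \<longrightarrow>
         solution_with_quasi_deriv a b r \<rho> p h lam (\<lambda>x. yp x lam) (\<lambda>x. yp1 x lam) \<and>
         solution_with_quasi_deriv a b r \<rho> p h lam (\<lambda>x. ym x lam) (\<lambda>x. ym1 x lam) \<and>
         lin_indep_on a b (\<lambda>x. yp x lam) (\<lambda>x. ym x lam) \<and>
         (\<forall>x\<in>{a..b}.
            yp x lam = of_real (1 / sqrt (r x * \<rho> x))
              * exp (1/2 * integral {a..x} (\<lambda>\<tau>. p \<tau> / of_real ((r \<tau>)\<^sup>2))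
                     + \<i> * lam * of_real (integral {a..x} (\<lambda>\<tau>. \<rho> \<tau> / r \<tau>)))
              * (1 + \<phi>p x lam) \<and>
            ym x lam = of_real (1 / sqrt (r x * \<rho> x))
              * exp (1/2 * integral {a..x} (\<lambda>\<tau>. p \<tau> / of_real ((r \<tau>)\<^sup>2))
                     - \<i> * lam * of_real (integral {a..x} (\<lambda>\<tau>. \<rho> \<tau> / r \<tau>)))
              * (1 + \<phi>m x lam) \<and>
            yp1 x lam = \<i> * lam * of_real (sqrt (\<rho> x / (r x) ^ 3))
              * exp (1/2 * integral {a..x} (\<lambda>\<tau>. p \<tau> / of_real ((r \<tau>)\<^sup>2))
                     + \<i> * lam * of_real (integral {a..x} (\<lambda>\<tau>. \<rho> \<tau> / r \<tau>)))
              * (1 + \<psi>p x lam) \<and>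
            ym1 x lam = - \<i> * lam * of_real (sqrt (\<rho> x / (r x) ^ 3))
              * exp (1/2 * integral {a..x} (\<lambda>\<tau>. p \<tau> / of_real ((r \<tau>)\<^sup>2))
                     - \<i> * lam * of_real (integral {a..x} (\<lambda>\<tau>. \<rho> \<tau> / r \<tau>)))
              * (1 + \<psi>m x lam))) \<and>
      (\<forall>x\<in>{a..b}.
         (\<lambda>lam. \<phi>p x lam) analytic_on {lam\<in>\<H>. cmod lam > R} \<and>
         (\<lambda>lam. \<phi>m x lam) analytic_on {lam\<in>\<H>. cmod lam > R} \<and>
         (\<lambda>lam. \<psi>p x lam) analytic_on {lam\<in>\<H>. cmod lam > R} \<and>
         (\<lambda>lam. \<psi>m x lam) analytic_on {lam\<in>\<H>. cmod lam > R}) \<and>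
      uniform_limit {a..b} (\<lambda>lam x. cmod (\<phi>p x lam) + cmod (\<phi>m x lam)) (\<lambda>_. 0)
        (inf at_infinity (principal \<H>)) \<and>
      uniform_limit {a..b} (\<lambda>lam x. cmod (\<psi>p x lam) + cmod (\<psi>m x lam)) (\<lambda>_. 0)
        (inf at_infinity (principal \<H>))"
proof (intro allI impI ballI, goal_cases)
  case (1 s \<H>)
  interpret sturm_liouville a b r \<rho> p u h
    by unfold_locales (use assms in auto)
  obtain F1 F2 where F: "amplitudes F1 F2"
    "\<And>\<epsilon>. \<epsilon> > 0 \<Longrightarrow> \<exists>R>0. \<forall>lam t. norm lam > R \<longrightarrow> Im lam \<le> s \<longrightarrow> t \<in> {a..b} \<longrightarrow> norm (F1 t lam) + norm (F2 t lam) \<le> \<epsilon>"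
    using amplitudes_forward[of s] 1(1) by auto
  obtain B1 B2 where B: "amplitudes B1 B2"
    "\<And>\<epsilon>. \<epsilon> > 0 \<Longrightarrow> \<exists>R>0. \<forall>lam t. norm lam > R \<longrightarrow> - s \<le> Im lam \<longrightarrow> t \<in> {a..b} \<longrightarrow> norm (B1 t lam) + norm (B2 t lam) \<le> \<epsilon>"
    using amplitudes_backward[of s] 1(1) by auto
  from 1(2) consider "\<H> = {lam. Im lam \<ge> - s}" | "\<H> = {lam. Im lam \<le> s}" by blast
  then show ?case
  proof cases
    case upper: 1
    \<comment> \<open>For Im lam \<ge> -s the plus solution comes from the amplitudes built at
      \<open>b\<close>; \<open>- lam\<close> then has imaginary part at most \<open>s\<close>, so
      the minus solution uses those built at \<open>a\<close>. In the other half-plane the roles are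
      exchanged.\<close>
    show ?thesis by (rule asymptotics[OF B(1) F(1)]) (use B(2) F(2) in \<open>simp_all add: upper\<close>)
  next
    case lower: 2
    have *: "- Im lam \<le> s \<longleftrightarrow> - s \<le> Im lam" for lam by linarith
    show ?thesis by (rule asymptotics[OF F(1) B(1)]) (use B(2) F(2) in \<open>simp_all add: lower *\<close>)
  qed
qed

end
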